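(* There exists an interactive protocol between a verifier $V$ and a prover $P$ where, given $\epsilon,\delta>0$, $t\in\mathbb{N}$, and membership query access to $f:\mathbb{F}_2^n\to\{-1,1\}$, the verifier makes $\mathrm{poly}(t,1/\epsilon,\log(1/\delta))$ membership queries to $f$ (independent of $n$) and outputs $\Lambda$, which is either a subset of $\mathbb{F}_2^n$ of size $t$ or $\bot$ (reject). The communication complexity is $t\cdot n$, the interaction consists only of a proof (a single message from the prover), and the verifier's and honest prover's running times are $\mathrm{poly}(n,t,1/\epsilon,\log(1/\delta))$. Moreover: (Completeness) there exists an honest prover $P^*$ such that the output $\Lambda$ satisfies $\Pr[\Lambda\text{ is }\tfrac{\epsilon}{3}\text{-top}]\ge1-\delta-o(1)$; (Soundness) for every (possibly unbounded) prover $P$, the output $\Lambda$ satisfies $\Pr[(\Lambda\neq\bot)\wedge(\Lambda\text{ is not }\epsilon\text{-top})]\le\delta+o(1)$.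
   Context: For $f:\mathbb{F}_2^n\to\{-1,1\}$, $\hat f(\gamma)=\mathbb{E}_{x}[f(x)(-1)^{\langle\gamma,x\rangle}]$, $x$ uniform in $\mathbb{F}_2^n$. A set $\Gamma\subseteq\mathbb{F}_2^n$ is $\epsilon$-top with respect to $f$ if for all $\alpha\in\mathbb{F}_2^n\setminus\Gamma$ and all $\beta\in\Gamma$, $|\hat f(\alpha)|\le|\hat f(\beta)|+\epsilon$. The term $o(1)$ is with respect to $n\to\infty$; probabilities are over the parties' randomness. *)

theory Defs
  imports "Jordan_Normal_Form.Matrix" "HOL-Library.Z2" "HOL-Library.Log_Nat"
    "HOL-Probability.SPMF"
begin

hide_type (open) Finite_Cartesian_Product.vec
hide_const (open) Finite_Cartesian_Product.vec

section \<open>Fourier coefficients and top sets\<close>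

text \<open>The space $\mathbb{F}_2^n$ is the carrier set \<^term>\<open>carrier_vec n :: bit vec set\<close>.\<close>

definition fourier :: "nat \<Rightarrow> (bit vec \<Rightarrow> real) \<Rightarrow> bit vec \<Rightarrow> real" where
  "fourier n f \<gamma> = measure_pmf.expectation (pmf_of_set (carrier_vec n))
     (\<lambda>x. f x * (if scalar_prod \<gamma> x = 0 then 1 else - 1))"

definition is_top :: "nat \<Rightarrow> (bit vec \<Rightarrow> real) \<Rightarrow> real \<Rightarrow> bit vec set \<Rightarrow> bool" where
  "is_top n f \<epsilon> \<Gamma> \<longleftrightarrow> \<Gamma> \<subseteq> carrier_vec n \<and>
     (\<forall>\<alpha>\<in>carrier_vec n - \<Gamma>. \<forall>\<beta>\<in>\<Gamma>. \<bar>fourier n f \<alpha>\<bar> \<le> \<bar>fourier n f \<beta>\<bar> + \<epsilon>)"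


section \<open>Randomized oracle programs\<close>

text \<open>
  Algorithms are programs of a random access machine under the logarithmic cost measure, which is
  polynomially equivalent to Turing machines. The memory consists of arrays of natural numbers:
  \<open>m a i\<close> is the content of cell \<open>i\<close> of array \<open>a\<close>. Array names are constants of the program text, so
  a program uses finitely many arrays; the index is computed.
\<close>

type_synonym mem = "nat \<Rightarrow> nat \<Rightarrow> nat"

datatype binop = Plus | Minus | Times | Div | Mod | Less | Eq

datatype expr = Const nat | Cell nat expr | Op binop expr expr

fun eval_op :: "binop \<Rightarrow> nat \<Rightarrow> nat \<Rightarrow> nat" where
  "eval_op Plus x y = x + y"
| "eval_op Minus x y = x - y"
| "eval_op Times x y = x * y"
| "eval_op Div x y = x div y"
| "eval_op Mod x y = x mod y"
| "eval_op Less x y = of_bool (x < y)"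
| "eval_op Eq x y = of_bool (x = y)"

fun eval :: "mem \<Rightarrow> expr \<Rightarrow> nat" where
  "eval m (Const k) = k"
| "eval m (Cell a e) = m a (eval m e)"
| "eval m (Op b e1 e2) = eval_op b (eval m e1) (eval m e2)"

text \<open>Every node of an expression costs one unit plus the binary length of its value; hence
  multiplication cannot build large numbers cheaply.\<close>

fun cost :: "mem \<Rightarrow> expr \<Rightarrow> nat" where
  "cost m (Const k) = 1 + floorlog 2 k"
| "cost m (Cell a e) = 1 + floorlog 2 (m a (eval m e)) + cost m e"
| "cost m (Op b e1 e2) =
     1 + floorlog 2 (eval_op b (eval m e1) (eval m e2)) + cost m e1 + cost m e2"

text \<open>
  \<^item> \<open>Assign a i e\<close> stores the value of \<open>e\<close> in cell \<open>i\<close> of array \<open>a\<close>.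
  \<^item> \<open>Flip a i\<close> stores a fresh uniformly random bit in cell \<open>i\<close> of array \<open>a\<close>.
  \<^item> \<open>Query a i q\<close> is a membership query at the vector whose coordinates are the parities of the
    cells \<open>0, \<dots>, n - 1\<close> of array \<open>q\<close>; the answer, \<open>0\<close> for the value $1$ and \<open>1\<close> for the value $-1$,
    is stored in cell \<open>i\<close> of array \<open>a\<close>.

  In conditionals and loops, nonzero means true.
\<close>

datatype com =
    Skip
  | Assign nat expr expr
  | Flip nat expr
  | Query nat expr nat
  | Seq com com
  | If expr com com
  | While expr com

record config =
  memory :: mem
  steps :: nat
  queries :: nat

definition charge :: "nat \<Rightarrow> config \<Rightarrow> config" where
  "charge k s = s\<lparr>steps := steps s + k\<rparr>"

definition store :: "nat \<Rightarrow> nat \<Rightarrow> nat \<Rightarrow> config \<Rightarrow> config" where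
  "store a i v s = s\<lparr>memory := (memory s)(a := (memory s a)(i := v))\<rparr>"

text \<open>A block of \<open>n\<close> cells starting at cell \<open>k\<close>, read as a vector over $\mathbb{F}_2$ (the coercion
  \<^const>\<open>of_nat\<close> into \<^typ>\<open>bit\<close> is the parity).\<close>

definition read_vec :: "nat \<Rightarrow> (nat \<Rightarrow> nat) \<Rightarrow> nat \<Rightarrow> bit vec" where
  "read_vec n A k = Matrix.vec n (\<lambda>i. of_nat (A (k + i)))"

text \<open>Distribution of the final configuration of a program with oracle \<open>f\<close> on $\mathbb{F}_2^n$; the
  missing probability mass is the probability of divergence.\<close>

partial_function (spmf) exec ::
  "nat \<Rightarrow> (bit vec \<Rightarrow> real) \<Rightarrow> com \<Rightarrow> config \<Rightarrow> config spmf" where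
  "exec n f c s = (case c of
      Skip \<Rightarrow> return_spmf (charge 1 s)
    | Assign a i e \<Rightarrow> return_spmf
        (charge (1 + cost (memory s) i + cost (memory s) e)
          (store a (eval (memory s) i) (eval (memory s) e) s))
    | Flip a i \<Rightarrow> bind_spmf coin_spmf (\<lambda>b. return_spmf
        (charge (1 + cost (memory s) i) (store a (eval (memory s) i) (of_bool b) s)))
    | Query a i q \<Rightarrow> return_spmf
        (charge (1 + n + cost (memory s) i)
          (store a (eval (memory s) i)
            (if f (read_vec n (memory s q) 0) = 1 then 0 else 1)
            (s\<lparr>queries := queries s + 1\<rparr>)))
    | Seq c1 c2 \<Rightarrow> bind_spmf (exec n f c1 s) (exec n f c2)
    | If e c1 c2 \<Rightarrow>
        (if eval (memory s) e \<noteq> 0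
         then exec n f c1 (charge (1 + cost (memory s) e) s)
         else exec n f c2 (charge (1 + cost (memory s) e) s))
    | While e c1 \<Rightarrow>
        (if eval (memory s) e \<noteq> 0
         then bind_spmf (exec n f c1 (charge (1 + cost (memory s) e) s)) (exec n f (While e c1))
         else return_spmf (charge (1 + cost (memory s) e) s)))"


section \<open>Protocols consisting of a single message of the prover\<close>

text \<open>Messages are bit strings. On an array they are represented like on a tape: a cell contains
  \<open>0\<close> (blank) or \<open>1 + b\<close> for a bit \<open>b\<close>, and the first blank ends the string.\<close>

type_synonym message = "bit list"

definition tape :: "message \<Rightarrow> nat \<Rightarrow> nat" where
  "tape w i = (if i < length w then (if w ! i = 0 then 1 else 2) else 0)"

definition untape :: "(nat \<Rightarrow> nat) \<Rightarrow> message" where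
  "untape A = map (\<lambda>i. if A i = 1 then 0 else 1) [0..<(LEAST i. A i = 0)]"

text \<open>
  Array \<open>0\<close> holds \<open>n\<close>, \<open>t\<close> and the accuracy and confidence parameters, array \<open>1\<close> holds the received
  message, and all other cells are \<open>0\<close>. Real numbers cannot be given to a machine; it receives
  $\lceil 1/\epsilon \rceil$ and $\lceil \log_2 (1/\delta) \rceil$ (\<open>0\<close> if $\delta \ge 1$), i.e.
  only the guarantee that $\epsilon \ge 1/a$ and $\delta \ge 2^{-b}$ for the numbers \<open>a\<close> and \<open>b\<close>
  it is given.
\<close>

definition start :: "nat \<Rightarrow> nat \<Rightarrow> real \<Rightarrow> real \<Rightarrow> message \<Rightarrow> config" where
  "start n t \<epsilon> \<delta> w = \<lparr>memory = (\<lambda>_ _. 0)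
      (0 := (\<lambda>_. 0)(0 := n, 1 := t, 2 := nat \<lceil>1 / \<epsilon>\<rceil>, 3 := nat \<lceil>log 2 (1 / \<delta>)\<rceil>),
       1 := tape w),
     steps = 0, queries = 0\<rparr>"

definition run :: "com \<Rightarrow> nat \<Rightarrow> nat \<Rightarrow> real \<Rightarrow> real \<Rightarrow> (bit vec \<Rightarrow> real) \<Rightarrow> message \<Rightarrow> config spmf" where
  "run c n t \<epsilon> \<delta> f w = exec n f c (start n t \<epsilon> \<delta> w)"

text \<open>The verifier rejects (\<^const>\<open>None\<close>) by leaving \<open>0\<close> in cell \<open>0\<close> of array \<open>2\<close>. Otherwise its
  output is the set of the \<open>t\<close> vectors written consecutively in array \<open>3\<close>. These need not be
  distinct, so that the set has size \<open>t\<close> is a property of the verifier.\<close>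

definition verifier_output :: "nat \<Rightarrow> nat \<Rightarrow> config \<Rightarrow> bit vec set option" where
  "verifier_output n t s =
     (if memory s 2 0 = 0 then None
      else Some ((\<lambda>j. read_vec n (memory s 3) (j * n)) ` {..<t}))"

definition prover_message :: "config \<Rightarrow> message" where
  "prover_message s = untape (memory s 1)"

text \<open>An arbitrary prover is any randomized function from the parameters and \<open>f\<close> to messages of any
  length. Missing mass means that no message is sent.\<close>

type_synonym prover =
  "nat \<Rightarrow> nat \<Rightarrow> real \<Rightarrow> real \<Rightarrow> (bit vec \<Rightarrow> real) \<Rightarrow> message spmf"

definition program_prover :: "com \<Rightarrow> prover" where
  "program_prover c n t \<epsilon> \<delta> f = map_spmf prover_message (run c n t \<epsilon> \<delta> f [])"

text \<open>Distribution of the output $\Lambda$; the coins of the two parties are independent.\<close>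

definition interaction ::
  "com \<Rightarrow> prover \<Rightarrow> nat \<Rightarrow> nat \<Rightarrow> real \<Rightarrow> real \<Rightarrow> (bit vec \<Rightarrow> real) \<Rightarrow> bit vec set option spmf" where
  "interaction V P n t \<epsilon> \<delta> f =
     bind_spmf (P n t \<epsilon> \<delta> f) (\<lambda>w. map_spmf (verifier_output n t) (run V n t \<epsilon> \<delta> f w))"

text \<open>$\log (1/\delta)$, truncated at $0$ so that polynomial bounds also make sense for
  $\delta \ge 1$.\<close>

definition log_inv :: "real \<Rightarrow> real" where
  "log_inv \<delta> = max 0 (log 2 (1 / \<delta>))"

end

theory Submission
  imports Defs
begin

text \<open>
  Random vectors \<open>x 1, \<dots>, x k\<close> distribute the characters \<open>\<gamma>\<close> over \<open>2 ^ k\<close> buckets, according to the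
  values \<open>\<langle>\<gamma>, x i\<rangle>\<close>. The Fourier weight of the bucket \<open>c\<close>, the sum of the squares of its
  coefficients, is the expectation over \<open>y\<close> of \<open>f y\<close> times the average over \<open>d\<close> of
  \<open>f (y + d 1 x 1 + \<dots> + d k x k) * (- 1) ^ \<langle>c, d\<rangle>\<close>, so it can be estimated with a number of queries
  that does not depend on \<open>n\<close>. By Parseval, if \<open>2 ^ k\<close> is large compared with \<open>1 / \<epsilon> ^ 4\<close>, the
  weight of each bucket is probably close to its largest square.

  The verifier accepts in a round if no bucket without a claimed character is much heavier than a
  bucket with one. Collisions can only make a bad claim look good when a missing heavy character
  falls into a bucket hit by the claim, which has probability at most \<open>t / 2 ^ k\<close>. A majority over
  \<open>2 * log (1 / \<delta>)\<close> rounds brings the error down to \<open>\<delta>\<close>.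

  The honest prover reads off the character dominating a heavy bucket from the signs of the
  same estimates with \<open>y\<close> shifted by each unit vector, pads the list with further characters and
  sends the \<open>t\<close> heaviest. Its failure probability \<open>1 / (n + 1)\<close> is the error term \<open>\<eta> n\<close>.
\<close>

section \<open>Deterministic loop programs\<close>

text \<open>Squares are compared instead of absolute values because bucket weights are sums of
  squares: with \<theta> = 1 / a^2 \<le> \<epsilon>^2, a gap of at most \<theta> between squares
  implies a gap of at most \<epsilon> between absolute values. A list with squared gap 5 * \<theta>
  / 64 is \<epsilon> / 3-top, since 5 / 64 \<le> 1 / 9, and probably passes a round; a list whose
  squared gap exceeds \<theta> probably fails it. The tolerance \<theta> / 8 lies in between.

  The verifier never decodes anything. It uses only the plain weights of 2 ^ k buckets, so its union
  bounds run over buckets and claims and no factor n enters. The prover needs n + 1 estimates per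
  bucket.

  The other obstacle is that \<open>exec\<close> is a partial function into distributions. All coins
  are therefore flipped onto a tape before the main computation, which is then a deterministic
  program of bounded loops and denotes a function on memories. Probabilities become averages over
  finitely many tapes, and time bounds follow from the syntax of the programs.\<close>

lemma exec_simps:
  "exec n f Skip s = return_spmf (charge 1 s)"
  "exec n f (Assign a i e) s = return_spmf
        (charge (1 + cost (memory s) i + cost (memory s) e)
          (store a (eval (memory s) i) (eval (memory s) e) s))"
  "exec n f (Flip a i) s = bind_spmf coin_spmf (\<lambda>b. return_spmf
        (charge (1 + cost (memory s) i) (store a (eval (memory s) i) (of_bool b) s)))"
  "exec n f (Query a i q) s = return_spmf
        (charge (1 + n + cost (memory s) i)
          (store a (eval (memory s) i)
            (if f (read_vec n (memory s q) 0) = 1 then 0 else 1)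
            (s\<lparr>queries := queries s + 1\<rparr>)))"
  "exec n f (Seq c1 c2) s = bind_spmf (exec n f c1 s) (exec n f c2)"
  "exec n f (If e c1 c2) s =
        (if eval (memory s) e \<noteq> 0
         then exec n f c1 (charge (1 + cost (memory s) e) s)
         else exec n f c2 (charge (1 + cost (memory s) e) s))"
  "exec n f (While e c1) s =
        (if eval (memory s) e \<noteq> 0
         then bind_spmf (exec n f c1 (charge (1 + cost (memory s) e) s)) (exec n f (While e c1))
         else return_spmf (charge (1 + cost (memory s) e) s))"
  by (subst exec.simps, simp)+

lemma charge_sel [simp]: "memory (charge k s) = memory s" "steps (charge k s) = steps s + k"
  "queries (charge k s) = queries s"
  by (simp_all add: charge_def)

definition upd :: "mem \<Rightarrow> nat \<Rightarrow> nat \<Rightarrow> nat \<Rightarrow> mem" where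
  "upd m a i v = m(a := (m a)(i := v))"

lemma upd_same: "upd m a i v a = (m a)(i := v)"
  and upd_same_same [simp]: "upd m a i v a i = v"
  and upd_other [simp]: "a' \<noteq> a \<Longrightarrow> upd m a i v a' = m a'"
  and upd_same_other [simp]: "i' \<noteq> i \<Longrightarrow> upd m a i v a i' = m a i'"
  by (simp_all add: upd_def)

lemma store_sel [simp]: "memory (store a i v s) = upd (memory s) a i v"
  "steps (store a i v s) = steps s" "queries (store a i v s) = queries s"
  by (simp_all add: store_def upd_def)

section \<open>Loop programs and their meaning as functions on memories\<close>

datatype prog =
    PAssign nat expr expr
  | PQuery nat expr nat
  | PSeq prog prog
  | PIf expr prog prog
  | PFor nat expr prog

abbreviation reg :: "nat \<Rightarrow> expr" where "reg a \<equiv> Cell a (Const 0)"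

text \<open>The fragment has no coins and no unbounded loops, so each of its programs denotes a
  total function; its loops are unfolded once, in \<open>exec_compile\<close>. The loop counter is
  cell 0 of array \<open>x\<close>.\<close>

fun compile :: "prog \<Rightarrow> com" where
  "compile (PAssign a i e) = Assign a i e"
| "compile (PQuery a i q) = Query a i q"
| "compile (PSeq p q) = Seq (compile p) (compile q)"
| "compile (PIf e p q) = If e (compile p) (compile q)"
| "compile (PFor x e p) = Seq (Assign x (Const 0) (Const 0))
     (While (Op Less (reg x) e)
       (Seq (compile p) (Assign x (Const 0) (Op Plus (reg x) (Const 1)))))"

fun den :: "nat \<Rightarrow> (bit vec \<Rightarrow> real) \<Rightarrow> prog \<Rightarrow> mem \<Rightarrow> mem" where
  "den n f (PAssign a i e) m = upd m a (eval m i) (eval m e)"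
| "den n f (PQuery a i q) m =
     upd m a (eval m i) (if f (read_vec n (m q) 0) = 1 then 0 else 1)"
| "den n f (PSeq p q) m = den n f q (den n f p m)"
| "den n f (PIf e p q) m = (if eval m e \<noteq> 0 then den n f p m else den n f q m)"
| "den n f (PFor x e p) m =
     ((\<lambda>m. let m' = den n f p m in upd m' x 0 (m' x 0 + 1)) ^^ eval m e) (upd m x 0 0)"

fun arrays :: "expr \<Rightarrow> nat set" where
  "arrays (Const k) = {}"
| "arrays (Cell a e) = insert a (arrays e)"
| "arrays (Op b e1 e2) = arrays e1 \<union> arrays e2"

fun writes :: "prog \<Rightarrow> nat set" where
  "writes (PAssign a i e) = {a}"
| "writes (PQuery a i q) = {a}"
| "writes (PSeq p q) = writes p \<union> writes q"
| "writes (PIf e p q) = writes p \<union> writes q"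
| "writes (PFor x e p) = insert x (writes p)"

text \<open>\<open>den\<close> evaluates a loop bound once, the compiled loop before every
  iteration. The two agree if the body leaves the counter and all arrays of the bound alone.\<close>

fun wf :: "prog \<Rightarrow> bool" where
  "wf (PAssign a i e) = True"
| "wf (PQuery a i q) = True"
| "wf (PSeq p q) = (wf p \<and> wf q)"
| "wf (PIf e p q) = (wf p \<and> wf q)"
| "wf (PFor x e p) = (wf p \<and> x \<notin> writes p \<and> x \<notin> arrays e \<and> writes p \<inter> arrays e = {})"

lemma eval_cong: "(\<And>a. a \<in> arrays e \<Longrightarrow> m a = m' a) \<Longrightarrow> eval m e = eval m' e"
  by (induction e) auto

lemma den_frame: "a \<notin> writes p \<Longrightarrow> den n f p m a = m a"
proof (induction p arbitrary: m)
  case (PFor x e p)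
  have "((\<lambda>m. let m' = den n f p m in upd m' x 0 (m' x 0 + 1)) ^^ k) (upd m x 0 0) a = m a" for k
    by (induction k) (use PFor in \<open>auto simp: Let_def\<close>)
  then show ?case by simp
qed auto

text \<open>The step may assume that all arrays which the body does not write still have their
  initial contents, so the invariants below mention only what a loop changes.\<close>

lemma for_rule:
  assumes "wf (PFor x e p)" and "I 0 (upd m x 0 0)"
    and step: "\<And>i m'. i < eval m e \<Longrightarrow> m' x 0 = i \<Longrightarrow>
      (\<And>a. a \<notin> insert x (writes p) \<Longrightarrow> m' a = m a) \<Longrightarrow> I i m' \<Longrightarrow>
      I (Suc i) (upd (den n f p m') x 0 (Suc i))"
  shows "I (eval m e) (den n f (PFor x e p) m)"
proof -
  define g where "g = (\<lambda>m. let m' = den n f p m in upd m' x 0 (m' x 0 + 1))"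
  have "j \<le> eval m e \<Longrightarrow> I j ((g ^^ j) (upd m x 0 0)) \<and> (g ^^ j) (upd m x 0 0) x 0 = j \<and>
      (\<forall>a. a \<notin> insert x (writes p) \<longrightarrow> (g ^^ j) (upd m x 0 0) a = m a)" for j
  proof (induction j)
    case 0
    then show ?case using assms by auto
  next
    case (Suc j)
    define m' where "m' = (g ^^ j) (upd m x 0 0)"
    have *: "I j m'" "m' x 0 = j" "\<And>a. a \<notin> insert x (writes p) \<Longrightarrow> m' a = m a"
      using Suc unfolding m'_def by auto
    have x: "den n f p m' x 0 = j"
      using assms(1) *(2) by (simp add: den_frame)
    have "(g ^^ Suc j) (upd m x 0 0) = upd (den n f p m') x 0 (Suc j)"
      using x m'_def by (simp add: g_def Let_def)
    moreover have "I (Suc j) (upd (den n f p m') x 0 (Suc j))"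
      using step[of j m'] * Suc.prems by auto
    ultimately show ?case
      using *(3) by (auto simp: den_frame)
  qed
  then show ?thesis by (simp add: g_def)
qed

section \<open>Bounds on steps, queries and memory contents\<close>

fun ops :: "mem \<Rightarrow> prog \<Rightarrow> nat" where
  "ops m (PAssign a i e) = 1"
| "ops m (PQuery a i q) = 1"
| "ops m (PSeq p q) = ops m p + ops m q"
| "ops m (PIf e p q) = 1 + ops m p + ops m q"
| "ops m (PFor x e p) = 2 + eval m e * (2 + ops m p)"

fun qcount :: "mem \<Rightarrow> prog \<Rightarrow> nat" where
  "qcount m (PAssign a i e) = 0"
| "qcount m (PQuery a i q) = 1"
| "qcount m (PSeq p q) = qcount m p + qcount m q"
| "qcount m (PIf e p q) = qcount m p + qcount m q"
| "qcount m (PFor x e p) = eval m e * qcount m p"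

text \<open>The arrays that decide how often loops run. If a program does not write them,
  \<open>ops\<close> and \<open>qcount\<close> can be evaluated once and for all in the initial
  memory.\<close>

fun controls :: "prog \<Rightarrow> nat set" where
  "controls (PAssign a i e) = {}"
| "controls (PQuery a i q) = {}"
| "controls (PSeq p q) = controls p \<union> controls q"
| "controls (PIf e p q) = controls p \<union> controls q"
| "controls (PFor x e p) = arrays e \<union> controls p"

text \<open>A crude polynomial in the largest memory entry: 1 + x + y + x * y is at least the result
  of every operator. Lengths are in turn bounded by values (\<open>floorlog_le\<close>), as only
  polynomial bounds are claimed.\<close>

fun vbound :: "nat \<Rightarrow> expr \<Rightarrow> nat" where
  "vbound B (Const k) = k"
| "vbound B (Cell a e) = B"
| "vbound B (Op b e1 e2) = 1 + vbound B e1 + vbound B e2 + vbound B e1 * vbound B e2"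

fun cbound :: "nat \<Rightarrow> expr \<Rightarrow> nat" where
  "cbound B (Const k) = 1 + k"
| "cbound B (Cell a e) = 1 + B + cbound B e"
| "cbound B (Op b e1 e2) = 1 + vbound B (Op b e1 e2) + cbound B e1 + cbound B e2"

abbreviation mem_le :: "mem \<Rightarrow> nat \<Rightarrow> bool" where "mem_le m B \<equiv> \<forall>a i. m a i \<le> B"

lemma eval_le_vbound: "mem_le m B \<Longrightarrow> eval m e \<le> vbound B e"
proof (induction e)
  case (Op b e1 e2)
  have "x div y \<le> x" "x mod y \<le> x" "x - y \<le> x" for x y :: nat by auto
  then have "eval_op b x y \<le> 1 + x + y + x * y" for x y
    by (cases b) (simp_all add: trans_le_add1 le_SucI)
  then have "eval m (Op b e1 e2) \<le> 1 + eval m e1 + eval m e2 + eval m e1 * eval m e2" by simp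
  also have "\<dots> \<le> vbound B (Op b e1 e2)"
    using Op by (simp add: add_mono mult_mono)
  finally show ?case .
qed auto

lemma floorlog_le: "floorlog 2 x \<le> x"
proof (cases "x = 0")
  case False
  then have "floorlog 2 x \<le> x \<longleftrightarrow> x < 2 ^ x"
    by (simp add: floorlog_le_iff)
  then show ?thesis by simp
qed (simp add: floorlog_def)

lemma cost_le_cbound: "mem_le m B \<Longrightarrow> cost m e \<le> cbound B e"
proof (induction e)
  case (Const k)
  then show ?case using floorlog_le[of k] by simp
next
  case (Cell a e)
  then have "floorlog 2 (m a (eval m e)) \<le> B"
    using floorlog_le le_trans by blast
  with Cell show ?case by simp
next
  case (Op b e1 e2)
  have "floorlog 2 (eval m (Op b e1 e2)) \<le> vbound B (Op b e1 e2)"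
    using floorlog_le eval_le_vbound[OF Op.prems] le_trans by blast
  with Op show ?case by simp
qed

fun ubound :: "nat \<Rightarrow> prog \<Rightarrow> nat" where
  "ubound B (PAssign a i e) = 1 + cbound B i + cbound B e"
| "ubound B (PQuery a i q) = 1 + B + cbound B i"
| "ubound B (PSeq p q) = ubound B p + ubound B q"
| "ubound B (PIf e p q) = 1 + cbound B e + ubound B p + ubound B q"
| "ubound B (PFor x e p) = 10 + B + cbound B e + ubound B p"

definition increment :: "expr \<Rightarrow> bool" where
  "increment e \<longleftrightarrow> (\<forall>m B. B \<ge> 2 \<longrightarrow> mem_le m B \<longrightarrow> eval m e \<le> Suc B)"

text \<open>An assignment of a tame program raises the largest value in memory by at most one, so that
  memory contents are bounded by the number of steps; no loop needs a size invariant of its own.\<close>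

fun tame :: "prog \<Rightarrow> bool" where
  "tame (PAssign a i e) = increment e"
| "tame (PQuery a i q) = True"
| "tame (PSeq p q) = (tame p \<and> tame q)"
| "tame (PIf e p q) = (tame p \<and> tame q)"
| "tame (PFor x e p) = tame p"

lemma mem_le_upd: "mem_le m B \<Longrightarrow> v \<le> B \<Longrightarrow> mem_le (upd m a i v) B"
  by (simp add: upd_def)

lemma mem_le_mono: "mem_le m B \<Longrightarrow> B \<le> B' \<Longrightarrow> mem_le m B'"
  using le_trans by blast

text \<open>Induction with two bounds on memory: \<open>B\<close> for the current contents, which
  grows by at most one per operation because the program is tame, and \<open>BB\<close> for the
  whole run. As all entries stay below \<open>BB\<close>, one operation costs at most
  \<open>U\<close>. The counts refer to a memory \<open>m0\<close> that agrees with the current one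
  on \<open>controls\<close>, so they do not change during the run.\<close>

lemma exec_compile:
  assumes "wf p" "tame p" "n \<le> BB" "2 \<le> B" "B + ops m0 p \<le> BB"
    "controls p \<inter> writes p = {}" "\<And>a. a \<in> controls p \<Longrightarrow> memory s a = m0 a"
    "mem_le (memory s) B" "ubound BB p \<le> U"
  shows "\<exists>s'. exec n f (compile p) s = return_spmf s' \<and> memory s' = den n f p (memory s) \<and>
    queries s' \<le> queries s + qcount m0 p \<and> steps s' \<le> steps s + ops m0 p * U \<and>
    mem_le (memory s') (B + ops m0 p)"
  using assms
proof (induction p arbitrary: s B)
  case (PAssign a i e)
  have 1: "eval (memory s) e \<le> Suc B"
    using PAssign.prems by (auto simp: increment_def)
  have le: "mem_le (memory s) BB"
    using PAssign.prems(5,8) by (intro mem_le_mono[of _ B BB]) auto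
  have "1 + cost (memory s) i + cost (memory s) e \<le> U"
    using cost_le_cbound[OF le, of i] cost_le_cbound[OF le, of e] PAssign.prems(9) by simp
  moreover have "mem_le (upd (memory s) a (eval (memory s) i) (eval (memory s) e)) (B + 1)"
    by (rule mem_le_upd[OF mem_le_mono[OF PAssign.prems(8)]]) (use 1 in auto)
  ultimately show ?case by (simp add: exec_simps)
next
  case (PQuery a i q)
  have le: "mem_le (memory s) BB"
    using PQuery.prems(5,8) by (intro mem_le_mono[of _ B BB]) auto
  have "1 + n + cost (memory s) i \<le> U"
    using cost_le_cbound[OF le, of i] PQuery.prems(3,9) by simp
  moreover have "mem_le (upd (memory s) a (eval (memory s) i) v) (B + 1)" if "v \<le> 1" for v
    by (rule mem_le_upd[OF mem_le_mono[OF PQuery.prems(8)]]) (use that in auto)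
  ultimately show ?case by (simp add: exec_simps)
next
  case (PSeq p q)
  obtain s1 where s1: "exec n f (compile p) s = return_spmf s1" "memory s1 = den n f p (memory s)"
     "queries s1 \<le> queries s + qcount m0 p" "steps s1 \<le> steps s + ops m0 p * U"
     "mem_le (memory s1) (B + ops m0 p)"
    using PSeq.IH(1)[of B s] PSeq.prems by (auto simp: disjoint_iff)
  have "memory s1 a = m0 a" if "a \<in> controls q" for a
    using that PSeq.prems(6,7) s1(2) by (auto simp: den_frame disjoint_iff)
  then obtain s2 where s2: "exec n f (compile q) s1 = return_spmf s2"
     "memory s2 = den n f q (memory s1)"
     "queries s2 \<le> queries s1 + qcount m0 q" "steps s2 \<le> steps s1 + ops m0 q * U"
     "mem_le (memory s2) (B + ops m0 p + ops m0 q)"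
    using PSeq.IH(2)[of "B + ops m0 p" s1] PSeq.prems s1(5) by (auto simp: disjoint_iff)
  show ?case
    using s1 s2 by (auto simp: exec_simps algebra_simps)
next
  case (PIf e p q)
  have le: "mem_le (memory s) BB"
    using PIf.prems(5,8) by (intro mem_le_mono[of _ B BB]) auto
  define s' where "s' = charge (1 + cost (memory s) e) s"
  have c: "1 + cost (memory s) e \<le> U"
    using cost_le_cbound[OF le, of e] PIf.prems(9) by simp
  show ?case
  proof (cases "eval (memory s) e = 0")
    case False
    obtain s1 where s1: "exec n f (compile p) s' = return_spmf s1" "memory s1 = den n f p (memory s)"
       "queries s1 \<le> queries s + qcount m0 p" "steps s1 \<le> steps s' + ops m0 p * U"
       "mem_le (memory s1) (B + ops m0 p)"
      using PIf.IH(1)[of B s'] PIf.prems unfolding s'_def by (auto simp: disjoint_iff)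
    have "mem_le (memory s1) (B + ops m0 (PIf e p q))"
      by (rule mem_le_mono[OF s1(5)]) simp
    then show ?thesis using s1 False c
      by (auto simp: exec_simps s'_def algebra_simps)
  next
    case True
    obtain s1 where s1: "exec n f (compile q) s' = return_spmf s1" "memory s1 = den n f q (memory s)"
       "queries s1 \<le> queries s + qcount m0 q" "steps s1 \<le> steps s' + ops m0 q * U"
       "mem_le (memory s1) (B + ops m0 q)"
      using PIf.IH(2)[of B s'] PIf.prems unfolding s'_def by (auto simp: disjoint_iff)
    have "mem_le (memory s1) (B + ops m0 (PIf e p q))"
      by (rule mem_le_mono[OF s1(5)]) simp
    then show ?thesis using s1 True c
      by (auto simp: exec_simps s'_def algebra_simps)
  qed
next
  case (PFor x e p)
  define N where "N = eval m0 e"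
  define g where "g = (\<lambda>m. let m' = den n f p m in upd m' x 0 (m' x 0 + 1))"
  define W where "W = While (Op Less (reg x) e)
       (Seq (compile p) (Assign x (Const 0) (Op Plus (reg x) (Const 1))))"
  have BN: "B + 2 + N * (2 + ops m0 p) \<le> BB" using PFor.prems(5) by (simp add: N_def)
  have U: "10 + BB + cbound BB e + ubound BB p \<le> U" using PFor.prems(9) by simp
  \<comment> \<open>Induction on the number \<open>r\<close> of iterations left; each raises the
    memory bound by \<open>1 + ops m0 p\<close>, the 1 being for the counter.\<close>
  have loop: "\<exists>s'. exec n f W s = return_spmf s' \<and> memory s' = (g ^^ r) (memory s) \<and>
    queries s' \<le> queries s + r * qcount m0 p \<and> steps s' \<le> steps s + (1 + r * (2 + ops m0 p)) * U \<and>
    mem_le (memory s') (B' + r * (1 + ops m0 p))"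
    if "memory s x 0 + r = N" "mem_le (memory s) B'" "2 \<le> B'" "B' + r * (1 + ops m0 p) \<le> BB"
       "\<And>a. a \<in> arrays e \<union> controls p \<Longrightarrow> memory s a = m0 a" for r s B'
    using that
  proof (induction r arbitrary: s B')
    case 0
    have ev: "eval (memory s) e = N"
      unfolding N_def by (rule eval_cong) (use 0 in auto)
    have le: "mem_le (memory s) BB"
      using 0 by (intro mem_le_mono[OF 0(2)]) auto
    have "cost (memory s) (Op Less (reg x) e) \<le> BB + 5 + cbound BB e"
      using cost_le_cbound[OF le, of e] floorlog_le[of "memory s x 0"] floorlog_le[of 0]
        le[rule_format, of x 0] ev 0(1) floorlog_le[of 1]
      by (simp add: ev)
    then have "1 + cost (memory s) (Op Less (reg x) e) \<le> U" using U by simp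
    then show ?case using 0 ev by (simp add: W_def exec_simps)
  next
    case (Suc r)
    have ev: "eval (memory s) e = N"
      unfolding N_def by (rule eval_cong) (use Suc.prems in auto)
    have le: "mem_le (memory s) BB"
      using Suc.prems by (intro mem_le_mono[OF Suc.prems(2)]) auto
    define s0 where "s0 = charge (1 + cost (memory s) (Op Less (reg x) e)) s"
    have "cost (memory s) (Op Less (reg x) e) \<le> BB + 5 + cbound BB e"
      using cost_le_cbound[OF le, of e] floorlog_le[of "memory s x 0"] floorlog_le[of 0]
        le[rule_format, of x 0] ev floorlog_le[of 1]
      by (simp add: ev)
    then have c0: "1 + cost (memory s) (Op Less (reg x) e) \<le> U" using U by simp
    obtain s1 where s1: "exec n f (compile p) s0 = return_spmf s1" "memory s1 = den n f p (memory s0)"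
       "queries s1 \<le> queries s0 + qcount m0 p" "steps s1 \<le> steps s0 + ops m0 p * U"
       "mem_le (memory s1) (B' + ops m0 p)"
      using PFor.IH[of B' s0] PFor.prems Suc.prems U unfolding s0_def
      by (fastforce simp: disjoint_iff)
    have le1: "mem_le (memory s1) BB"
      using Suc.prems by (intro mem_le_mono[OF s1(5)]) auto
    have x1: "memory s1 x 0 = memory s x 0"
      using PFor.prems(1) s1(2) by (simp add: den_frame s0_def)
    define s2 where "s2 = charge (1 + cost (memory s1) (Const 0) + cost (memory s1) (Op Plus (reg x) (Const 1)))
       (store x 0 (memory s1 x 0 + 1) s1)"
    have m2: "memory s2 = g (memory s)"
      by (simp add: s2_def g_def Let_def s1(2) s0_def)
    have "memory s1 x 0 + 1 \<le> BB"
    proof -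
      have "N \<le> N * (2 + ops m0 p)" by simp
      then show ?thesis using x1 Suc.prems(1) BN by linarith
    qed
    \<comment> \<open>The increment pays for the lengths of both x and x + 1, while
      \<open>BB\<close> is guaranteed only once in \<open>U\<close>. Bounding each length by about
      half of the value is enough.\<close>
    have fb: "floorlog 2 y \<le> y div 2 + 1" for y :: nat
    proof -
      have "y < 2 ^ (y div 2 + 1)"
      proof -
        have "y div 2 < 2 ^ (y div 2)" by (rule less_exp)
        then have "y div 2 + 1 \<le> 2 ^ (y div 2)" by linarith
        then show ?thesis by simp
      qed
      then show ?thesis
        by (cases "y = 0") (auto simp: floorlog_le_iff simp del: power_Suc)
    qed
    have "cost (memory s1) (Const 0) + cost (memory s1) (Op Plus (reg x) (Const 1)) \<le> 9 + BB"
      using fb[of "memory s1 x 0"] floorlog_le[of 0] floorlog_le[of 1]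
         fb[of "memory s1 x 0 + 1"] le1[rule_format, of x 0] \<open>memory s1 x 0 + 1 \<le> BB\<close>
      by simp
    then have c2: "1 + cost (memory s1) (Const 0) + cost (memory s1) (Op Plus (reg x) (Const 1)) \<le> U"
      using U by simp
    have "memory s1 x 0 + 1 \<le> B' + ops m0 p + 1" using s1(5) by simp
    then have le2: "mem_le (memory s2) (B' + (1 + ops m0 p))"
      unfolding s2_def using mem_le_upd[OF mem_le_mono[OF s1(5), of "B' + (1 + ops m0 p)"]] by simp
    have fr: "memory s2 a = m0 a" if "a \<in> arrays e \<union> controls p" for a
    proof -
      have "a \<noteq> x" "a \<notin> writes p" using that PFor.prems(1,6) by auto
      then show ?thesis using that Suc.prems(5)
        by (simp add: m2 g_def Let_def den_frame)
    qed
    obtain s3 where s3: "exec n f W s2 = return_spmf s3" "memory s3 = (g ^^ r) (memory s2)"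
      "queries s3 \<le> queries s2 + r * qcount m0 p" "steps s3 \<le> steps s2 + (1 + r * (2 + ops m0 p)) * U"
      "mem_le (memory s3) (B' + (1 + ops m0 p) + r * (1 + ops m0 p))"
      using Suc.IH[of s2 "B' + (1 + ops m0 p)"] fr le2 Suc.prems x1 by (force simp: s2_def)
    have "exec n f W s = bind_spmf (exec n f (Seq (compile p) (Assign x (Const 0) (Op Plus (reg x) (Const 1)))) s0) (exec n f W)"
      using Suc.prems(1) ev unfolding W_def s0_def by (subst exec_simps(7)) simp
    also have "\<dots> = return_spmf s3"
      using s1(1) s3(1) by (simp add: exec_simps s2_def)
    finally have "exec n f W s = return_spmf s3" .
    moreover have "memory s3 = (g ^^ Suc r) (memory s)"
      using s3(2) m2 by (simp add: funpow_swap1)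
    moreover have "queries s3 \<le> queries s + Suc r * qcount m0 p"
      using s3(3) s1(3) by (simp add: s2_def s0_def)
    moreover have "steps s3 \<le> steps s + (1 + Suc r * (2 + ops m0 p)) * U"
    proof -
      have "steps s2 \<le> steps s1 + U" "steps s0 \<le> steps s + U"
        using c2 c0 by (simp_all add: s2_def s0_def)
      then have "steps s3 \<le> steps s + U + ops m0 p * U + U + (1 + r * (2 + ops m0 p)) * U"
        using s1(4) s3(4) by linarith
      also have "\<dots> = steps s + (1 + Suc r * (2 + ops m0 p)) * U" by (simp add: algebra_simps)
      finally show ?thesis .
    qed
    moreover have "mem_le (memory s3) (B' + Suc r * (1 + ops m0 p))"
      by (rule mem_le_mono[OF s3(5)]) simp
    ultimately show ?case by blast
  qed
  define s0 where "s0 = charge (1 + cost (memory s) (Const 0) + cost (memory s) (Const 0))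
       (store x 0 0 s)"
  have c0: "1 + cost (memory s) (Const 0) + cost (memory s) (Const 0) \<le> U"
    using U floorlog_le[of 0] by simp
  have ev: "eval (memory s) e = N"
    unfolding N_def by (rule eval_cong) (use PFor.prems in auto)
  have "memory s0 a = m0 a" if "a \<in> arrays e \<union> controls p" for a
  proof -
    have "a \<noteq> x" using that PFor.prems(1,6) by auto
    then show ?thesis using that PFor.prems(7) by (simp add: s0_def)
  qed
  moreover have "mem_le (memory s0) B"
    unfolding s0_def using mem_le_upd[OF PFor.prems(8), of 0] by simp
  moreover have "B + N * (1 + ops m0 p) \<le> B + 2 + N * (2 + ops m0 p)" by (simp add: algebra_simps)
  ultimately obtain s' where s': "exec n f W s0 = return_spmf s'" "memory s' = (g ^^ N) (memory s0)"
    "queries s' \<le> queries s0 + N * qcount m0 p" "steps s' \<le> steps s0 + (1 + N * (2 + ops m0 p)) * U"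
    "mem_le (memory s') (B + N * (1 + ops m0 p))"
    using loop[of s0 N B] BN PFor.prems(4) by (force simp: s0_def)
  have "exec n f (compile (PFor x e p)) s = return_spmf s'"
    using s'(1) by (simp add: exec_simps s0_def W_def)
  moreover have "memory s' = den n f (PFor x e p) (memory s)"
    using s'(2) ev by (simp add: g_def s0_def)
  moreover have "queries s' \<le> queries s + qcount m0 (PFor x e p)"
    using s'(3) by (simp add: s0_def N_def)
  moreover have "steps s' \<le> steps s + ops m0 (PFor x e p) * U"
    using s'(4) c0 by (simp add: s0_def N_def algebra_simps)
  moreover have "mem_le (memory s') (B + ops m0 (PFor x e p))"
    by (rule mem_le_mono[OF s'(5)]) (simp add: N_def)
  ultimately show ?case by blast
qed

section \<open>Averages over random tapes\<close>

text \<open>Bits padded with zeros to a total function: this is what array 4 contains after the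
  flips, so a tape can be placed in memory unchanged.\<close>

definition tapes :: "nat \<Rightarrow> (nat \<Rightarrow> nat) set" where
  "tapes N = {z. (\<forall>i. z i \<le> 1) \<and> (\<forall>i\<ge>N. z i = 0)}"

definition avg :: "nat \<Rightarrow> ((nat \<Rightarrow> nat) \<Rightarrow> real) \<Rightarrow> real" where
  "avg N F = (\<Sum>z\<in>tapes N. F z) / 2 ^ N"

lemma tapes_0: "tapes 0 = {\<lambda>_. 0}"
  by (auto simp: tapes_def)

lemma tapes_Suc: "tapes (Suc N) = tapes N \<union> (\<lambda>z. z(N := 1)) ` tapes N"
proof (intro equalityI subsetI)
  fix z assume z: "z \<in> tapes (Suc N)"
  show "z \<in> tapes N \<union> (\<lambda>z. z(N := 1)) ` tapes N"
  proof (cases "z N = 0")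
    case True
    then have "z i = 0" if "i \<ge> N" for i
      using z that by (cases "i = N") (auto simp: tapes_def)
    with z show ?thesis by (simp add: tapes_def)
  next
    case False
    then have "z N = 1" using z by (auto simp: tapes_def intro: le_antisym)
    then have "z = (z(N := 0))(N := 1)" by auto
    moreover have "z(N := 0) \<in> tapes N"
      using z by (simp add: tapes_def)
    ultimately show ?thesis by blast
  qed
qed (auto simp: tapes_def)

lemma avg_0: "avg 0 F = F (\<lambda>_. 0)"
  by (simp add: avg_def tapes_0)

lemma finite_tapes [simp]: "finite (tapes N)"
  by (induction N) (simp_all only: tapes_0 tapes_Suc finite.intros finite_UnI finite_imageI)

lemma avg_Suc: "avg (Suc N) F = (avg N F + avg N (\<lambda>z. F (z(N := 1)))) / 2"
proof -
  have "(\<Sum>z\<in>tapes (Suc N). F z) = (\<Sum>z\<in>tapes N. F z) + (\<Sum>z\<in>(\<lambda>z. z(N := 1)) ` tapes N. F z)"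
    unfolding tapes_Suc
  proof (rule sum.union_disjoint)
    show "tapes N \<inter> (\<lambda>z. z(N := 1)) ` tapes N = {}" by (auto simp: tapes_def)
  qed auto
  also have "inj_on (\<lambda>z. z(N := 1)) (tapes N)"
  proof (rule inj_onI)
    fix z z' assume "z \<in> tapes N" "z' \<in> tapes N" and eq: "z(N := 1) = z'(N := 1)"
    then have "z N = z' N" by (simp add: tapes_def)
    then show "z = z'" using eq by (metis fun_upd_triv fun_upd_upd)
  qed
  then have "(\<Sum>z\<in>(\<lambda>z. z(N := 1)) ` tapes N. F z) = (\<Sum>z\<in>tapes N. F (z(N := 1)))"
    by (simp add: sum.reindex)
  finally show ?thesis by (simp add: avg_def field_simps)
qed

lemma card_tapes: "card (tapes N) = 2 ^ N"
proof -
  have "avg N (\<lambda>_. 1) = 1" by (induction N) (simp_all add: avg_0 avg_Suc)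
  then have "real (card (tapes N)) = real (2 ^ N)" by (simp add: avg_def)
  then show ?thesis by (simp only: of_nat_eq_iff)
qed

lemma avg_const [simp]: "avg N (\<lambda>_. c) = c"
  by (simp add: avg_def card_tapes)

lemma avg_add: "avg N (\<lambda>z. F z + G z) = avg N F + avg N G"
  and avg_diff: "avg N (\<lambda>z. F z - G z) = avg N F - avg N G"
  and avg_cmult: "avg N (\<lambda>z. c * F z) = c * avg N F"
  and avg_cmult_right: "avg N (\<lambda>z. F z * c) = avg N F * c"
  and avg_divide: "avg N (\<lambda>z. F z / c) = avg N F / c"
  and avg_sum: "avg N (\<lambda>z. \<Sum>i\<in>I. H i z) = (\<Sum>i\<in>I. avg N (H i))"
  by (simp_all add: avg_def sum.distrib sum_subtractf sum_distrib_left sum_distrib_right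
      add_divide_distrib diff_divide_distrib sum_divide_distrib sum.swap[of _ I]
      mult.commute divide_simps)

lemma avg_mono: "(\<And>z. z \<in> tapes N \<Longrightarrow> F z \<le> G z) \<Longrightarrow> avg N F \<le> avg N G"
  by (simp add: avg_def divide_right_mono sum_mono)

lemma avg_cong: "(\<And>z. z \<in> tapes N \<Longrightarrow> F z = G z) \<Longrightarrow> avg N F = avg N G"
  by (simp add: avg_def)

definition join :: "nat \<Rightarrow> (nat \<Rightarrow> nat) \<Rightarrow> (nat \<Rightarrow> nat) \<Rightarrow> nat \<Rightarrow> nat" where
  "join N z z' i = (if i < N then z i else z' (i - N))"

text \<open>Independence of disjoint parts of the tape, in the form of an iterated average; the
  other independence arguments rest on it.\<close>

lemma avg_split: "avg (N + M) F = avg N (\<lambda>z. avg M (\<lambda>z'. F (join N z z')))"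
proof (induction M arbitrary: F)
  case 0
  have "join N z (\<lambda>_. 0) = z" if "z \<in> tapes N" for z
    using that by (auto simp: join_def tapes_def fun_eq_iff)
  then show ?case by (simp add: avg_0 avg_cong[of N "\<lambda>z. F (join N z (\<lambda>_. 0))" F])
next
  case (Suc M)
  have "(join N z z')(N + M := 1) = join N z (z'(M := 1))" for z z'
    by (auto simp: join_def fun_eq_iff)
  then show ?case
    by (simp add: avg_Suc Suc.IH avg_add avg_divide)
qed

text \<open>Each factor is handed the whole tape from its block on; the assumption that it depends
  on \<open>B\<close> cells makes the blocks independent.\<close>

lemma avg_block_prod:
  assumes "\<And>z z'. (\<And>i. i < B \<Longrightarrow> z i = z' i) \<Longrightarrow> \<phi> z = \<phi> z'"
  shows "avg (R * B) (\<lambda>z. \<Prod>r<R. \<phi> (\<lambda>i. z (r * B + i))) = avg B \<phi> ^ R"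
proof (induction R)
  case (Suc R)
  have *: "(\<Prod>r<Suc R. \<phi> (\<lambda>i. join (R * B) z z' (r * B + i))) =
      (\<Prod>r<R. \<phi> (\<lambda>i. z (r * B + i))) * \<phi> z'" for z z'
  proof -
    have "\<phi> (\<lambda>i. join (R * B) z z' (r * B + i)) = \<phi> (\<lambda>i. z (r * B + i))" if "r < R" for r
    proof (rule assms)
      fix i assume "i < B"
      have "r * B + i < Suc r * B" using \<open>i < B\<close> by simp
      also have "\<dots> \<le> R * B" using that by (intro mult_right_mono) auto
      finally show "join (R * B) z z' (r * B + i) = z (r * B + i)" by (simp add: join_def)
    qed
    moreover have "\<phi> (\<lambda>i. join (R * B) z z' (R * B + i)) = \<phi> z'"
      by (rule assms) (simp add: join_def)
    ultimately show ?thesis by simp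
  qed
  have "avg (Suc R * B) (\<lambda>z. \<Prod>r<Suc R. \<phi> (\<lambda>i. z (r * B + i))) =
    avg (R * B + B) (\<lambda>z. \<Prod>r<Suc R. \<phi> (\<lambda>i. z (r * B + i)))"
    by (simp add: add.commute)
  also have "\<dots> = avg B \<phi> ^ Suc R"
    by (simp only: avg_split * avg_cmult avg_cmult_right Suc.IH) simp
  finally show ?case .
qed (simp add: avg_0)

text \<open>Expanding the square, the cross terms vanish because the last block is independent of
  the others and has mean zero.\<close>

lemma avg_block_variance:
  assumes dep: "\<And>z z'. (\<And>i. i < B \<Longrightarrow> z i = z' i) \<Longrightarrow> \<psi> z = \<psi> z'" and zero: "avg B \<psi> = 0"
  shows "avg (R * B) (\<lambda>z. (\<Sum>r<R. \<psi> (\<lambda>i. z (r * B + i)))\<^sup>2) = R * avg B (\<lambda>z. (\<psi> z)\<^sup>2)"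
proof (induction R)
  case (Suc R)
  define S where "S z = (\<Sum>r<R. \<psi> (\<lambda>i. z (r * B + i)))" for z
  have *: "(\<Sum>r<Suc R. \<psi> (\<lambda>i. join (R * B) z z' (r * B + i)))\<^sup>2 =
      (S z)\<^sup>2 + 2 * S z * \<psi> z' + (\<psi> z')\<^sup>2" for z z'
  proof -
    have "\<psi> (\<lambda>i. join (R * B) z z' (r * B + i)) = \<psi> (\<lambda>i. z (r * B + i))" if "r < R" for r
    proof (rule dep)
      fix i assume "i < B"
      have "r * B + i < Suc r * B" using \<open>i < B\<close> by simp
      also have "\<dots> \<le> R * B" using that by (intro mult_right_mono) auto
      finally show "join (R * B) z z' (r * B + i) = z (r * B + i)" by (simp add: join_def)
    qed
    moreover have "\<psi> (\<lambda>i. join (R * B) z z' (R * B + i)) = \<psi> z'"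
      by (rule dep) (simp add: join_def)
    ultimately show ?thesis by (simp add: S_def power2_eq_square algebra_simps)
  qed
  have "avg (Suc R * B) (\<lambda>z. (\<Sum>r<Suc R. \<psi> (\<lambda>i. z (r * B + i)))\<^sup>2) =
    avg (R * B + B) (\<lambda>z. (\<Sum>r<Suc R. \<psi> (\<lambda>i. z (r * B + i)))\<^sup>2)"
    by (simp add: add.commute)
  also have "\<dots> = Suc R * avg B (\<lambda>z. (\<psi> z)\<^sup>2)"
    using Suc.IH
    by (simp only: avg_split * avg_cmult avg_add avg_const zero S_def[symmetric])
      (simp add: algebra_simps)
  finally show ?case .
qed (simp add: avg_0)

text \<open>A sample bounded by 1 has variance at most 1, so the mean of \<open>R\<close>
  independent samples has variance at most 1 / R.\<close>

lemma avg_chebyshev: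
  assumes dep: "\<And>z z'. (\<And>i. i < B \<Longrightarrow> z i = z' i) \<Longrightarrow> \<phi> z = \<phi> z'"
    and bd: "\<And>z. \<bar>\<phi> z\<bar> \<le> 1" and h: "h > 0" and R: "R > 0"
  shows "avg (R * B) (\<lambda>z. of_bool (\<bar>(\<Sum>r<R. \<phi> (\<lambda>i. z (r * B + i))) / R - avg B \<phi>\<bar> > h))
      \<le> 1 / (R * h\<^sup>2)"
proof -
  define \<psi> where "\<psi> z = \<phi> z - avg B \<phi>" for z
  have zero: "avg B \<psi> = 0" unfolding \<psi>_def by (simp add: avg_diff)
  have eq: "(\<Sum>r<R. \<phi> (\<lambda>i. z (r * B + i))) / R - avg B \<phi> = (\<Sum>r<R. \<psi> (\<lambda>i. z (r * B + i))) / R" for z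
    using R by (simp add: \<psi>_def sum_subtractf field_simps)
  have "avg B (\<lambda>z. (\<psi> z)\<^sup>2) = avg B (\<lambda>z. (\<phi> z)\<^sup>2 - 2 * avg B \<phi> * \<phi> z + (avg B \<phi>)\<^sup>2)"
    by (simp add: \<psi>_def power2_diff algebra_simps)
  also have "\<dots> = avg B (\<lambda>z. (\<phi> z)\<^sup>2) - (avg B \<phi>)\<^sup>2"
    by (simp add: avg_add avg_diff avg_cmult power2_eq_square)
  also have "\<dots> \<le> avg B (\<lambda>z. (\<phi> z)\<^sup>2)" by simp
  also have "\<dots> \<le> avg B (\<lambda>_. 1)" using bd by (intro avg_mono) (simp add: abs_square_le_1)
  finally have var: "avg B (\<lambda>z. (\<psi> z)\<^sup>2) \<le> 1" by simp
  have "avg (R * B) (\<lambda>z. of_bool (\<bar>(\<Sum>r<R. \<phi> (\<lambda>i. z (r * B + i))) / R - avg B \<phi>\<bar> > h)) \<le>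
    avg (R * B) (\<lambda>z. (\<Sum>r<R. \<psi> (\<lambda>i. z (r * B + i)))\<^sup>2 / (R * h)\<^sup>2)"
  proof (rule avg_mono)
    fix z
    define s where "s = (\<Sum>r<R. \<psi> (\<lambda>i. z (r * B + i)))"
    have "(R * h)\<^sup>2 \<le> s\<^sup>2" if "\<bar>s / R\<bar> > h"
    proof -
      have "R * h \<le> \<bar>s\<bar>" using that R by (simp add: field_simps)
      then show ?thesis using h R by (metis abs_le_square_iff abs_of_nonneg less_imp_le mult_nonneg_nonneg of_nat_0_le_iff)
    qed
    then show "of_bool (\<bar>(\<Sum>r<R. \<phi> (\<lambda>i. z (r * B + i))) / R - avg B \<phi>\<bar> > h) \<le>
      (\<Sum>r<R. \<psi> (\<lambda>i. z (r * B + i)))\<^sup>2 / (R * h)\<^sup>2"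
      unfolding eq s_def[symmetric] using h R by (auto simp: of_bool_def)
  qed
  also have "\<dots> = R * avg B (\<lambda>z. (\<psi> z)\<^sup>2) / (R * h)\<^sup>2"
  proof -
    have "avg (R * B) (\<lambda>z. (\<Sum>r<R. \<psi> (\<lambda>i. z (r * B + i)))\<^sup>2) = R * avg B (\<lambda>z. (\<psi> z)\<^sup>2)"
    proof (rule avg_block_variance[OF _ zero])
      fix z z' :: "nat \<Rightarrow> nat" assume "\<And>i. i < B \<Longrightarrow> z i = z' i"
      then show "\<psi> z = \<psi> z'" using dep[of z z'] by (simp add: \<psi>_def)
    qed
    then show ?thesis by (simp add: avg_divide)
  qed
  also have "\<dots> \<le> R * 1 / (R * h)\<^sup>2"
    using mult_left_mono[OF var, of R] by (intro divide_right_mono) auto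
  also have "\<dots> = 1 / (R * h\<^sup>2)" using R by (simp add: power2_eq_square)
  finally show ?thesis .
qed

text \<open>The recursion follows the loop that fills the tape, one flip per cell;
  \<open>coins_eq\<close> then identifies the result as the uniform distribution.\<close>

fun coins :: "nat \<Rightarrow> (nat \<Rightarrow> nat) spmf" where
  "coins 0 = return_spmf (\<lambda>_. 0)"
| "coins (Suc N) = bind_spmf (coins N)
     (\<lambda>z. bind_spmf coin_spmf (\<lambda>b. return_spmf (z(N := of_bool b))))"

lemma coins_eq: "coins N = spmf_of_set (tapes N)"
proof (induction N)
  case 0
  then show ?case by (simp add: tapes_0 spmf_of_set_singleton)
next
  case (Suc N)
  have eq: "tapes (Suc N) = (\<lambda>(z, b). z(N := of_bool b)) ` (tapes N \<times> UNIV)"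
  proof -
    have "z(N := 0) = z" if "z \<in> tapes N" for z using that by (auto simp: tapes_def)
    then have "(\<lambda>z. z(N := 0)) ` tapes N = tapes N" by force
    moreover have "(\<lambda>(z, b). z(N := of_bool b)) ` (tapes N \<times> UNIV) =
       (\<lambda>z. z(N := 0)) ` tapes N \<union> (\<lambda>z. z(N := 1)) ` tapes N"
      by (force simp: UNIV_bool)
    ultimately show ?thesis by (simp add: tapes_Suc)
  qed
  have inj: "inj_on (\<lambda>(z, b). z(N := of_bool b)) (tapes N \<times> UNIV)"
  proof (rule inj_onI, clarify)
    fix z z' :: "nat \<Rightarrow> nat" and b b'
    assume z: "z \<in> tapes N" "z' \<in> tapes N" and eq: "z(N := of_bool b) = z'(N := of_bool b')"
    have "z N = z' N" using z by (simp add: tapes_def)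
    then have "z = z'" using eq by (metis fun_upd_triv fun_upd_upd)
    moreover have "b = b'" using fun_cong[OF eq, of N] by (cases b; cases b') auto
    ultimately show "z = z' \<and> b = b'" by simp
  qed
  have "spmf_of_set (tapes (Suc N)) = map_spmf (\<lambda>(z, b). z(N := of_bool b)) (spmf_of_set (tapes N \<times> UNIV))"
    unfolding eq by (rule map_spmf_of_set_inj_on[OF inj, symmetric])
  also have "\<dots> = map_spmf (\<lambda>(z, b). z(N := of_bool b)) (pair_spmf (spmf_of_set (tapes N)) coin_spmf)"
  proof -
    have "spmf_of_set (A \<times> B) = pair_spmf (spmf_of_set A) (spmf_of_set B)" for A :: "(nat \<Rightarrow> nat) set" and B :: "bool set"
      by (rule spmf_eqI) (auto simp: spmf_of_set card_cartesian_product indicator_def)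
    then show ?thesis by simp
  qed
  also have "\<dots> = coins (Suc N)"
    by (simp add: Suc pair_spmf_alt_def map_spmf_bind_spmf bind_map_spmf o_def)
  finally show ?case by simp
qed

lemma set_coins: "set_spmf (coins N) = tapes N"
  by (simp add: coins_eq)

lemma lossless_coins: "lossless_spmf (coins N)"
  using card_tapes[of N] by (auto simp: coins_eq lossless_spmf_of_set)

lemma measure_coins: "measure (measure_spmf (coins N)) {z. Q z} = avg N (\<lambda>z. of_bool (Q z))"
proof -
  have "tapes N \<noteq> {}" using card_tapes[of N] by auto
  have "measure (measure_spmf (coins N)) {z. Q z} = card (tapes N \<inter> {z. Q z}) / card (tapes N)"
    by (simp add: coins_eq measure_spmf_of_set)
  also have "\<dots> = avg N (\<lambda>z. of_bool (Q z))"
    by (simp add: avg_def card_tapes of_bool_def sum.If_cases)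
  finally show ?thesis .
qed

section \<open>Fourier analysis\<close>

unbundle no vec_syntax

declare add_bit_eq_xor [simp del] mult_bit_eq_and [simp del]

abbreviation cube :: "nat \<Rightarrow> bit vec set" where "cube n \<equiv> carrier_vec n"

definition chi :: "bit vec \<Rightarrow> bit vec \<Rightarrow> real" where
  "chi \<gamma> x = (if scalar_prod \<gamma> x = 0 then 1 else - 1)"

lemma bit_zero_or_one: "b = 0 \<or> b = (1 :: bit)"
  by (cases b) auto

lemma bit_add_self [simp]: "b + b = (0 :: bit)"
  using bit_zero_or_one[of b] by auto

lemma of_nat_bit: "(of_nat k :: bit) = (if even k then 0 else 1)"
  by (induction k) (use bit_add_self[of 1] in \<open>auto simp del: bit_add_self\<close>)

lemma chi_cases: "chi \<gamma> x = 1 \<or> chi \<gamma> x = - 1"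
  by (simp add: chi_def)

lemma sign_add: "(if a + b = (0 :: bit) then 1 else - 1 :: real) =
    (if a = 0 then 1 else - 1) * (if b = 0 then 1 else - 1)"
  using bit_zero_or_one[of a] bit_zero_or_one[of b] by auto

lemma chi_add_right:
  assumes "\<gamma> \<in> cube n" "x \<in> cube n" "y \<in> cube n"
  shows "chi \<gamma> (x + y) = chi \<gamma> x * chi \<gamma> y"
  unfolding chi_def scalar_prod_add_distrib[OF assms] sign_add ..

lemma chi_comm: "\<gamma> \<in> cube n \<Longrightarrow> x \<in> cube n \<Longrightarrow> chi \<gamma> x = chi x \<gamma>"
  by (simp add: chi_def comm_scalar_prod[of \<gamma> n x])

lemma chi_add_left:
  assumes "\<gamma> \<in> cube n" "\<gamma>' \<in> cube n" "x \<in> cube n"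
  shows "chi (\<gamma> + \<gamma>') x = chi \<gamma> x * chi \<gamma>' x"
  unfolding chi_def add_scalar_prod_distrib[OF assms] sign_add ..

lemma abs_chi [simp]: "\<bar>chi \<gamma> x\<bar> = 1"
  by (simp add: chi_def)

lemma chi_zero_left [simp]: "x \<in> cube n \<Longrightarrow> chi (0\<^sub>v n) x = 1"
  and chi_zero_right [simp]: "x \<in> cube n \<Longrightarrow> chi x (0\<^sub>v n) = 1"
  by (simp_all add: chi_def)

lemma cube_add_self: "x \<in> cube n \<Longrightarrow> x + x = 0\<^sub>v n"
  by (intro eq_vecI) auto

lemma cube_add_cancel: "x \<in> cube n \<Longrightarrow> y \<in> cube n \<Longrightarrow> x + y + y = x"
  by (simp add: assoc_add_vec[of _ n] cube_add_self)

lemma bij_read_tapes: "bij_betw (\<lambda>z. read_vec n z 0) (tapes n) (cube n)"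
proof (rule bij_betwI[where g = "\<lambda>v i. if i < n \<and> v $ i = 1 then 1 else 0"])
  show "(\<lambda>z. read_vec n z 0) \<in> tapes n \<rightarrow> cube n" by (simp add: read_vec_def)
  show "(\<lambda>v i. if i < n \<and> v $ i = 1 then 1 else 0) \<in> cube n \<rightarrow> tapes n"
    by (auto simp: tapes_def)
next
  fix z assume z: "z \<in> tapes n"
  have z01: "z i = 0 \<or> z i = 1" for i
    using z by (auto simp: tapes_def le_Suc_eq)
  have "(if i < n \<and> read_vec n z 0 $ i = 1 then 1 else 0) = z i" for i
    using z z01[of i] by (cases "i < n") (auto simp: tapes_def read_vec_def of_nat_bit)
  then show "(\<lambda>i. if i < n \<and> read_vec n z 0 $ i = 1 then 1 else 0) = z"
    by (rule ext)
next
  fix v :: "bit vec" assume v: "v \<in> cube n"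
  show "read_vec n (\<lambda>i. if i < n \<and> v $ i = 1 then 1 else 0) 0 = v"
    using v by (intro eq_vecI) (auto simp: read_vec_def)
qed

lemma finite_cube [simp]: "finite (cube n)"
  using bij_betw_finite[OF bij_read_tapes[of n]] by simp

lemma card_cube: "card (cube n) = 2 ^ n"
  using bij_betw_same_card[OF bij_read_tapes[of n]] by (simp add: card_tapes)

lemma avg_read: "avg n (\<lambda>z. F (read_vec n z 0)) = (\<Sum>v\<in>cube n. F v) / 2 ^ n"
  unfolding avg_def using sum.reindex_bij_betw[OF bij_read_tapes, of F n] by simp

lemma sum_shift:
  assumes "u \<in> cube n"
  shows "(\<Sum>x\<in>cube n. F (x + u)) = (\<Sum>x\<in>cube n. F x :: real)"
proof (rule sum.reindex_bij_betw)
  show "bij_betw (\<lambda>x. x + u) (cube n) (cube n)"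
    by (rule bij_betwI[where g = "\<lambda>x. x + u"]) (use assms in \<open>auto simp: cube_add_cancel\<close>)
qed

text \<open>Shifting by a unit vector on which a nonzero \<gamma> does not vanish permutes the cube
  and negates the character.\<close>

lemma sum_chi:
  assumes "\<gamma> \<in> cube n"
  shows "(\<Sum>x\<in>cube n. chi \<gamma> x) = (if \<gamma> = 0\<^sub>v n then 2 ^ n else 0)"
proof (cases "\<gamma> = 0\<^sub>v n")
  case True
  then show ?thesis by (simp add: card_cube)
next
  case False
  then obtain i where i: "i < n" "\<gamma> $ i \<noteq> 0"
    using assms eq_vecI[of \<gamma> "0\<^sub>v n"] by (auto simp del: bit_not_zero_iff)
  have u: "unit_vec n i \<in> cube n" by simp
  have "chi \<gamma> (unit_vec n i) = - 1"
    using i assms by (simp add: chi_def)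
  then have "(\<Sum>x\<in>cube n. chi \<gamma> (x + unit_vec n i)) = - (\<Sum>x\<in>cube n. chi \<gamma> x)"
    using assms by (simp add: chi_add_right[OF assms] sum_negf)
  then show ?thesis using sum_shift[OF u, of "chi \<gamma>"] False by simp
qed

lemma fourier_eq: "fourier n f \<gamma> = (\<Sum>x\<in>cube n. f x * chi \<gamma> x) / 2 ^ n"
proof -
  have "cube n \<noteq> {}" using zero_carrier_vec by blast
  then show ?thesis
    by (simp add: fourier_def chi_def integral_pmf_of_set card_cube)
qed

definition sqf :: "nat \<Rightarrow> (bit vec \<Rightarrow> real) \<Rightarrow> bit vec \<Rightarrow> real" where
  "sqf n f \<gamma> = (fourier n f \<gamma>)\<^sup>2"

lemma sqf_nonneg [simp]: "sqf n f \<gamma> \<ge> 0"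
  by (simp add: sqf_def)

text \<open>The Wiener-Khinchin identity on the cube: expand each square into a double sum over x
  and y; summing the characters over \<gamma> leaves the terms with y = x + z. This makes sums of
  squared coefficients accessible to sampling.\<close>

lemma autocorrelation:
  assumes z: "z \<in> cube n"
  shows "(\<Sum>y\<in>cube n. f y * f (y + z)) / 2 ^ n = (\<Sum>\<gamma>\<in>cube n. sqf n f \<gamma> * chi \<gamma> z)"
proof -
  have *: "(\<Sum>\<gamma>\<in>cube n. chi \<gamma> x * chi \<gamma> y * chi \<gamma> z) = (if y = x + z then 2 ^ n else 0)"
    if "x \<in> cube n" "y \<in> cube n" for x y
  proof -
    have "(\<Sum>\<gamma>\<in>cube n. chi \<gamma> x * chi \<gamma> y * chi \<gamma> z) = (\<Sum>\<gamma>\<in>cube n. chi (x + z + y) \<gamma>)"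
    proof (rule sum.cong)
      fix \<gamma> assume "\<gamma> \<in> cube n"
      then show "chi \<gamma> x * chi \<gamma> y * chi \<gamma> z = chi (x + z + y) \<gamma>"
        using that z by (simp add: chi_add_right[of _ n] chi_comm[of _ n \<gamma>])
    qed simp
    also have "\<dots> = (if x + z + y = 0\<^sub>v n then 2 ^ n else 0)"
      using that z by (intro sum_chi) simp
    also have "x + z + y = 0\<^sub>v n \<longleftrightarrow> y = x + z"
    proof
      assume "x + z + y = 0\<^sub>v n"
      moreover have "x + z + y + y = x + z" using that z by (intro cube_add_cancel) auto
      ultimately show "y = x + z" using that by simp
    next
      assume "y = x + z"
      then show "x + z + y = 0\<^sub>v n" using that z by (simp only: cube_add_self)
    qed
    finally show ?thesis .
  qed
  have "sqf n f \<gamma> * chi \<gamma> z =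
      (\<Sum>x\<in>cube n. \<Sum>y\<in>cube n. f x * f y * (chi \<gamma> x * chi \<gamma> y * chi \<gamma> z)) / (2 ^ n * 2 ^ n)" for \<gamma>
  proof -
    have "(\<Sum>x\<in>cube n. f x * chi \<gamma> x) * (\<Sum>y\<in>cube n. f y * chi \<gamma> y) * chi \<gamma> z =
      (\<Sum>x\<in>cube n. \<Sum>y\<in>cube n. f x * f y * (chi \<gamma> x * chi \<gamma> y * chi \<gamma> z))"
      by (subst sum_product, unfold sum_distrib_right) (intro sum.cong refl, simp only: mult_ac)
    then show ?thesis by (simp add: sqf_def fourier_eq power2_eq_square)
  qed
  then have "(\<Sum>\<gamma>\<in>cube n. sqf n f \<gamma> * chi \<gamma> z) =
      (\<Sum>\<gamma>\<in>cube n. (\<Sum>x\<in>cube n. \<Sum>y\<in>cube n. f x * f y * (chi \<gamma> x * chi \<gamma> y * chi \<gamma> z))) / (2 ^ n * 2 ^ n)"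
    by (simp only: sum_divide_distrib)
  also have "(\<Sum>\<gamma>\<in>cube n. (\<Sum>x\<in>cube n. \<Sum>y\<in>cube n. f x * f y * (chi \<gamma> x * chi \<gamma> y * chi \<gamma> z))) =
      (\<Sum>x\<in>cube n. \<Sum>y\<in>cube n. \<Sum>\<gamma>\<in>cube n. f x * f y * (chi \<gamma> x * chi \<gamma> y * chi \<gamma> z))"
    by (subst sum.swap, rule sum.cong[OF refl], rule sum.swap)
  also have "\<dots> = (\<Sum>x\<in>cube n. \<Sum>y\<in>cube n. f x * f y * (if y = x + z then 2 ^ n else 0))"
    by (simp add: sum_distrib_left[symmetric] *)
  also have "\<dots> = (\<Sum>x\<in>cube n. f x * f (x + z) * 2 ^ n)"
  proof (rule sum.cong)
    fix x assume x: "x \<in> cube n"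
    have "(\<Sum>y\<in>cube n. f x * f y * (if y = x + z then 2 ^ n else 0)) =
        (\<Sum>y\<in>cube n. if y = x + z then f x * f y * 2 ^ n else 0)"
      by (intro sum.cong) auto
    also have "\<dots> = f x * f (x + z) * 2 ^ n"
      using x z by (simp add: sum.delta)
    finally show "(\<Sum>y\<in>cube n. f x * f y * (if y = x + z then 2 ^ n else 0)) =
      f x * f (x + z) * 2 ^ n" .
  qed simp
  finally show ?thesis by (simp add: sum_distrib_right[symmetric])
qed

lemma parseval:
  assumes "f \<in> cube n \<rightarrow> {- 1, 1}"
  shows "(\<Sum>\<gamma>\<in>cube n. sqf n f \<gamma>) = 1"
proof -
  have "f y * f y = 1" if "y \<in> cube n" for y using funcset_mem[OF assms that] by auto
  then have "(\<Sum>y\<in>cube n. f y * f (y + 0\<^sub>v n)) = (\<Sum>y\<in>cube n. 1)"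
    by (intro sum.cong) auto
  then show ?thesis using autocorrelation[of "0\<^sub>v n" n f] by (simp add: card_cube)
qed

subsection \<open>Random buckets\<close>

text \<open>The binary digits of \<open>d\<close> encode a subset of the \<open>k\<close> vectors,
  and those of \<open>c\<close> a bucket, since programs handle natural numbers.\<close>

definition combination :: "nat \<Rightarrow> (nat \<Rightarrow> bit vec) \<Rightarrow> nat \<Rightarrow> nat \<Rightarrow> bit vec" where
  "combination n X k d = Matrix.vec n (\<lambda>i. \<Sum>l<k. if bit d l then X l $ i else 0)"

definition bsign :: "nat \<Rightarrow> nat \<Rightarrow> nat \<Rightarrow> real" where
  "bsign k c d = (\<Prod>l<k. if bit c l \<and> bit d l then - 1 else 1)"

definition in_bucket :: "(nat \<Rightarrow> bit vec) \<Rightarrow> nat \<Rightarrow> nat \<Rightarrow> bit vec \<Rightarrow> bool" where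
  "in_bucket X k c \<gamma> \<longleftrightarrow> (\<forall>l<k. chi \<gamma> (X l) = - 1 \<longleftrightarrow> bit c l)"

text \<open>The index J = n stands for the zero vector, so plain and shifted bucket weights share
  one definition and one program.\<close>

definition direction :: "nat \<Rightarrow> nat \<Rightarrow> bit vec" where
  "direction n J = Matrix.vec n (\<lambda>i. of_bool (i = J))"

lemma combination_carrier [simp]: "combination n X k d \<in> cube n"
  by (simp add: combination_def)

lemma direction_carrier [simp]: "direction n J \<in> cube n"
  by (simp add: direction_def)

lemma direction_n: "direction n n = 0\<^sub>v n"
  by (intro eq_vecI) (auto simp: direction_def)

lemma chi_direction:
  assumes "\<gamma> \<in> cube n" "J < n"
  shows "chi \<gamma> (direction n J) = (if \<gamma> $ J = 0 then 1 else - 1)"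
proof -
  have "direction n J = unit_vec n J" by (intro eq_vecI) (auto simp: direction_def unit_vec_def)
  then show ?thesis using assms by (simp add: chi_def)
qed

lemma chi_combination:
  assumes "\<gamma> \<in> cube n" "\<And>l. l < k \<Longrightarrow> X l \<in> cube n"
  shows "chi \<gamma> (combination n X k d) = (\<Prod>l<k. if bit d l then chi \<gamma> (X l) else 1)"
  using assms(2)
proof (induction k)
  case 0
  have "combination n X 0 d = 0\<^sub>v n" by (intro eq_vecI) (auto simp: combination_def)
  then show ?case using assms by simp
next
  case (Suc k)
  have "combination n X (Suc k) d = combination n X k d + (if bit d k then X k else 0\<^sub>v n)"
    using Suc.prems[of k] by (intro eq_vecI) (auto simp: combination_def)
  then show ?case
    using Suc assms(1) by (simp add: chi_add_right[of _ n])
qed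

text \<open>Expansion of a product of binomials, the chosen subsets being numbered in binary;
  numbers below 2 ^ (k + 1) are split by their top bit.\<close>

lemma sum_prod_bits:
  "(\<Sum>d<2 ^ k :: nat. \<Prod>l<k. if bit d l then g l else 1) = (\<Prod>l<k. 1 + g l :: real)"
proof (induction k)
  case (Suc k)
  define F where "F d = (\<Prod>l<k. if bit d l then g l else 1)" for d :: nat
  have "{..<2 ^ Suc k} = {..<2 ^ k :: nat} \<union> (\<lambda>d. d + 2 ^ k) ` {..<2 ^ k :: nat}"
  proof (intro equalityI subsetI)
    fix d :: nat assume "d \<in> {..<2 ^ Suc k}"
    then show "d \<in> {..<2 ^ k :: nat} \<union> (\<lambda>d. d + 2 ^ k) ` {..<2 ^ k}"
      by (cases "d < 2 ^ k") (auto simp: image_iff intro!: bexI[of _ "d - 2 ^ k"])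
  qed auto
  then have "(\<Sum>d\<in>{..<2 ^ Suc k :: nat}. \<Prod>l<Suc k. if bit d l then g l else 1) =
     (\<Sum>d<2 ^ k :: nat. \<Prod>l<Suc k. if bit d l then g l else 1) +
     (\<Sum>d\<in>(\<lambda>d. d + 2 ^ k) ` {..<2 ^ k :: nat}. \<Prod>l<Suc k. if bit d l then g l else 1)"
    by (simp only:) (rule sum.union_disjoint, auto)
  also have "(\<Sum>d<2 ^ k :: nat. \<Prod>l<Suc k. if bit d l then g l else 1) = (\<Sum>d<2 ^ k :: nat. F d)"
  proof (rule sum.cong)
    fix d :: nat assume "d \<in> {..<2 ^ k}"
    then have "\<not> bit d k" by (simp add: bit_iff_odd)
    then show "(\<Prod>l<Suc k. if bit d l then g l else 1) = F d" by (simp add: F_def)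
  qed simp
  also have "(\<Sum>d\<in>(\<lambda>d. d + 2 ^ k) ` {..<2 ^ k :: nat}. \<Prod>l<Suc k. if bit d l then g l else 1) =
     (\<Sum>d<2 ^ k :: nat. F d * g k)"
  proof (subst sum.reindex)
    show "inj_on (\<lambda>d. d + 2 ^ k) {..<2 ^ k :: nat}" by (simp add: inj_on_def)
    show "sum ((\<lambda>d. \<Prod>l<Suc k. if bit d l then g l else 1) \<circ> (\<lambda>d. d + 2 ^ k)) {..<2 ^ k :: nat} =
      (\<Sum>d<2 ^ k :: nat. F d * g k)"
    proof (rule sum.cong)
      fix d :: nat assume d: "d \<in> {..<2 ^ k}"
      have "bit (d + 2 ^ k) l = bit d l" if "l < k" for l
      proof -
        have "(2 :: nat) ^ k = 2 ^ (k - l) * 2 ^ l" using that by (simp add: power_add[symmetric])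
        then have "(d + 2 ^ k) div 2 ^ l = d div 2 ^ l + 2 ^ (k - l)" by simp
        then show ?thesis using that by (simp add: bit_iff_odd)
      qed
      moreover have "bit (d + 2 ^ k) k" using d by (simp add: bit_iff_odd)
      ultimately show "((\<lambda>d. \<Prod>l<Suc k. if bit d l then g l else 1) \<circ> (\<lambda>d. d + 2 ^ k)) d = F d * g k"
        by (simp add: F_def)
    qed simp
  qed
  also have "(\<Sum>d<2 ^ k :: nat. F d) + (\<Sum>d<2 ^ k :: nat. F d * g k) = (\<Prod>l<Suc k. 1 + g l)"
    using Suc by (simp add: F_def[symmetric] sum_distrib_right[symmetric] algebra_simps)
  finally show ?case .
qed simp

text \<open>The sum factors over \<open>l\<close>: a factor is 2 where the sign of \<gamma> on
  \<open>X l\<close> agrees with the digit of \<open>c\<close>, and 0 otherwise.\<close>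

lemma bucket_sum:
  assumes "\<gamma> \<in> cube n" "\<And>l. l < k \<Longrightarrow> X l \<in> cube n"
  shows "(\<Sum>d<2 ^ k :: nat. chi \<gamma> (combination n X k d) * bsign k c d) = 2 ^ k * of_bool (in_bucket X k c \<gamma>)"
proof -
  define g where "g l = chi \<gamma> (X l) * (if bit c l then - 1 else 1)" for l
  have "(\<Sum>d<2 ^ k :: nat. chi \<gamma> (combination n X k d) * bsign k c d) =
    (\<Sum>d<2 ^ k :: nat. \<Prod>l<k. if bit d l then g l else 1)"
  proof (rule sum.cong)
    fix d :: nat
    show "chi \<gamma> (combination n X k d) * bsign k c d = (\<Prod>l<k. if bit d l then g l else 1)"
      using chi_combination[of \<gamma> n k X d] assms
      by (simp add: bsign_def prod.distrib[symmetric] del: prod.distrib)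
        (rule prod.cong, auto simp: g_def)
  qed simp
  also have "\<dots> = (\<Prod>l<k. 1 + g l)" by (rule sum_prod_bits)
  also have "\<dots> = 2 ^ k * of_bool (in_bucket X k c \<gamma>)"
  proof (cases "in_bucket X k c \<gamma>")
    case True
    then have "1 + g l = 2" if "l < k" for l
      using that chi_cases[of \<gamma> "X l"] by (auto simp: g_def in_bucket_def)
    then show ?thesis using True by simp
  next
    case False
    then obtain l where l: "l < k" "(chi \<gamma> (X l) = - 1) \<noteq> bit c l"
      by (auto simp: in_bucket_def)
    then have "1 + g l = 0" using chi_cases[of \<gamma> "X l"] by (auto simp: g_def)
    then have "(\<Prod>l<k. 1 + g l) = 0" using l(1) by (intro prod_zero) auto
    then show ?thesis using False by simp
  qed
  finally show ?thesis .
qed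

lemma ex_bucket: "\<exists>c<2 ^ k. in_bucket X k c \<gamma>"
proof -
  define c where "c = (horner_sum of_bool 2 (map (\<lambda>l. chi \<gamma> (X l) = - 1) [0..<k]) :: nat)"
  have "c < 2 ^ k" using horner_sum_of_bool_2_less[of "map (\<lambda>l. chi \<gamma> (X l) = - 1) [0..<k]"]
    unfolding c_def by (metis horner_sum_of_bool_2_less length_map length_upt minus_nat.diff_0 diff_zero)
  moreover have "in_bucket X k c \<gamma>"
    by (simp add: in_bucket_def c_def bit_horner_sum_bit_iff)
  ultimately show ?thesis by blast
qed

text \<open>For J = n this is the Fourier weight of the bucket. For J < n every character enters
  with the sign given by its coordinate J, so the sign of the sum reveals that coordinate of a
  dominating character.\<close>

definition weight :: "nat \<Rightarrow> (bit vec \<Rightarrow> real) \<Rightarrow> (nat \<Rightarrow> bit vec) \<Rightarrow> nat \<Rightarrow> nat \<Rightarrow> nat \<Rightarrow> real" where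
  "weight n f X k c J =
     (\<Sum>\<gamma>\<in>cube n. sqf n f \<gamma> * chi \<gamma> (direction n J) * of_bool (in_bucket X k c \<gamma>))"

definition sample :: "nat \<Rightarrow> (bit vec \<Rightarrow> real) \<Rightarrow> (nat \<Rightarrow> bit vec) \<Rightarrow> nat \<Rightarrow> nat \<Rightarrow> nat \<Rightarrow> bit vec \<Rightarrow> real" where
  "sample n f X k c J y =
     f y * (\<Sum>d<2 ^ k. f (y + (combination n X k d + direction n J)) * bsign k c d) / 2 ^ k"

text \<open>Averaging over y turns the products into autocorrelations; the signed sum over d then
  singles out the bucket by \<open>bucket_sum\<close>.\<close>

lemma sample_mean:
  assumes "\<And>l. l < k \<Longrightarrow> X l \<in> cube n"
  shows "(\<Sum>y\<in>cube n. sample n f X k c J y) / 2 ^ n = weight n f X k c J"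
proof -
  let ?e = "direction n J"
  have "(\<Sum>y\<in>cube n. sample n f X k c J y) / 2 ^ n =
    (\<Sum>d<2 ^ k. bsign k c d * ((\<Sum>y\<in>cube n. f y * f (y + (combination n X k d + ?e))) / 2 ^ n)) / 2 ^ k"
    by (simp add: sample_def sum_divide_distrib sum_distrib_left sum_distrib_right mult_ac
        sum.swap[of _ "cube n"])
  also have "\<dots> = (\<Sum>d<2 ^ k. bsign k c d *
      (\<Sum>\<gamma>\<in>cube n. sqf n f \<gamma> * (chi \<gamma> (combination n X k d) * chi \<gamma> ?e))) / 2 ^ k"
    by (simp add: autocorrelation chi_add_right[of _ n])
  also have "\<dots> = (\<Sum>\<gamma>\<in>cube n. sqf n f \<gamma> * chi \<gamma> ?e *
      ((\<Sum>d<2 ^ k. chi \<gamma> (combination n X k d) * bsign k c d) / 2 ^ k))"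
    by (simp add: sum_divide_distrib sum_distrib_left sum_distrib_right mult_ac
        sum.swap[of _ "cube n"])
  also have "\<dots> = weight n f X k c J"
    by (simp add: weight_def bucket_sum[OF _ assms])
  finally show ?thesis .
qed

lemma sample_bound:
  assumes f: "f \<in> cube n \<rightarrow> {- 1, 1}" and y: "y \<in> cube n"
  shows "\<bar>sample n f X k c J y\<bar> \<le> 1"
proof -
  have f1: "\<bar>f x\<bar> = 1" if "x \<in> cube n" for x using funcset_mem[OF f that] by auto
  have b1: "\<bar>bsign k c d\<bar> = 1" for d by (simp add: bsign_def abs_prod if_distrib[of abs] cong: if_cong)
  have "\<bar>\<Sum>d<2 ^ k. f (y + (combination n X k d + direction n J)) * bsign k c d\<bar> \<le>
    (\<Sum>d<2 ^ k :: nat. 1)"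
    using y by (intro order_trans[OF sum_abs] sum_mono) (simp add: abs_mult f1 b1)
  then show ?thesis using f1[OF y] by (simp add: sample_def abs_mult)
qed

subsection \<open>Failure probabilities\<close>

definition block :: "nat \<Rightarrow> (nat \<Rightarrow> nat) \<Rightarrow> nat \<Rightarrow> bit vec" where
  "block n z l = read_vec n z (l * n)"

text \<open>One round uses \<open>k + M\<close> blocks of the tape: the first \<open>k\<close>
  define the buckets, the others are sample points, shared by all buckets and directions.\<close>

definition estimate :: "nat \<Rightarrow> (bit vec \<Rightarrow> real) \<Rightarrow> nat \<Rightarrow> nat \<Rightarrow> (nat \<Rightarrow> nat) \<Rightarrow> nat \<Rightarrow> nat \<Rightarrow> real" where
  "estimate n f k M z c J = (\<Sum>m<M. sample n f (block n z) k c J (block n z (k + m))) / M"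

text \<open>The set \<open>S\<close> is {n} for the verifier and {..n} for the prover, who also
  needs the signed weights.\<close>

definition accurate :: "nat \<Rightarrow> (bit vec \<Rightarrow> real) \<Rightarrow> nat \<Rightarrow> nat \<Rightarrow> nat set \<Rightarrow> real \<Rightarrow> (nat \<Rightarrow> nat) \<Rightarrow> bool" where
  "accurate n f k M S h z \<longleftrightarrow> (\<forall>c<2 ^ k. \<forall>J\<in>S.
     \<bar>estimate n f k M z c J - weight n f (block n z) k c J\<bar> \<le> h)"

definition separated :: "nat \<Rightarrow> (bit vec \<Rightarrow> real) \<Rightarrow> nat \<Rightarrow> real \<Rightarrow> (nat \<Rightarrow> bit vec) \<Rightarrow> bool" where
  "separated n f k h X \<longleftrightarrow> (\<forall>c. weight n f X k c n \<le> h \<or>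
     (\<exists>\<gamma>\<in>cube n. in_bucket X k c \<gamma> \<and> weight n f X k c n \<le> sqf n f \<gamma> + h))"

definition collide :: "(nat \<Rightarrow> bit vec) \<Rightarrow> nat \<Rightarrow> bit vec \<Rightarrow> bit vec \<Rightarrow> bool" where
  "collide X k \<gamma> \<gamma>' \<longleftrightarrow> (\<forall>l<k. chi \<gamma> (X l) = chi \<gamma>' (X l))"

lemma block_carrier [simp]: "block n z l \<in> cube n"
  by (simp add: block_def read_vec_def)

lemma collide_iff: "in_bucket X k c \<gamma> \<Longrightarrow> collide X k \<gamma> \<gamma>' \<longleftrightarrow> in_bucket X k c \<gamma>'"
  unfolding in_bucket_def collide_def by (metis chi_cases)

lemma avg_ex_le:
  assumes "finite I"
  shows "avg N (\<lambda>z. of_bool (\<exists>i\<in>I. Q i z)) \<le> (\<Sum>i\<in>I. avg N (\<lambda>z. of_bool (Q i z)))"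
  unfolding avg_sum[symmetric]
proof (rule avg_mono)
  fix z
  show "of_bool (\<exists>i\<in>I. Q i z) \<le> (\<Sum>i\<in>I. of_bool (Q i z) :: real)"
  proof (cases "\<exists>i\<in>I. Q i z")
    case True
    then obtain i where "i \<in> I" "Q i z" by blast
    then show ?thesis
      using member_le_sum[of i I "\<lambda>i. of_bool (Q i z) :: real"] assms by auto
  qed (simp add: sum_nonneg)
qed

lemma avg_disj_le:
  "avg N (\<lambda>z. of_bool (P z \<or> Q z)) \<le> avg N (\<lambda>z. of_bool (P z)) + avg N (\<lambda>z. of_bool (Q z))"
  unfolding avg_add[symmetric] by (rule avg_mono) auto

lemma block_join:
  "l < k \<Longrightarrow> block n (join (k * n) z z') l = block n z l"
  "block n (join (k * n) z z') (k + m) = block n z' m"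
proof -
  have "l * n + i < k * n" if "l < k" "i < n" for i
  proof -
    have "l * n + i < Suc l * n" using that by simp
    also have "\<dots> \<le> k * n" using that by (intro mult_right_mono) auto
    finally show ?thesis .
  qed
  then show "l < k \<Longrightarrow> block n (join (k * n) z z') l = block n z l"
    by (auto simp: block_def read_vec_def join_def)
  show "block n (join (k * n) z z') (k + m) = block n z' m"
    by (auto simp: block_def read_vec_def join_def algebra_simps)
qed

lemma combination_cong: "(\<And>l. l < k \<Longrightarrow> X l = X' l) \<Longrightarrow> combination n X k d = combination n X' k d"
  by (simp add: combination_def cong: if_cong)

lemma in_bucket_cong: "(\<And>l. l < k \<Longrightarrow> X l = X' l) \<Longrightarrow> in_bucket X k c \<gamma> = in_bucket X' k c \<gamma>"
  by (simp add: in_bucket_def)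

lemma weight_cong: "(\<And>l. l < k \<Longrightarrow> X l = X' l) \<Longrightarrow> weight n f X k c J = weight n f X' k c J"
  by (simp add: weight_def in_bucket_cong[of k X X'])

lemma sample_cong: "(\<And>l. l < k \<Longrightarrow> X l = X' l) \<Longrightarrow> sample n f X k c J y = sample n f X' k c J y"
  by (simp add: sample_def combination_cong[of k X X'])

lemma avg_directions:
  assumes "\<And>X X'. (\<And>l. l < k \<Longrightarrow> X l = X' l) \<Longrightarrow> g X = g X'"
  shows "avg ((k + M) * n) (\<lambda>z. g (block n z)) = avg (k * n) (\<lambda>z. g (block n z))"
proof -
  have "g (block n (join (k * n) z z')) = g (block n z)" for z z'
    by (rule assms) (simp add: block_join)
  then show ?thesis by (simp add: add_mult_distrib avg_split)
qed

text \<open>With the bucketing vectors fixed, each estimate is a mean of independent bounded samples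
  and Chebyshev applies; a union bound over buckets and \<open>S\<close> follows. For S = {n} the
  bound is free of n.\<close>

lemma inaccurate_le:
  assumes f: "f \<in> cube n \<rightarrow> {- 1, 1}" and "h > 0" "M > 0" "finite S"
  shows "avg ((k + M) * n) (\<lambda>z. of_bool (\<not> accurate n f k M S h z)) \<le> 2 ^ k * card S / (M * h\<^sup>2)"
proof -
  have one: "avg (M * n) (\<lambda>z'. of_bool (\<bar>estimate n f k M (join (k * n) z z') c J -
      weight n f (block n (join (k * n) z z')) k c J\<bar> > h)) \<le> 1 / (M * h\<^sup>2)" for z c J
  proof -
    define \<phi> where "\<phi> z' = sample n f (block n z) k c J (read_vec n z' 0)" for z'
    have "estimate n f k M (join (k * n) z z') c J = (\<Sum>m<M. \<phi> (\<lambda>i. z' (m * n + i))) / M" for z'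
    proof -
      have "read_vec n (\<lambda>i. z' (m * n + i)) 0 = block n z' m" for m
        by (simp add: read_vec_def block_def)
      then show ?thesis
        by (simp add: estimate_def \<phi>_def block_join
            sample_cong[of k "block n (join (k * n) z z')" "block n z"])
    qed
    moreover have "weight n f (block n (join (k * n) z z')) k c J = avg n \<phi>" for z'
    proof -
      have "avg n \<phi> = weight n f (block n z) k c J"
        unfolding \<phi>_def by (simp add: avg_read sample_mean)
      then show ?thesis
        by (simp add: weight_cong[of k "block n (join (k * n) z z')" "block n z"] block_join)
    qed
    moreover have "avg (M * n) (\<lambda>z'. of_bool (\<bar>(\<Sum>m<M. \<phi> (\<lambda>i. z' (m * n + i))) / M - avg n \<phi>\<bar> > h))
      \<le> 1 / (M * h\<^sup>2)"
    proof (rule avg_chebyshev)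
      fix z z' :: "nat \<Rightarrow> nat" assume "\<And>i. i < n \<Longrightarrow> z i = z' i"
      then have "read_vec n z 0 = read_vec n z' 0" by (auto simp: read_vec_def)
      then show "\<phi> z = \<phi> z'" by (simp add: \<phi>_def)
    next
      show "\<bar>\<phi> z\<bar> \<le> 1" for z unfolding \<phi>_def by (rule sample_bound[OF f]) (simp add: read_vec_def)
    qed (use assms in auto)
    ultimately show ?thesis by simp
  qed
  have "avg ((k + M) * n) (\<lambda>z. of_bool (\<not> accurate n f k M S h z)) =
    avg ((k + M) * n) (\<lambda>z. of_bool (\<exists>p\<in>{..<2 ^ k} \<times> S.
      \<bar>estimate n f k M z (fst p) (snd p) - weight n f (block n z) k (fst p) (snd p)\<bar> > h))"
    by (intro arg_cong2[where f = avg] refl ext) (auto simp: accurate_def not_le Bex_def)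
  also have "\<dots> \<le> (\<Sum>p\<in>{..<2 ^ k} \<times> S. avg ((k + M) * n) (\<lambda>z. of_bool (
      \<bar>estimate n f k M z (fst p) (snd p) - weight n f (block n z) k (fst p) (snd p)\<bar> > h)))"
    by (rule avg_ex_le) (use assms in auto)
  also have "\<dots> \<le> (\<Sum>p\<in>{..<2 ^ k :: nat} \<times> S. 1 / (M * h\<^sup>2))"
  proof (rule sum_mono)
    fix p
    have "avg ((k + M) * n) (\<lambda>z. of_bool (
      \<bar>estimate n f k M z (fst p) (snd p) - weight n f (block n z) k (fst p) (snd p)\<bar> > h)) \<le>
      avg (k * n) (\<lambda>z. 1 / (M * h\<^sup>2))"
      unfolding add_mult_distrib avg_split by (intro avg_mono one)
    then show "avg ((k + M) * n) (\<lambda>z. of_bool (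
      \<bar>estimate n f k M z (fst p) (snd p) - weight n f (block n z) k (fst p) (snd p)\<bar> > h)) \<le>
      1 / (M * h\<^sup>2)" by simp
  qed
  also have "\<dots> = 2 ^ k * card S / (M * h\<^sup>2)" by (simp add: card_cartesian_product)
  finally show ?thesis .
qed

text \<open>Distinct characters differ by a nontrivial one, which takes each sign on half of the
  cube; the \<open>k\<close> vectors are independent.\<close>

lemma collide_prob:
  assumes "\<gamma> \<in> cube n" "\<gamma>' \<in> cube n" "\<gamma> \<noteq> \<gamma>'"
  shows "avg ((k + M) * n) (\<lambda>z. of_bool (collide (block n z) k \<gamma> \<gamma>')) = 1 / 2 ^ k"
proof -
  define \<phi> where "\<phi> z = (of_bool (chi \<gamma> (read_vec n z 0) = chi \<gamma>' (read_vec n z 0)) :: real)" for z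
  have ne: "\<gamma> + \<gamma>' \<noteq> 0\<^sub>v n"
  proof
    assume "\<gamma> + \<gamma>' = 0\<^sub>v n"
    moreover have "\<gamma> + \<gamma>' + \<gamma>' = \<gamma>" using assms by (intro cube_add_cancel) auto
    ultimately show False using assms by simp
  qed
  have "avg n \<phi> = (\<Sum>v\<in>cube n. of_bool (chi \<gamma> v = chi \<gamma>' v)) / 2 ^ n"
    unfolding \<phi>_def by (rule avg_read)
  also have "(\<Sum>v\<in>cube n. of_bool (chi \<gamma> v = chi \<gamma>' v)) = (\<Sum>v\<in>cube n. (1 + chi (\<gamma> + \<gamma>') v) / 2 :: real)"
  proof (rule sum.cong)
    fix v assume "v \<in> cube n"
    then have "chi (\<gamma> + \<gamma>') v = chi \<gamma> v * chi \<gamma>' v" using assms by (intro chi_add_left[of _ n]) auto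
    then show "of_bool (chi \<gamma> v = chi \<gamma>' v) = (1 + chi (\<gamma> + \<gamma>') v) / 2"
      using chi_cases[of \<gamma> v] chi_cases[of \<gamma>' v] by auto
  qed simp
  also have "\<dots> = 2 ^ n / 2"
    using sum_chi[of "\<gamma> + \<gamma>'" n] assms ne
    by (simp add: sum_divide_distrib[symmetric] sum.distrib card_cube)
  finally have half: "avg n \<phi> = 1 / 2" by simp
  have "avg ((k + M) * n) (\<lambda>z. of_bool (collide (block n z) k \<gamma> \<gamma>')) =
      avg (k * n) (\<lambda>z. of_bool (collide (block n z) k \<gamma> \<gamma>'))"
    by (rule avg_directions) (simp add: collide_def)
  also have "\<dots> = avg (k * n) (\<lambda>z. \<Prod>l<k. \<phi> (\<lambda>i. z (l * n + i)))"
  proof -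
    have "of_bool (collide (block n z) k \<gamma> \<gamma>') = (\<Prod>l<k. \<phi> (\<lambda>i. z (l * n + i)))" for z
    proof -
      have "read_vec n (\<lambda>i. z (l * n + i)) 0 = block n z l" for l
        by (simp add: read_vec_def block_def)
      then show ?thesis by (auto simp: \<phi>_def collide_def of_bool_def prod_zero)
    qed
    then show ?thesis by simp
  qed
  also have "\<dots> = avg n \<phi> ^ k"
  proof (rule avg_block_prod)
    fix z z' :: "nat \<Rightarrow> nat" assume "\<And>i. i < n \<Longrightarrow> z i = z' i"
    then have "read_vec n z 0 = read_vec n z' 0" by (auto simp: read_vec_def)
    then show "\<phi> z = \<phi> z'" by (simp add: \<phi>_def)
  qed
  finally show ?thesis by (simp add: half power_divide)
qed

lemma weight_n: "weight n f X k c n = (\<Sum>\<gamma>\<in>{\<gamma> \<in> cube n. in_bucket X k c \<gamma>}. sqf n f \<gamma>)"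
proof -
  have "weight n f X k c n = (\<Sum>\<gamma>\<in>cube n. if in_bucket X k c \<gamma> then sqf n f \<gamma> else 0)"
    unfolding weight_def by (intro sum.cong) (auto simp: direction_n)
  then show ?thesis by (simp add: sum.inter_filter)
qed

text \<open>In a bad bucket the weight W exceeds h, and so does W minus any single square. Hence the
  sum of square * (W - square) over the bucket, the mass of its colliding pairs, is at least h^2. By
  Parseval the expected mass of all colliding pairs is at most 1 / 2 ^ k, and Markov's inequality
  concludes.\<close>

lemma inseparable_le:
  assumes f: "f \<in> cube n \<rightarrow> {- 1, 1}" and h: "h > 0"
  shows "avg ((k + M) * n) (\<lambda>z. of_bool (\<not> separated n f k h (block n z))) \<le> 1 / (2 ^ k * h\<^sup>2)"
proof -
  define T where "T X = (\<Sum>\<gamma>\<in>cube n. \<Sum>\<gamma>'\<in>cube n - {\<gamma>}.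
     sqf n f \<gamma> * sqf n f \<gamma>' * of_bool (collide X k \<gamma> \<gamma>'))" for X
  have "of_bool (\<not> separated n f k h X) \<le> T X / h\<^sup>2" for X
  proof (cases "separated n f k h X")
    case True
    then show ?thesis by (simp add: T_def sum_nonneg)
  next
    case False
    then obtain c where c: "weight n f X k c n > h"
      and *: "\<And>\<gamma>. \<gamma> \<in> cube n \<Longrightarrow> in_bucket X k c \<gamma> \<Longrightarrow> weight n f X k c n > sqf n f \<gamma> + h"
      by (force simp: separated_def not_le)
    define B where "B = {\<gamma> \<in> cube n. in_bucket X k c \<gamma>}"
    have finB: "finite B" by (simp add: B_def)
    have w: "weight n f X k c n = (\<Sum>\<gamma>\<in>B. sqf n f \<gamma>)" by (simp add: weight_n B_def)
    have "h * h \<le> weight n f X k c n * h" using c h by (intro mult_right_mono) auto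
    also have "\<dots> = (\<Sum>\<gamma>\<in>B. sqf n f \<gamma> * h)" by (simp add: w sum_distrib_right)
    also have "\<dots> \<le> (\<Sum>\<gamma>\<in>B. sqf n f \<gamma> * (weight n f X k c n - sqf n f \<gamma>))"
      using * by (intro sum_mono mult_left_mono) (force simp: B_def)+
    also have "\<dots> = (\<Sum>\<gamma>\<in>B. \<Sum>\<gamma>'\<in>B - {\<gamma>}. sqf n f \<gamma> * sqf n f \<gamma>' * of_bool (collide X k \<gamma> \<gamma>'))"
    proof (rule sum.cong)
      fix \<gamma> assume \<gamma>: "\<gamma> \<in> B"
      have "weight n f X k c n - sqf n f \<gamma> = (\<Sum>\<gamma>'\<in>B - {\<gamma>}. sqf n f \<gamma>')"
        using \<gamma> finB by (simp add: w sum_diff1)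
      moreover have "collide X k \<gamma> \<gamma>'" if "\<gamma>' \<in> B" for \<gamma>'
        using \<gamma> that collide_iff[of X k c \<gamma> \<gamma>'] by (simp add: B_def)
      ultimately show "sqf n f \<gamma> * (weight n f X k c n - sqf n f \<gamma>) =
        (\<Sum>\<gamma>'\<in>B - {\<gamma>}. sqf n f \<gamma> * sqf n f \<gamma>' * of_bool (collide X k \<gamma> \<gamma>'))"
        by (simp add: sum_distrib_left)
    qed simp
    also have "\<dots> \<le> (\<Sum>\<gamma>\<in>B. \<Sum>\<gamma>'\<in>cube n - {\<gamma>}. sqf n f \<gamma> * sqf n f \<gamma>' * of_bool (collide X k \<gamma> \<gamma>'))"
      by (intro sum_mono sum_mono2) (auto simp: B_def)
    also have "\<dots> \<le> T X"
      unfolding T_def by (intro sum_mono2 sum_nonneg) (auto simp: B_def)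
    finally show ?thesis using h False by (simp add: power2_eq_square field_simps)
  qed
  then have "avg ((k + M) * n) (\<lambda>z. of_bool (\<not> separated n f k h (block n z))) \<le>
    avg ((k + M) * n) (\<lambda>z. T (block n z) / h\<^sup>2)"
    by (intro avg_mono)
  also have "\<dots> = (\<Sum>\<gamma>\<in>cube n. \<Sum>\<gamma>'\<in>cube n - {\<gamma>}. sqf n f \<gamma> * sqf n f \<gamma>' * (1 / 2 ^ k)) / h\<^sup>2"
    unfolding T_def avg_divide avg_sum avg_cmult
    by (intro arg_cong2[where f = "(/)"] sum.cong refl arg_cong2[where f = "(*)"] collide_prob) auto
  also have "\<dots> \<le> (\<Sum>\<gamma>\<in>cube n. \<Sum>\<gamma>'\<in>cube n. sqf n f \<gamma> * sqf n f \<gamma>' * (1 / 2 ^ k)) / h\<^sup>2"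
    by (intro divide_right_mono sum_mono sum_mono2) auto
  also have "\<dots> = (\<Sum>\<gamma>\<in>cube n. sqf n f \<gamma>) * (\<Sum>\<gamma>\<in>cube n. sqf n f \<gamma>) * (1 / 2 ^ k) / h\<^sup>2"
    by (simp add: sum_product sum_divide_distrib)
  also have "\<dots> = 1 / (2 ^ k * h\<^sup>2)" by (simp add: parseval[OF f])
  finally show ?thesis .
qed

text \<open>A first-moment bound: for a fixed \<beta> the expected weight of the other characters in
  its bucket is at most 1 / 2 ^ k.\<close>

lemma overweight_le:
  assumes f: "f \<in> cube n \<rightarrow> {- 1, 1}" and h: "h > 0" and \<beta>: "\<beta> \<in> cube n"
  shows "avg ((k + M) * n) (\<lambda>z. of_bool (\<exists>c. in_bucket (block n z) k c \<beta> \<and>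
     weight n f (block n z) k c n > sqf n f \<beta> + h)) \<le> 1 / (2 ^ k * h)"
proof -
  define T where "T X = (\<Sum>\<gamma>\<in>cube n - {\<beta>}. sqf n f \<gamma> * of_bool (collide X k \<gamma> \<beta>))" for X
  have "of_bool (\<exists>c. in_bucket X k c \<beta> \<and> weight n f X k c n > sqf n f \<beta> + h) \<le> T X / h" for X
  proof (cases "\<exists>c. in_bucket X k c \<beta> \<and> weight n f X k c n > sqf n f \<beta> + h")
    case False
    have "0 \<le> T X / h" using h by (simp add: T_def sum_nonneg)
    then show ?thesis using False by (simp only: of_bool_def if_False)
  next
    case True
    then obtain c where c: "in_bucket X k c \<beta>" "weight n f X k c n > sqf n f \<beta> + h" by blast
    define B where "B = {\<gamma> \<in> cube n. in_bucket X k c \<gamma>}"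
    have finB: "finite B" "\<beta> \<in> B" using c \<beta> by (auto simp: B_def)
    have "weight n f X k c n - sqf n f \<beta> = (\<Sum>\<gamma>\<in>B - {\<beta>}. sqf n f \<gamma>)"
      using finB by (simp add: weight_n B_def[symmetric] sum_diff1)
    also have "\<dots> = (\<Sum>\<gamma>\<in>B - {\<beta>}. sqf n f \<gamma> * of_bool (collide X k \<gamma> \<beta>))"
      using collide_iff c by (intro sum.cong) (auto simp: B_def)
    also have "\<dots> \<le> T X" unfolding T_def by (intro sum_mono2) (auto simp: B_def)
    finally show ?thesis using c h True by simp
  qed
  then have "avg ((k + M) * n) (\<lambda>z. of_bool (\<exists>c. in_bucket (block n z) k c \<beta> \<and>
     weight n f (block n z) k c n > sqf n f \<beta> + h)) \<le> avg ((k + M) * n) (\<lambda>z. T (block n z) / h)"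
    by (intro avg_mono)
  also have "\<dots> = (\<Sum>\<gamma>\<in>cube n - {\<beta>}. sqf n f \<gamma> * (1 / 2 ^ k)) / h"
    unfolding T_def avg_divide avg_sum avg_cmult
    by (intro arg_cong2[where f = "(/)"] sum.cong refl arg_cong2[where f = "(*)"] collide_prob)
      (use \<beta> in auto)
  also have "\<dots> \<le> (\<Sum>\<gamma>\<in>cube n. sqf n f \<gamma> * (1 / 2 ^ k)) / h"
    using h by (intro divide_right_mono sum_mono2) auto
  also have "\<dots> = 1 / (2 ^ k * h)"
    using parseval[OF f] by (simp add: sum_divide_distrib[symmetric])
  finally show ?thesis .
qed

subsection \<open>One round of the verifier\<close>

definition accepts_round :: "nat \<Rightarrow> (bit vec \<Rightarrow> real) \<Rightarrow> nat \<Rightarrow> nat \<Rightarrow> real \<Rightarrow> bit vec set \<Rightarrow> (nat \<Rightarrow> nat) \<Rightarrow> bool" where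
  "accepts_round n f k M \<theta> \<Gamma> z \<longleftrightarrow> (\<forall>c<2 ^ k. \<forall>c'<2 ^ k.
     (\<forall>\<gamma>\<in>\<Gamma>. \<not> in_bucket (block n z) k c \<gamma>) \<longrightarrow> (\<exists>\<gamma>\<in>\<Gamma>. in_bucket (block n z) k c' \<gamma>) \<longrightarrow>
     estimate n f k M z c n \<le> estimate n f k M z c' n + \<theta> / 8)"

definition sq_top :: "nat \<Rightarrow> (bit vec \<Rightarrow> real) \<Rightarrow> real \<Rightarrow> bit vec set \<Rightarrow> bool" where
  "sq_top n f \<theta> \<Gamma> \<longleftrightarrow> (\<forall>\<alpha>\<in>cube n - \<Gamma>. \<forall>\<beta>\<in>\<Gamma>. sqf n f \<alpha> \<le> sqf n f \<beta> + \<theta>)"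

text \<open>With h = \<theta> / 64: a bucket without a claimed character is light or dominated by an
  unclaimed one, so its weight exceeds the square of any claimed \<beta> by at most 5 * h + h. Two
  estimation errors make this 8 * h, the tolerance \<theta> / 8.\<close>

lemma round_complete:
  assumes f: "f \<in> cube n \<rightarrow> {- 1, 1}" and \<theta>: "\<theta> > 0" and M: "M > 0" and \<Gamma>: "\<Gamma> \<subseteq> cube n"
    and top: "sq_top n f (5 * \<theta> / 64) \<Gamma>"
  shows "avg ((k + M) * n) (\<lambda>z. of_bool (\<not> accepts_round n f k M \<theta> \<Gamma> z)) \<le>
    (1 / 2 ^ k + 2 ^ k / M) * (64 / \<theta>)\<^sup>2"
proof -
  define h where "h = \<theta> / 64"
  have h: "h > 0" using \<theta> by (simp add: h_def)
  have "accepts_round n f k M \<theta> \<Gamma> z" if sep: "separated n f k h (block n z)" and acc: "accurate n f k M {n} h z" for z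
    unfolding accepts_round_def
  proof (intro allI impI)
    fix c c' :: nat
    let ?X = "block n z"
    assume c: "c < 2 ^ k" "c' < 2 ^ k" and unhit: "\<forall>\<gamma>\<in>\<Gamma>. \<not> in_bucket ?X k c \<gamma>"
      and "\<exists>\<gamma>\<in>\<Gamma>. in_bucket ?X k c' \<gamma>"
    then obtain \<beta> where \<beta>: "\<beta> \<in> \<Gamma>" "in_bucket ?X k c' \<beta>" by blast
    have e: "\<bar>estimate n f k M z c n - weight n f ?X k c n\<bar> \<le> h"
      "\<bar>estimate n f k M z c' n - weight n f ?X k c' n\<bar> \<le> h"
      using acc c by (auto simp: accurate_def)
    have w': "sqf n f \<beta> \<le> weight n f ?X k c' n"
      unfolding weight_n using \<beta> \<Gamma> by (intro member_le_sum) auto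
    have w: "weight n f ?X k c n \<le> sqf n f \<beta> + 6 * h"
    proof -
      consider "weight n f ?X k c n \<le> h"
        | \<gamma> where "\<gamma> \<in> cube n" "in_bucket ?X k c \<gamma>" "weight n f ?X k c n \<le> sqf n f \<gamma> + h"
        using sep by (auto simp: separated_def)
      then show ?thesis
      proof cases
        case 1
        then show ?thesis using h sqf_nonneg[of n f \<beta>] by linarith
      next
        case 2
        then have "\<gamma> \<in> cube n - \<Gamma>" using unhit by blast
        then have "sqf n f \<gamma> \<le> sqf n f \<beta> + 5 * h"
          using top \<beta> by (simp add: sq_top_def h_def)
        then show ?thesis using 2 by simp
      qed
    qed
    have "\<theta> / 8 = 8 * h" by (simp add: h_def)
    then show "estimate n f k M z c n \<le> estimate n f k M z c' n + \<theta> / 8"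
      using e w w' by (simp add: abs_le_iff)
  qed
  then have "avg ((k + M) * n) (\<lambda>z. of_bool (\<not> accepts_round n f k M \<theta> \<Gamma> z)) \<le>
    avg ((k + M) * n) (\<lambda>z. of_bool (\<not> separated n f k h (block n z) \<or> \<not> accurate n f k M {n} h z))"
    by (intro avg_mono) auto
  also have "\<dots> \<le> 1 / (2 ^ k * h\<^sup>2) + 2 ^ k * card {n} / (M * h\<^sup>2)"
    using avg_disj_le inseparable_le[OF f h, of k M] inaccurate_le[OF f h M, of "{n}" k]
    by (intro order_trans[OF avg_disj_le] add_mono) auto
  also have "\<dots> = (1 / 2 ^ k + 2 ^ k / M) * (64 / \<theta>)\<^sup>2"
    using \<theta> M by (simp add: h_def field_simps power2_eq_square)
  finally show ?thesis .
qed

text \<open>Take a missing \<alpha> whose square exceeds that of a claimed \<beta> by more than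
  \<theta> = 64 * h. Unless \<alpha> collides with a claim, its bucket is unclaimed and weighs at
  least its square. If the bucket of \<beta> is not overweight and the estimates are accurate, they
  differ by more than 61 * h, beyond the tolerance 8 * h.\<close>

lemma round_sound:
  assumes f: "f \<in> cube n \<rightarrow> {- 1, 1}" and \<theta>: "0 < \<theta>" "\<theta> \<le> 1" and M: "M > 0" and \<Gamma>: "\<Gamma> \<subseteq> cube n"
    and top: "\<not> sq_top n f \<theta> \<Gamma>"
  shows "avg ((k + M) * n) (\<lambda>z. of_bool (accepts_round n f k M \<theta> \<Gamma> z)) \<le>
    card \<Gamma> / 2 ^ k + (1 / 2 ^ k + 2 ^ k / M) * (64 / \<theta>)\<^sup>2"
proof -
  define h where "h = \<theta> / 64"
  have h: "0 < h" "h \<le> 1" using \<theta> by (simp_all add: h_def)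
  obtain \<alpha> \<beta> where \<alpha>: "\<alpha> \<in> cube n" "\<alpha> \<notin> \<Gamma>" and \<beta>: "\<beta> \<in> \<Gamma>" "sqf n f \<alpha> > sqf n f \<beta> + \<theta>"
    using top by (auto simp: sq_top_def not_le)
  define over where "over z \<longleftrightarrow> (\<exists>c. in_bucket (block n z) k c \<beta> \<and>
     weight n f (block n z) k c n > sqf n f \<beta> + h)" for z
  have "\<not> accepts_round n f k M \<theta> \<Gamma> z" if nocoll: "\<not> (\<exists>\<gamma>\<in>\<Gamma>. collide (block n z) k \<alpha> \<gamma>)"
    and acc: "accurate n f k M {n} h z" and ov: "\<not> over z" for z
  proof
    let ?X = "block n z"
    assume A: "accepts_round n f k M \<theta> \<Gamma> z"
    obtain c where c: "c < 2 ^ k" "in_bucket ?X k c \<alpha>" using ex_bucket by blast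
    obtain c' where c': "c' < 2 ^ k" "in_bucket ?X k c' \<beta>" using ex_bucket by blast
    have "\<not> in_bucket ?X k c \<gamma>" if "\<gamma> \<in> \<Gamma>" for \<gamma>
      using nocoll that collide_iff[OF c(2)] by blast
    then have le: "estimate n f k M z c n \<le> estimate n f k M z c' n + \<theta> / 8"
      using A c c' \<beta> unfolding accepts_round_def by blast
    have e: "\<bar>estimate n f k M z c n - weight n f ?X k c n\<bar> \<le> h"
      "\<bar>estimate n f k M z c' n - weight n f ?X k c' n\<bar> \<le> h"
      using acc c c' by (auto simp: accurate_def)
    have w: "sqf n f \<alpha> \<le> weight n f ?X k c n"
      unfolding weight_n using \<alpha> c by (intro member_le_sum) auto
    have w': "weight n f ?X k c' n \<le> sqf n f \<beta> + h"
      using ov c' unfolding over_def by force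
    have "\<theta> = 64 * h" by (simp add: h_def)
    then show False using e w w' le \<beta> h by (simp add: abs_le_iff)
  qed
  then have "avg ((k + M) * n) (\<lambda>z. of_bool (accepts_round n f k M \<theta> \<Gamma> z)) \<le>
    avg ((k + M) * n) (\<lambda>z. of_bool ((\<exists>\<gamma>\<in>\<Gamma>. collide (block n z) k \<alpha> \<gamma>) \<or>
      (over z \<or> \<not> accurate n f k M {n} h z)))"
    by (intro avg_mono) (auto simp: of_bool_def)
  also have "\<dots> \<le> avg ((k + M) * n) (\<lambda>z. of_bool (\<exists>\<gamma>\<in>\<Gamma>. collide (block n z) k \<alpha> \<gamma>)) +
    (avg ((k + M) * n) (\<lambda>z. of_bool (over z)) + avg ((k + M) * n) (\<lambda>z. of_bool (\<not> accurate n f k M {n} h z)))"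
    by (rule order_trans[OF avg_disj_le]) (intro add_left_mono avg_disj_le)
  also have "\<dots> \<le> card \<Gamma> / 2 ^ k + (1 / (2 ^ k * h) + 2 ^ k * card {n} / (M * h\<^sup>2))"
  proof (intro add_mono)
    have "avg ((k + M) * n) (\<lambda>z. of_bool (\<exists>\<gamma>\<in>\<Gamma>. collide (block n z) k \<alpha> \<gamma>)) \<le>
      (\<Sum>\<gamma>\<in>\<Gamma>. avg ((k + M) * n) (\<lambda>z. of_bool (collide (block n z) k \<alpha> \<gamma>)))"
      by (rule avg_ex_le) (use \<Gamma> finite_cube finite_subset in blast)
    also have "\<dots> = (\<Sum>\<gamma>\<in>\<Gamma>. 1 / 2 ^ k)"
      using \<alpha> \<Gamma> by (intro sum.cong refl collide_prob) auto
    finally show "avg ((k + M) * n) (\<lambda>z. of_bool (\<exists>\<gamma>\<in>\<Gamma>. collide (block n z) k \<alpha> \<gamma>)) \<le> card \<Gamma> / 2 ^ k"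
      by simp
    show "avg ((k + M) * n) (\<lambda>z. of_bool (over z)) \<le> 1 / (2 ^ k * h)"
      unfolding over_def by (rule overweight_le[OF f]) (use h \<beta> \<Gamma> in auto)
    show "avg ((k + M) * n) (\<lambda>z. of_bool (\<not> accurate n f k M {n} h z)) \<le> 2 ^ k * card {n} / (M * h\<^sup>2)"
      by (rule inaccurate_le[OF f]) (use h M in auto)
  qed
  \<comment> \<open>Since h \<le> 1, this weakening is possible; it gives soundness the error terms
    of completeness, plus collisions.\<close>
  also have "1 / (2 ^ k * h) \<le> 1 / (2 ^ k * h\<^sup>2)"
    using h by (intro divide_left_mono mult_left_mono) (auto simp: power2_eq_square mult_le_one)
  also have "card \<Gamma> / 2 ^ k + (1 / (2 ^ k * h\<^sup>2) + 2 ^ k * card {n} / (M * h\<^sup>2)) =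
     card \<Gamma> / 2 ^ k + (1 / 2 ^ k + 2 ^ k / M) * (64 / \<theta>)\<^sup>2"
    using \<theta> M by (simp add: h_def field_simps power2_eq_square)
  finally show ?thesis by simp
qed

text \<open>Exponential Markov bound: a bad round has weight 4, any other weight 1, so the mean
  weight is at most 1 + 3 / 12 = 5 / 4. With \<open>b\<close> bad rounds the product is at least 4 ^
  b, and (5 / 4) ^ (2 * b) / 4 ^ b = (25 / 64) ^ b \<le> 1 / 2 ^ b.\<close>

lemma majority_le:
  assumes dep: "\<And>z z'. (\<And>i. i < B \<Longrightarrow> z i = z' i) \<Longrightarrow> Q z = Q z'"
    and p: "avg B (\<lambda>z. of_bool (Q z)) \<le> 1 / 12"
  shows "avg (2 * b * B) (\<lambda>z. of_bool (card {r. r < 2 * b \<and> Q (\<lambda>i. z (r * B + i))} \<ge> b)) \<le> 1 / 2 ^ b"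
proof -
  define \<phi> where "\<phi> z = (if Q z then 4 else 1 :: real)" for z
  have "of_bool (card {r. r < 2 * b \<and> Q (\<lambda>i. z (r * B + i))} \<ge> b) \<le>
      (\<Prod>r<2 * b. \<phi> (\<lambda>i. z (r * B + i))) / 4 ^ b" for z
  proof -
    have "(\<Prod>r<2 * b. \<phi> (\<lambda>i. z (r * B + i))) = 4 ^ card {r. r < 2 * b \<and> Q (\<lambda>i. z (r * B + i))}"
      by (simp add: \<phi>_def prod.If_cases Int_def)
    moreover have "(4 :: real) ^ b \<le> 4 ^ m" if "b \<le> m" for m
      using that by (intro power_increasing) auto
    ultimately show ?thesis by (auto simp: of_bool_def)
  qed
  then have "avg (2 * b * B) (\<lambda>z. of_bool (card {r. r < 2 * b \<and> Q (\<lambda>i. z (r * B + i))} \<ge> b)) \<le>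
     avg (2 * b * B) (\<lambda>z. (\<Prod>r<2 * b. \<phi> (\<lambda>i. z (r * B + i))) / 4 ^ b)"
    by (intro avg_mono)
  also have "\<dots> = avg B \<phi> ^ (2 * b) / 4 ^ b"
  proof -
    have "avg (2 * b * B) (\<lambda>z. \<Prod>r<2 * b. \<phi> (\<lambda>i. z (r * B + i))) = avg B \<phi> ^ (2 * b)"
    proof (rule avg_block_prod)
      fix z z' :: "nat \<Rightarrow> nat" assume "\<And>i. i < B \<Longrightarrow> z i = z' i"
      then have "Q z = Q z'" by (rule dep)
      then show "\<phi> z = \<phi> z'" by (simp add: \<phi>_def)
    qed
    then show ?thesis by (simp add: avg_divide)
  qed
  also have "\<dots> = (avg B \<phi> ^ 2 / 4) ^ b" by (simp add: power_mult power_divide)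
  also have "\<dots> \<le> (1 / 2) ^ b"
  proof (rule power_mono)
    have "avg B \<phi> = avg B (\<lambda>z. 1 + 3 * of_bool (Q z))"
      by (intro avg_cong) (simp add: \<phi>_def)
    also have "\<dots> \<le> 5 / 4" using p by (simp add: avg_add avg_cmult)
    finally have "avg B \<phi> \<le> 5 / 4" .
    moreover have "0 \<le> avg B \<phi>" unfolding avg_def by (intro divide_nonneg_nonneg sum_nonneg) (auto simp: \<phi>_def)
    ultimately have "avg B \<phi> ^ 2 \<le> (5 / 4) ^ 2" by (intro power_mono)
    then show "avg B \<phi> ^ 2 / 4 \<le> 1 / 2" by (simp add: power2_eq_square)
  qed simp
  finally show ?thesis by (simp add: power_divide)
qed

subsection \<open>Decoding the heavy buckets\<close>

definition decode :: "nat \<Rightarrow> (bit vec \<Rightarrow> real) \<Rightarrow> nat \<Rightarrow> nat \<Rightarrow> (nat \<Rightarrow> nat) \<Rightarrow> nat \<Rightarrow> bit vec" where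
  "decode n f k M z c = Matrix.vec n (\<lambda>J. if estimate n f k M z c J < 0 then 1 else 0)"

text \<open>An estimate above 4 * h forces a dominating character with square above 2 * h, the rest
  of the bucket weighing at most h. Each signed weight is within h of plus or minus that square and
  its estimate within 2 * h, so all signs are read correctly.\<close>

lemma decode_heavy:
  assumes sep: "separated n f k h (block n z)" and acc: "accurate n f k M {..n} h z"
    and h: "h > 0" and c: "c < 2 ^ k" and heavy: "estimate n f k M z c n > 4 * h"
  shows "in_bucket (block n z) k c (decode n f k M z c)"
    and "estimate n f k M z c n \<le> sqf n f (decode n f k M z c) + 2 * h"
    and "\<alpha> \<in> cube n \<Longrightarrow> in_bucket (block n z) k c \<alpha> \<Longrightarrow> sqf n f \<alpha> > h \<Longrightarrow> \<alpha> = decode n f k M z c"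
proof -
  let ?X = "block n z"
  have e: "\<bar>estimate n f k M z c J - weight n f ?X k c J\<bar> \<le> h" if "J \<le> n" for J
    using acc c that by (auto simp: accurate_def)
  have "weight n f ?X k c n > h" using e[of n] heavy h by (simp add: abs_le_iff)
  then obtain \<gamma> where \<gamma>: "\<gamma> \<in> cube n" "in_bucket ?X k c \<gamma>" "weight n f ?X k c n \<le> sqf n f \<gamma> + h"
    using sep unfolding separated_def by (metis not_le)
  have \<gamma>2: "sqf n f \<gamma> > 2 * h" using e[of n] heavy \<gamma>(3) by (simp add: abs_le_iff)
  define B where "B = {\<gamma> \<in> cube n. in_bucket ?X k c \<gamma>}"
  have B: "finite B" "\<gamma> \<in> B" using \<gamma> by (auto simp: B_def)
  have rest: "(\<Sum>\<gamma>'\<in>B - {\<gamma>}. sqf n f \<gamma>') \<le> h"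
    using \<gamma>(3) B by (simp add: weight_n B_def[symmetric] sum_diff1)
  have "(if estimate n f k M z c J < 0 then 1 else 0) = \<gamma> $ J" if J: "J < n" for J
  proof -
    have "weight n f ?X k c J = (\<Sum>\<gamma>'\<in>B. sqf n f \<gamma>' * chi \<gamma>' (direction n J))"
    proof -
      have "weight n f ?X k c J = (\<Sum>\<gamma>'\<in>cube n. if in_bucket ?X k c \<gamma>' then sqf n f \<gamma>' * chi \<gamma>' (direction n J) else 0)"
        unfolding weight_def by (intro sum.cong) auto
      then show ?thesis by (simp add: sum.inter_filter B_def)
    qed
    then have "weight n f ?X k c J - sqf n f \<gamma> * chi \<gamma> (direction n J) =
        (\<Sum>\<gamma>'\<in>B - {\<gamma>}. sqf n f \<gamma>' * chi \<gamma>' (direction n J))"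
      using B by (simp add: sum_diff1)
    also have "\<bar>\<dots>\<bar> \<le> (\<Sum>\<gamma>'\<in>B - {\<gamma>}. sqf n f \<gamma>')"
      by (intro order_trans[OF sum_abs] sum_mono) (simp add: abs_mult)
    finally have "\<bar>weight n f ?X k c J - sqf n f \<gamma> * chi \<gamma> (direction n J)\<bar> \<le> h"
      using rest by simp
    then have "\<bar>estimate n f k M z c J - sqf n f \<gamma> * chi \<gamma> (direction n J)\<bar> \<le> 2 * h"
      using e[of J] J by (simp add: abs_le_iff)
    then show ?thesis
      using \<gamma>2 h bit_zero_or_one[of "\<gamma> $ J"] chi_direction[OF \<gamma>(1) J]
      by (auto simp: abs_le_iff)
  qed
  then have dec: "decode n f k M z c = \<gamma>"
    using \<gamma>(1) by (intro eq_vecI) (auto simp: decode_def)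
  show "in_bucket ?X k c (decode n f k M z c)" using dec \<gamma> by simp
  show "estimate n f k M z c n \<le> sqf n f (decode n f k M z c) + 2 * h"
    using dec \<gamma>(3) e[of n] by (simp add: abs_le_iff)
  show "\<alpha> = decode n f k M z c" if \<alpha>: "\<alpha> \<in> cube n" "in_bucket ?X k c \<alpha>" "sqf n f \<alpha> > h"
  proof (rule ccontr)
    assume "\<alpha> \<noteq> decode n f k M z c"
    then have "\<alpha> \<in> B - {\<gamma>}" using \<alpha> dec by (simp add: B_def)
    then have "sqf n f \<alpha> \<le> (\<Sum>\<gamma>'\<in>B - {\<gamma>}. sqf n f \<gamma>')"
      using B by (intro member_le_sum) auto
    then show False using rest \<alpha> by simp
  qed
qed

text \<open>Assumption \<open>sel\<close> is what greedy selection guarantees: if a bucket of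
  positive estimate is left out, every selected vector comes from a bucket with at least that
  estimate. A heavy missing \<alpha> loses h in its own bucket and 2 * h in that of \<beta>; the
  slack 10 * h settles every \<alpha> whose square is at most 10 * h.\<close>

lemma selection_sq_top:
  assumes sep: "separated n f k h (block n z)" and acc: "accurate n f k M {..n} h z" and h: "h > 0"
    and sel: "\<And>c \<beta>. c < 2 ^ k \<Longrightarrow> decode n f k M z c \<notin> \<Gamma> \<Longrightarrow> estimate n f k M z c n > 0 \<Longrightarrow> \<beta> \<in> \<Gamma> \<Longrightarrow>
      \<exists>c'<2 ^ k. \<beta> = decode n f k M z c' \<and> estimate n f k M z c n \<le> estimate n f k M z c' n"
  shows "sq_top n f (10 * h) \<Gamma>"
  unfolding sq_top_def
proof (intro ballI)
  fix \<alpha> \<beta> assume \<alpha>: "\<alpha> \<in> cube n - \<Gamma>" and \<beta>: "\<beta> \<in> \<Gamma>"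
  show "sqf n f \<alpha> \<le> sqf n f \<beta> + 10 * h"
  proof (cases "sqf n f \<alpha> \<le> 10 * h")
    case True
    then show ?thesis using sqf_nonneg[of n f \<beta>] by linarith
  next
    case False
    obtain c where c: "c < 2 ^ k" "in_bucket (block n z) k c \<alpha>" using ex_bucket by blast
    have "sqf n f \<alpha> \<le> weight n f (block n z) k c n"
      unfolding weight_n using \<alpha> c by (intro member_le_sum) auto
    moreover have "\<bar>estimate n f k M z c n - weight n f (block n z) k c n\<bar> \<le> h"
      using acc c by (auto simp: accurate_def)
    ultimately have est: "sqf n f \<alpha> \<le> estimate n f k M z c n + h" by (simp add: abs_le_iff)
    then have heavy: "estimate n f k M z c n > 4 * h" using False h by linarith
    have "\<alpha> = decode n f k M z c"
      using decode_heavy(3)[OF sep acc h c(1) heavy] \<alpha> c False h by simp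
    then have "decode n f k M z c \<notin> \<Gamma>" using \<alpha> by simp
    moreover have "estimate n f k M z c n > 0" using heavy h by linarith
    ultimately obtain c' where c': "c' < 2 ^ k" "\<beta> = decode n f k M z c'"
      "estimate n f k M z c n \<le> estimate n f k M z c' n"
      using sel[OF c(1) _ _ \<beta>] by blast
    then have "estimate n f k M z c' n \<le> sqf n f \<beta> + 2 * h"
      using decode_heavy(2)[OF sep acc h c'(1)] heavy by simp
    then show ?thesis using est c' h by linarith
  qed
qed

section \<open>Programs\<close>

declare den.simps(5) [simp del]

abbreviation (input) Add_e (infixl "[+]" 65) where "a [+] b \<equiv> Op Plus a b"
abbreviation (input) Sub_e (infixl "[-]" 65) where "a [-] b \<equiv> Op Minus a b"
abbreviation (input) Mul_e (infixl "[*]" 70) where "a [*] b \<equiv> Op Times a b"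
abbreviation (input) Less_e (infix "[<]" 55) where "a [<] b \<equiv> Op Less a b"
abbreviation (input) Eq_e (infix "[=]" 55) where "a [=] b \<equiv> Op Eq a b"
abbreviation parity where "parity e \<equiv> Op Mod e (Const 2)"
abbreviation half where "half e \<equiv> Op Div e (Const 2)"
abbreviation (input) PSeq_infix (infixr ";;" 50) where "p ;; q \<equiv> PSeq p q"
abbreviation set_reg (infix "[:=]" 54) where "a [:=] e \<equiv> PAssign a (Const 0) e"

text \<open>Three loop shapes, accumulating into a register, filling consecutive cells and adding in
  place, cover most loops below without a new invariant.\<close>

lemma for_sum:
  assumes wf: "wf (PFor x e p)" and "acc \<noteq> x"
    and step: "\<And>i m'. i < eval m e \<Longrightarrow> m' x 0 = i \<Longrightarrow>
      (\<And>a. a \<notin> insert x (writes p) \<Longrightarrow> m' a = m a) \<Longrightarrow> den n f p m' acc 0 = m' acc 0 + g i"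
  shows "den n f (PFor x e p) m acc 0 = m acc 0 + (\<Sum>i<eval m e. g i)"
  by (rule for_rule[OF wf, where I = "\<lambda>i m'. m' acc 0 = m acc 0 + (\<Sum>i<i. g i)"])
    (use assms in auto)

lemma for_fill:
  assumes wf: "wf (PFor x e (PAssign a ix ex))" and a: "a \<notin> arrays ex"
    and ix: "\<And>j m'. m' x 0 = j \<Longrightarrow> (\<And>b. b \<notin> {x, a} \<Longrightarrow> m' b = m b) \<Longrightarrow> eval m' ix = s + j"
    and ex: "\<And>j m'. m' x 0 = j \<Longrightarrow> (\<And>b. b \<notin> {x, a} \<Longrightarrow> m' b = m b) \<Longrightarrow> eval m' ex = g j"
  shows "den n f (PFor x e (PAssign a ix ex)) m a =
    (\<lambda>q. if s \<le> q \<and> q < s + eval m e then g (q - s) else m a q)"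
  by (rule for_rule[OF wf, where I = "\<lambda>i m'. m' a = (\<lambda>q. if s \<le> q \<and> q < s + i then g (q - s) else m a q)"])
    (use assms in \<open>auto simp: upd_def fun_eq_iff\<close>)

lemma for_add:
  assumes wf: "wf (PFor x e (PAssign a (reg x) (Cell a (reg x) [+] ex)))" and a: "a \<notin> arrays ex"
    and ex: "\<And>j m'. m' x 0 = j \<Longrightarrow> (\<And>b. b \<notin> {x, a} \<Longrightarrow> m' b = m b) \<Longrightarrow> eval m' ex = g j"
  shows "den n f (PFor x e (PAssign a (reg x) (Cell a (reg x) [+] ex))) m a =
    (\<lambda>q. if q < eval m e then m a q + g q else m a q)"
  by (rule for_rule[OF wf, where I = "\<lambda>i m'. m' a = (\<lambda>q. if q < i then m a q + g q else m a q)"])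
    (use assms in \<open>auto simp: upd_def fun_eq_iff less_Suc_eq\<close>)

text \<open>
  Array \<open>4\<close> is the random tape and array \<open>5\<close> holds the constants \<open>k\<close>, \<open>2 ^ k\<close>, \<open>M\<close>, \<open>M * 2 ^ k\<close>,
  the length of the part of the tape used in one round, the number of rounds and the length of
  the tape. Register \<open>22\<close> is the round, \<open>23\<close> the bucket \<open>c\<close> and \<open>24\<close> the direction \<open>J\<close>;
  \<open>bucket_count\<close> leaves its result in register \<open>10\<close>.
\<close>

abbreviation "en \<equiv> Cell 0 (Const 0)"
abbreviation "et \<equiv> Cell 0 (Const 1)"
abbreviation "ea \<equiv> Cell 0 (Const 2)"
abbreviation "eb \<equiv> Cell 0 (Const 3)"
abbreviation "ek \<equiv> Cell 5 (Const 0)"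
abbreviation "eK \<equiv> Cell 5 (Const 1)"
abbreviation "eM \<equiv> Cell 5 (Const 2)"
abbreviation "eMK \<equiv> Cell 5 (Const 3)"
abbreviation "eB \<equiv> Cell 5 (Const 4)"
abbreviation "eR \<equiv> Cell 5 (Const 5)"

text \<open>The offset selects the part of the tape for the current round. The prover leaves
  register 22 at 0 and so reuses the code for a single round.\<close>

abbreviation "tape_at e \<equiv> Cell 4 (reg 22 [*] eB [+] e)"

text \<open>Entries of array 16 are plain sums, reduced modulo 2 only by the query. Multiplying by
  the parity of register 17, the current digit of \<open>d\<close>, replaces a conditional and keeps
  the summand a bit, as tameness requires.\<close>

definition "add_direction = PFor 13 en (PAssign 16 (reg 13)
   (Cell 16 (reg 13) [+] (parity (reg 17) [*] parity (tape_at (reg 14 [*] en [+] reg 13)))))"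

definition "combine = PFor 14 ek (add_direction ;;
   19 [:=] reg 19 [+] (parity (reg 17) [*] parity (reg 18)) ;; 17 [:=] half (reg 17) ;; 18 [:=] half (reg 18))"

definition "load_point = PFor 13 en (PAssign 15 (reg 13) (tape_at ((ek [+] reg 11) [*] en [+] reg 13)))"

definition "copy_point = PFor 13 en (PAssign 16 (reg 13) (Cell 15 (reg 13)))"

text \<open>Cell \<open>J\<close> of the second query point is raised by one; for J = n it lies
  beyond the vector and the point stays the same. Register 10 counts agreeing signs instead of
  summing them, as memory holds natural numbers only.\<close>

definition "count_step = (load_point ;; copy_point ;; PAssign 16 (reg 24) (Cell 16 (reg 24) [+] Const 1) ;;
   17 [:=] reg 12 ;; 18 [:=] reg 23 ;; 19 [:=] Const 0 ;; combine ;;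
   PQuery 20 (Const 0) 15 ;; PQuery 21 (Const 0) 16 ;;
   10 [:=] reg 10 [+] (Const 1 [-] parity (reg 19 [+] reg 20 [+] reg 21)))"

definition "bucket_count = (10 [:=] Const 0 ;; PFor 11 eM (PFor 12 eK count_step))"

lemma writes_bucket_count [simp]:
  "writes add_direction = {13, 16}" "writes combine = {13, 14, 16, 17, 18, 19}"
  "writes load_point = {13, 15}" "writes copy_point = {13, 16}"
  "writes count_step = {10, 13, 14, 15, 16, 17, 18, 19, 20, 21}"
  "writes bucket_count = {10, 11, 12, 13, 14, 15, 16, 17, 18, 19, 20, 21}"
  by (auto simp: add_direction_def combine_def load_point_def copy_point_def count_step_def bucket_count_def)

lemma wf_bucket_count [simp]:
  "wf add_direction" "wf combine" "wf load_point" "wf copy_point" "wf count_step" "wf bucket_count"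
  by (auto simp: combine_def count_step_def bucket_count_def)
    (auto simp: add_direction_def load_point_def copy_point_def)

lemma den_add_direction: "den n f add_direction m 16 = (\<lambda>q. if q < m 0 0 then
    m 16 q + m 17 0 mod 2 * (m 4 (m 22 0 * m 5 4 + (m 14 0 * m 0 0 + q)) mod 2) else m 16 q)"
  unfolding add_direction_def
  by (subst for_add[where g = "\<lambda>q. m 17 0 mod 2 * (m 4 (m 22 0 * m 5 4 + (m 14 0 * m 0 0 + q)) mod 2)"])
    auto

lemma den_combine:
  fixes m :: mem
  defines "z \<equiv> \<lambda>i. m 4 (m 22 0 * m 5 4 + i)"
  shows "den n f combine m 16 = (\<lambda>q. if q < m 0 0 then
      m 16 q + (\<Sum>l<m 5 0. of_bool (bit (m 17 0) l) * (z (l * m 0 0 + q) mod 2)) else m 16 q)" (is ?A)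
    and "den n f combine m 19 0 = m 19 0 + (\<Sum>l<m 5 0. of_bool (bit (m 17 0) l) * of_bool (bit (m 18 0) l))" (is ?B)
proof -
  let ?I = "\<lambda>i m'. m' 16 = (\<lambda>q. if q < m 0 0 then
      m 16 q + (\<Sum>l<i. of_bool (bit (m 17 0) l) * (z (l * m 0 0 + q) mod 2)) else m 16 q) \<and>
      m' 19 0 = m 19 0 + (\<Sum>l<i. of_bool (bit (m 17 0) l) * of_bool (bit (m 18 0) l)) \<and>
      m' 17 0 = m 17 0 div 2 ^ i \<and> m' 18 0 = m 18 0 div 2 ^ i"
  have "?I (eval m ek) (den n f combine m)"
    unfolding combine_def
  proof (rule for_rule, goal_cases)
    case 1
    then show ?case using wf_bucket_count(2) by (simp add: combine_def)
  next
    case 2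
    then show ?case by auto
  next
    case (3 i m')
    have fr: "m' 0 = m 0" "m' 4 = m 4" "m' 5 = m 5" "m' 22 = m 22" using 3(3) by auto
    have bits: "x div 2 ^ i mod 2 = of_bool (bit x i)" for x :: nat
      by (simp add: bit_iff_odd mod_2_eq_odd)
    have dv: "x div 2 ^ i div 2 = x div 2 ^ Suc i" for x :: nat
      by (simp only: power_Suc2 div_mult2_eq)
    show ?case
      using 3(2,4) by (auto simp: den_add_direction den_frame fr bits dv z_def fun_eq_iff simp del: power_Suc)
  qed
  then have I: "?I (m 5 0) (den n f combine m)" by (simp only: eval.simps)
  show ?A ?B using I by blast+
qed

lemma den_load_point: "den n f load_point m 15 = (\<lambda>q. if q < m 0 0 then
    m 4 (m 22 0 * m 5 4 + ((m 5 0 + m 11 0) * m 0 0 + q)) else m 15 q)"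
  unfolding load_point_def
  by (subst for_fill[where s = 0 and g = "\<lambda>q. m 4 (m 22 0 * m 5 4 + ((m 5 0 + m 11 0) * m 0 0 + q))"])
    auto

lemma den_copy_point: "den n f copy_point m 16 = (\<lambda>q. if q < m 0 0 then m 15 q else m 16 q)"
  unfolding copy_point_def
  by (subst for_fill[where s = 0 and g = "\<lambda>q. m 15 q"]) auto

definition agree :: "nat \<Rightarrow> (bit vec \<Rightarrow> real) \<Rightarrow> nat \<Rightarrow> (nat \<Rightarrow> nat) \<Rightarrow> nat \<Rightarrow> nat \<Rightarrow> nat \<Rightarrow> nat \<Rightarrow> nat" where
  "agree n f k z c J m d = 1 - ((\<Sum>l<k. of_bool (bit d l) * of_bool (bit c l)) +
     (if f (block n z (k + m)) = 1 then 0 else 1) +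
     (if f (block n z (k + m) + (combination n (block n z) k d + direction n J)) = 1 then 0 else 1)) mod 2"

lemma den_count_step:
  fixes m :: mem
  defines "z \<equiv> \<lambda>i. m 4 (m 22 0 * m 5 4 + i)"
  assumes "m 0 0 = n" "m 5 0 = k"
  shows "den n f count_step m 10 0 = m 10 0 + agree n f k z (m 23 0) (m 24 0) (m 11 0) (m 12 0)"
proof -
  define m1 where "m1 = den n f load_point m"
  define m2 where "m2 = den n f copy_point m1"
  define m3 where "m3 = upd (upd (upd (upd m2 16 (m 24 0) (m2 16 (m 24 0) + 1)) 17 0 (m 12 0)) 18 0 (m 23 0)) 19 0 0"
  define m4 where "m4 = den n f combine m3"
  have fr: "m1 a = m a" if "a \<notin> {13, 15}" for a using that by (simp add: m1_def den_frame)
  have fr2: "m2 a = m1 a" if "a \<notin> {13, 16}" for a using that by (simp add: m2_def den_frame)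
  have fr4: "m4 a = m3 a" if "a \<notin> {13, 14, 16, 17, 18, 19}" for a using that by (simp add: m4_def den_frame)
  have m3: "m3 17 0 = m 12 0" "m3 18 0 = m 23 0" "m3 19 0 = 0"
     "m3 16 = (m2 16)(m 24 0 := m2 16 (m 24 0) + 1)" "m3 a = m2 a" if "a \<notin> {16, 17, 18, 19}" for a
    using that by (auto simp: m3_def upd_same)
  have b15: "read_vec n (m4 15) 0 = block n z (k + m 11 0)"
    using assms(2,3) unfolding m4_def
    by (auto simp: den_frame m3_def m2_def m1_def den_load_point read_vec_def block_def z_def)
  have q16: "m2 16 i = z ((k + m 11 0) * n + i)" if "i < n" for i
    using assms(2,3) that
    by (simp add: m2_def den_copy_point fr m1_def den_load_point den_frame z_def)
  have zz: "(\<lambda>i. m3 4 (m3 22 0 * m3 5 4 + i)) = z"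
    by (simp add: m3_def fr fr2 z_def)
  have b16: "read_vec n (m4 16) 0 = block n z (k + m 11 0) + (combination n (block n z) k (m 12 0) + direction n (m 24 0))"
  proof (intro eq_vecI)
    fix i assume "i < dim_vec (block n z (k + m 11 0) + (combination n (block n z) k (m 12 0) + direction n (m 24 0)))"
    then have i: "i < n" by (simp add: direction_def)
    have "m4 16 i = m3 16 i + (\<Sum>l<k. of_bool (bit (m 12 0) l) * (z (l * n + i) mod 2))"
      using den_combine(1)[of n f m3] i assms(2,3) zz
      by (simp add: m4_def fun_eq_iff m3_def fr fr2)
    moreover have "m3 16 i = z ((k + m 11 0) * n + i) + of_bool (i = m 24 0)"
      using q16[OF i] by (auto simp: m3_def upd_def)
    moreover have "of_nat (\<Sum>l<k. of_bool (bit (m 12 0) l) * (z (l * n + i) mod 2)) =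
        (\<Sum>l<k. if bit (m 12 0) l then of_nat (z (l * n + i)) else 0 :: bit)"
      unfolding of_nat_sum by (intro sum.cong) (auto simp: of_nat_bit)
    ultimately have "of_nat (m4 16 i) = of_nat (z ((k + m 11 0) * n + i)) + of_bool (i = m 24 0) +
       (\<Sum>l<k. if bit (m 12 0) l then of_nat (z (l * n + i)) else 0 :: bit)"
      by (simp only: of_nat_add of_nat_of_bool)
    then show "read_vec n (m4 16) 0 $ i =
       (block n z (k + m 11 0) + (combination n (block n z) k (m 12 0) + direction n (m 24 0))) $ i"
      using i by (simp add: read_vec_def block_def combination_def direction_def ac_simps cong: if_cong)
  qed (simp add: read_vec_def direction_def)
  have par: "m4 19 0 = (\<Sum>l<k. of_bool (bit (m 12 0) l) * of_bool (bit (m 23 0) l))"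
    using den_combine(2)[of n f m3] assms(2,3) by (simp add: m4_def m3_def fr fr2)
  have "den n f count_step m 10 0 = m4 10 0 + (1 - (m4 19 0 + (if f (read_vec n (m4 15) 0) = 1 then 0 else 1) +
      (if f (read_vec n (m4 16) 0) = 1 then 0 else 1)) mod 2)"
    by (simp add: count_step_def m4_def m3_def m2_def m1_def den_frame)
  also have "m4 10 0 = m 10 0" by (simp add: fr4 m3_def fr fr2)
  finally show ?thesis by (simp add: par b15 b16 agree_def)
qed

lemma den_bucket_count:
  fixes m :: mem
  defines "z \<equiv> \<lambda>i. m 4 (m 22 0 * m 5 4 + i)"
  assumes "m 0 0 = n" "m 5 0 = k" "m 5 1 = 2 ^ k" "m 5 2 = M"
  shows "den n f bucket_count m 10 0 = (\<Sum>\<mu><M. \<Sum>d<2 ^ k. agree n f k z (m 23 0) (m 24 0) \<mu> d)"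
proof -
  define m0 where "m0 = upd m 10 0 0"
  have "den n f (PFor 11 eM (PFor 12 eK count_step)) m0 10 0 =
      m0 10 0 + (\<Sum>\<mu><eval m0 eM. \<Sum>d<2 ^ k. agree n f k z (m 23 0) (m 24 0) \<mu> d)"
    proof (rule for_sum)
      fix i m' assume i: "m' 11 0 = i" "\<And>a. a \<notin> insert 11 (writes (PFor 12 eK count_step)) \<Longrightarrow> m' a = m0 a"
      have fr: "m' 0 = m 0" "m' 4 = m 4" "m' 5 = m 5" "m' 22 = m 22" "m' 23 = m 23" "m' 24 = m 24"
        by (simp_all add: i(2) m0_def)
      have "den n f (PFor 12 eK count_step) m' 10 0 = m' 10 0 + (\<Sum>d<eval m' eK. agree n f k z (m 23 0) (m 24 0) i d)"
      proof (rule for_sum)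
        fix d m'' assume d: "m'' 12 0 = d" "\<And>a. a \<notin> insert 12 (writes count_step) \<Longrightarrow> m'' a = m' a"
        have fr': "m'' 0 = m 0" "m'' 4 = m 4" "m'' 5 = m 5" "m'' 22 = m 22" "m'' 23 = m 23" "m'' 24 = m 24"
          by (simp_all add: d(2) fr)
        have "m'' 11 0 = i" using i(1) by (simp add: d(2))
        then show "den n f count_step m'' 10 0 = m'' 10 0 + agree n f k z (m 23 0) (m 24 0) i d"
          using den_count_step[of m'' n k f] d(1) assms fr' by simp
      qed auto
      then show "den n f (PFor 12 eK count_step) m' 10 0 = m' 10 0 + (\<Sum>d<2 ^ k. agree n f k z (m 23 0) (m 24 0) i d)"
        using fr assms by simp
    qed auto
  then show ?thesis using assms by (simp add: bucket_count_def m0_def)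
qed

lemma agree_eq:
  assumes "f \<in> cube n \<rightarrow> {- 1, 1}"
  shows "2 * real (agree n f k z c J m d) - 1 = f (block n z (k + m)) *
     (f (block n z (k + m) + (combination n (block n z) k d + direction n J)) * bsign k c d)"
proof -
  define u where "u = f (block n z (k + m))"
  define v where "v = f (block n z (k + m) + (combination n (block n z) k d + direction n J))"
  define w where "w = (\<Sum>l<k. of_bool (bit d l) * of_bool (bit c l) :: nat)"
  have "u \<in> {- 1, 1}" unfolding u_def by (rule funcset_mem[OF assms]) simp
  moreover have "v \<in> {- 1, 1}" unfolding v_def by (rule funcset_mem[OF assms]) simp
  moreover have "bsign k c d = (- 1) ^ w"
    unfolding bsign_def w_def power_sum by (intro prod.cong) auto
  ultimately show ?thesis
    unfolding agree_def u_def[symmetric] v_def[symmetric] w_def[symmetric]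
    by (cases "even w") (auto simp: mod_2_eq_odd)
qed

text \<open>The count is an increasing affine function of the estimate, so programs compare counts;
  an estimate is negative iff twice the count is below M * 2 ^ k.\<close>

lemma bucket_count_estimate:
  fixes m :: mem
  defines "z \<equiv> \<lambda>i. m 4 (m 22 0 * m 5 4 + i)"
  assumes f: "f \<in> cube n \<rightarrow> {- 1, 1}" and "m 0 0 = n" "m 5 0 = k" "m 5 1 = 2 ^ k" "m 5 2 = M" "M > 0"
  shows "2 * real (den n f bucket_count m 10 0) =
    M * 2 ^ k * (1 + estimate n f k M z (m 23 0) (m 24 0))"
proof -
  have "2 * real (den n f bucket_count m 10 0) - M * 2 ^ k =
    (\<Sum>\<mu><M. \<Sum>d<2 ^ k :: nat. 2 * real (agree n f k z (m 23 0) (m 24 0) \<mu> d) - 1)"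
    using assms by (simp add: den_bucket_count sum_subtractf sum_distrib_left)
  also have "\<dots> = (\<Sum>\<mu><M. sample n f (block n z) k (m 23 0) (m 24 0) (block n z (k + \<mu>)) * 2 ^ k)"
    by (simp add: agree_eq[OF f] sample_def sum_distrib_left)
  also have "\<dots> = M * 2 ^ k * estimate n f k M z (m 23 0) (m 24 0)"
    using \<open>M > 0\<close> by (simp add: estimate_def sum_distrib_right[symmetric])
  finally show ?thesis by (simp add: algebra_simps)
qed

subsection \<open>Constants\<close>

text \<open>Plain doubling is not tame. Writing the new value as x - (x - cap), the minimum of x and
  a cap stored in memory, bounds it by an existing entry; the cap is twice the target, which
  doubling a smaller value never exceeds.\<close>

definition "choose_buckets = PFor 7 (reg 6) (
   PAssign 5 (Const 0) (ek [+] (eK [<] reg 6)) ;;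
   PAssign 5 (Const 1) (eK [+] (eK [<] reg 6) [*] eK [-]
     (eK [+] (eK [<] reg 6) [*] eK [-] Cell 6 (Const 1))))"

text \<open>\<open>eL\<close> is the lower bound for 2 ^ k, \<open>eF\<close> the ratio of
  \<open>M\<close> to 2 ^ k and \<open>eQ\<close> the number of rounds.\<close>

definition init :: "expr \<Rightarrow> expr \<Rightarrow> expr \<Rightarrow> prog" where
  "init eL eF eQ = (6 [:=] eL ;; PAssign 6 (Const 1) (Const 2 [*] reg 6) ;;
     PAssign 5 (Const 1) (Const 1) ;; choose_buckets ;;
     PAssign 5 (Const 2) (eF [*] eK) ;; PAssign 5 (Const 3) (eM [*] eK) ;;
     PAssign 5 (Const 4) ((ek [+] eM) [*] en) ;; PAssign 5 (Const 5) eQ ;;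
     PAssign 5 (Const 6) (eR [*] eB))"

lemma writes_init [simp]: "writes choose_buckets = {5, 7}" "writes (init eL eF eQ) = {5, 6, 7}"
  by (auto simp: init_def choose_buckets_def)

lemma wf_init [simp]: "wf choose_buckets" "wf (init eL eF eQ)"
  by (auto simp: init_def) (auto simp: choose_buckets_def)

text \<open>As long as the target \<open>L\<close> is not reached, the exponent equals the number of
  iterations; \<open>L\<close> iterations suffice because L < 2 ^ L.\<close>

lemma den_choose_buckets:
  assumes "m 6 0 = L" "L > 0" "m 6 1 = 2 * L" "m 5 0 = 0" "m 5 1 = 1"
  shows "\<exists>k. den n f choose_buckets m 5 0 = k \<and> den n f choose_buckets m 5 1 = 2 ^ k \<and>
    L \<le> 2 ^ k \<and> 2 ^ k \<le> 2 * L"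
proof -
  let ?I = "\<lambda>i m'. m' 5 1 = 2 ^ m' 5 0 \<and> m' 5 1 \<le> 2 * L \<and> (L \<le> m' 5 1 \<or> m' 5 0 = i)"
  have "?I (eval m (reg 6)) (den n f choose_buckets m)"
    unfolding choose_buckets_def
  proof (rule for_rule, goal_cases)
    case 1
    then show ?case by auto
  next
    case 2
    then show ?case using assms by auto
  next
    case (3 i m')
    have "m' 6 = m 6" by (rule 3(3)) simp
    then show ?case using 3(4) assms by (auto simp: upd_def)
  qed
  then have I: "?I L (den n f choose_buckets m)" using assms by auto
  moreover have "L < 2 ^ L" by (rule less_exp)
  ultimately show ?thesis by (intro exI[of _ "den n f choose_buckets m 5 0"]) auto
qed

lemma den_init:
  fixes m :: mem
  assumes m: "\<And>i. m 5 i = 0" and L: "eval m eL > 0"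
    and ar: "arrays eF \<subseteq> {0}" "arrays eQ \<subseteq> {0}"
  shows "\<exists>k M. eval m eL \<le> 2 ^ k \<and> 2 ^ k \<le> 2 * eval m eL \<and> M = eval m eF * 2 ^ k \<and>
     den n f (init eL eF eQ) m 5 0 = k \<and> den n f (init eL eF eQ) m 5 1 = 2 ^ k \<and>
     den n f (init eL eF eQ) m 5 2 = M \<and> den n f (init eL eF eQ) m 5 3 = M * 2 ^ k \<and>
     den n f (init eL eF eQ) m 5 4 = (k + M) * m 0 0 \<and> den n f (init eL eF eQ) m 5 5 = eval m eQ \<and>
     den n f (init eL eF eQ) m 5 6 = eval m eQ * ((k + M) * m 0 0)"
proof -
  define m1 where "m1 = upd (upd (upd m 6 0 (eval m eL)) 6 1 (2 * eval m eL)) 5 1 1"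
  define m2 where "m2 = den n f choose_buckets m1"
  obtain k where k: "m2 5 0 = k" "m2 5 1 = 2 ^ k" "eval m eL \<le> 2 ^ k" "2 ^ k \<le> 2 * eval m eL"
    using den_choose_buckets[of m1 "eval m eL" n f] L m unfolding m2_def by (auto simp: m1_def)
  have fr: "m2 0 = m 0" by (simp add: m2_def den_frame m1_def)
  have ev: "eval (upd m' 5 i v) e = eval m' e" "eval m2 e = eval m e" if "arrays e \<subseteq> {0}" for e m' i v
    by (rule eval_cong; use that fr in auto)+
  have "den n f (init eL eF eQ) m = upd (upd (upd (upd (upd m2 5 2 (eval m eF * 2 ^ k))
       5 3 (eval m eF * 2 ^ k * 2 ^ k)) 5 4 ((k + eval m eF * 2 ^ k) * m 0 0))
       5 5 (eval m eQ)) 5 6 (eval m eQ * ((k + eval m eF * 2 ^ k) * m 0 0))"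
  proof -
    have "den n f (init eL eF eQ) m = den n f (PAssign 5 (Const 2) (eF [*] eK) ;;
       PAssign 5 (Const 3) (eM [*] eK) ;; PAssign 5 (Const 4) ((ek [+] eM) [*] en) ;;
       PAssign 5 (Const 5) eQ ;; PAssign 5 (Const 6) (eR [*] eB)) m2"
      by (simp only: init_def m1_def m2_def den.simps eval.simps eval_op.simps upd_same_same)
    then show ?thesis using fr k ar by (simp add: ev)
  qed
  then show ?thesis using k fr by (intro exI[of _ k] exI[of _ "eval m eF * 2 ^ k"]) simp
qed

subsection \<open>The verifier\<close>

text \<open>Symbols are 1 for the bit 0 and 2 for the bit 1, so adding 1 makes the parity of a cell
  the bit. A message that is too short continues with ones, and only t * n cells are read, so the
  work does not depend on its length.\<close>

definition "copy_message = PFor 13 (et [*] en) (PAssign 3 (reg 13) (Cell 1 (reg 13) [+] Const 1))"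

definition "compare_vectors = (33 [:=] Const 0 ;;
   PFor 13 en (33 [:=] reg 33 [+]
     parity (Cell 3 (reg 31 [*] en [+] reg 13) [+] Cell 3 (reg 32 [*] en [+] reg 13))))"

definition "count_duplicates = (30 [:=] Const 0 ;; PFor 31 et (PFor 32 et (compare_vectors ;;
   30 [:=] reg 30 [+] ((reg 31 [<] reg 32) [*] (reg 33 [=] Const 0)))))"

definition "inner_product = (35 [:=] Const 0 ;; PFor 13 en (35 [:=] reg 35 [+]
   parity (Cell 3 (reg 32 [*] en [+] reg 13) [*] tape_at (reg 14 [*] en [+] reg 13))))"

definition "count_mismatches = (34 [:=] Const 0 ;; 18 [:=] reg 23 ;; PFor 14 ek (inner_product ;;
   34 [:=] reg 34 [+] parity (reg 35 [+] reg 18) ;; 18 [:=] half (reg 18)))"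

definition "count_hits = (36 [:=] Const 0 ;; PFor 32 et (count_mismatches ;;
   36 [:=] reg 36 [+] (reg 34 [=] Const 0)))"

text \<open>All pairs of an unclaimed and a claimed bucket pass the test iff the largest unclaimed
  count and the smallest claimed one do. Registers 39 and 40 hold these two; truncated subtraction
  expresses maximum and minimum in tame form.\<close>

definition "scan_buckets = PFor 23 eK (count_hits ;; bucket_count ;;
   PIf (reg 36) (40 [:=] reg 40 [-] (reg 40 [-] reg 10)) (39 [:=] reg 39 [+] (reg 10 [-] reg 39)))"

text \<open>Since a count is M * 2 ^ k * (1 + estimate) / 2, multiplying by 16 * a^2 turns the
  tolerance 1 / (8 * a^2) between estimates into M * 2 ^ k. The initial values 0 and M * 2 ^ k let
  the test succeed if one kind of bucket is absent.\<close>

definition "verify_round = (39 [:=] Const 0 ;; 40 [:=] eMK ;; scan_buckets ;;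
   37 [:=] reg 37 [+] (Const 1 [-] (eMK [+] Const 16 [*] ea [*] ea [*] reg 40 [<] Const 16 [*] ea [*] ea [*] reg 39)))"

text \<open>Half of the rounds suffice for acceptance: R < 2 * accepted + 1 means R \<le> 2 *
  accepted. Register 24 is set to n once, so only plain weights are estimated.\<close>

definition "verify = (copy_message ;; count_duplicates ;; 24 [:=] en ;; 37 [:=] Const 0 ;;
   PFor 22 eR verify_round ;;
   2 [:=] (reg 30 [=] Const 0) [*] (eR [<] Const 2 [*] reg 37 [+] Const 1))"

lemma writes_verify [simp]:
  "writes copy_message = {3, 13}" "writes compare_vectors = {13, 33}"
  "writes count_duplicates = {13, 30, 31, 32, 33}" "writes inner_product = {13, 35}"
  "writes count_mismatches = {13, 14, 18, 34, 35}" "writes count_hits = {13, 14, 18, 32, 34, 35, 36}"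
  "writes scan_buckets = {10, 11, 12, 13, 14, 15, 16, 17, 18, 19, 20, 21, 23, 32, 34, 35, 36, 39, 40}"
  "writes verify_round = {10, 11, 12, 13, 14, 15, 16, 17, 18, 19, 20, 21, 23, 32, 34, 35, 36, 37, 39, 40}"
  "writes verify = {2, 3, 10, 11, 12, 13, 14, 15, 16, 17, 18, 19, 20, 21, 22, 23, 24, 30, 31, 32, 33, 34, 35, 36, 37, 39, 40}"
  by (auto simp: copy_message_def compare_vectors_def count_duplicates_def inner_product_def
      count_mismatches_def count_hits_def scan_buckets_def verify_round_def verify_def)

lemma wf_verify [simp]:
  "wf copy_message" "wf compare_vectors" "wf count_duplicates" "wf inner_product" "wf count_mismatches"
  "wf count_hits" "wf scan_buckets" "wf verify_round" "wf verify"
  unfolding verify_def verify_round_def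
proof -
  show 1: "wf copy_message" by (simp add: copy_message_def)
  show 2: "wf compare_vectors" by (simp add: compare_vectors_def)
  show 3: "wf count_duplicates" using 2 by (simp add: count_duplicates_def)
  show 4: "wf inner_product" by (simp add: inner_product_def)
  show 5: "wf count_mismatches" using 4 by (simp add: count_mismatches_def)
  show 6: "wf count_hits" using 5 by (simp add: count_hits_def)
  show 7: "wf scan_buckets" using 6 by (simp add: scan_buckets_def)
  show 8: "wf (39 [:=] Const 0 ;; 40 [:=] eMK ;; scan_buckets ;;
   37 [:=] reg 37 [+] (Const 1 [-] (eMK [+] Const 16 [*] ea [*] ea [*] reg 40 [<] Const 16 [*] ea [*] ea [*] reg 39)))"
    using 7 by simp
  show "wf (copy_message ;; count_duplicates ;; 24 [:=] en ;; 37 [:=] Const 0 ;;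
   PFor 22 eR (39 [:=] Const 0 ;; 40 [:=] eMK ;; scan_buckets ;;
   37 [:=] reg 37 [+] (Const 1 [-] (eMK [+] Const 16 [*] ea [*] ea [*] reg 40 [<] Const 16 [*] ea [*] ea [*] reg 39))) ;;
   2 [:=] (reg 30 [=] Const 0) [*] (eR [<] Const 2 [*] reg 37 [+] Const 1))"
    using 1 3 8 by simp
qed

lemma den_copy_message: "den n f copy_message m 3 =
   (\<lambda>q. if q < m 0 1 * m 0 0 then m 1 q + 1 else m 3 q)"
  unfolding copy_message_def by (subst for_fill[where s = 0 and g = "\<lambda>q. m 1 q + 1"]) auto

lemma read_vec_eq_iff:
  "(\<Sum>l<n. (A (p + l) + B (q + l)) mod 2) = (0 :: nat) \<longleftrightarrow> read_vec n A p = read_vec n B q"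
proof -
  have "(x + y) mod 2 = 0 \<longleftrightarrow> (of_nat x :: bit) = of_nat y" for x y :: nat
    by (simp add: of_nat_bit mod_2_eq_odd)
  then have "(\<Sum>l<n. (A (p + l) + B (q + l)) mod 2) = 0 \<longleftrightarrow>
      (\<forall>l<n. (of_nat (A (p + l)) :: bit) = of_nat (B (q + l)))"
    by (simp only: sum_eq_0_iff finite_lessThan) auto
  also have "\<dots> \<longleftrightarrow> read_vec n A p = read_vec n B q"
  proof
    assume "read_vec n A p = read_vec n B q"
    then have eq: "read_vec n A p $ l = read_vec n B q $ l" for l by simp
    show "\<forall>l<n. (of_nat (A (p + l)) :: bit) = of_nat (B (q + l))"
    proof (intro allI impI)
      fix l assume "l < n"
      then show "(of_nat (A (p + l)) :: bit) = of_nat (B (q + l))"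
        using eq[of l] by (simp add: read_vec_def)
    qed
  qed (auto simp: read_vec_def)
  finally show ?thesis .
qed

lemma den_compare_vectors:
  assumes "m 0 0 = n"
  shows "den n f compare_vectors m 33 0 = 0 \<longleftrightarrow>
    read_vec n (m 3) (m 31 0 * n) = read_vec n (m 3) (m 32 0 * n)"
proof -
  define m0 where "m0 = upd m 33 0 0"
  have "den n f (PFor 13 en (33 [:=] reg 33 [+]
     parity (Cell 3 (reg 31 [*] en [+] reg 13) [+] Cell 3 (reg 32 [*] en [+] reg 13)))) m0 33 0 =
     m0 33 0 + (\<Sum>l<eval m0 en. (m 3 (m 31 0 * n + l) + m 3 (m 32 0 * n + l)) mod 2)"
    by (rule for_sum) (use assms in \<open>auto simp: m0_def\<close>)
  then have "den n f compare_vectors m 33 0 = (\<Sum>l<n. (m 3 (m 31 0 * n + l) + m 3 (m 32 0 * n + l)) mod 2)"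
    using assms by (simp add: compare_vectors_def m0_def)
  then show ?thesis by (simp only: read_vec_eq_iff)
qed

lemma den_count_duplicates:
  assumes "m 0 0 = n" "m 0 1 = t"
  shows "den n f count_duplicates m 30 0 = 0 \<longleftrightarrow> inj_on (\<lambda>j. read_vec n (m 3) (j * n)) {..<t}"
proof -
  define v where "v j = read_vec n (m 3) (j * n)" for j
  define m0 where "m0 = upd m 30 0 0"
  have "den n f (PFor 31 et (PFor 32 et (compare_vectors ;;
      30 [:=] reg 30 [+] ((reg 31 [<] reg 32) [*] (reg 33 [=] Const 0))))) m0 30 0 =
      m0 30 0 + (\<Sum>i<eval m0 et. \<Sum>j<t. of_bool (i < j \<and> v i = v j))"
  proof (rule for_sum)
    fix i m'
    assume i: "m' 31 0 = i" "\<And>a. a \<notin> insert 31 (writes (PFor 32 et (compare_vectors ;;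
      30 [:=] reg 30 [+] ((reg 31 [<] reg 32) [*] (reg 33 [=] Const 0))))) \<Longrightarrow> m' a = m0 a"
    have fr: "m' 0 = m 0" "m' 3 = m 3" by (simp_all add: i(2) m0_def)
    have "den n f (PFor 32 et (compare_vectors ;;
      30 [:=] reg 30 [+] ((reg 31 [<] reg 32) [*] (reg 33 [=] Const 0)))) m' 30 0 =
      m' 30 0 + (\<Sum>j<eval m' et. of_bool (i < j \<and> v i = v j))"
    proof (rule for_sum)
      fix j m'' assume j: "m'' 32 0 = j" "\<And>a. a \<notin> insert 32 (writes (compare_vectors ;;
        30 [:=] reg 30 [+] ((reg 31 [<] reg 32) [*] (reg 33 [=] Const 0)))) \<Longrightarrow> m'' a = m' a"
      have fr': "m'' 0 = m 0" "m'' 3 = m 3" "m'' 31 0 = i" using i(1) by (simp_all add: j(2) fr)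
      have "den n f compare_vectors m'' 33 0 = 0 \<longleftrightarrow> v i = v j"
        using den_compare_vectors[of m'' n f] assms fr' j(1) by (simp add: v_def)
      then show "den n f (compare_vectors ;;
        30 [:=] reg 30 [+] ((reg 31 [<] reg 32) [*] (reg 33 [=] Const 0))) m'' 30 0 =
        m'' 30 0 + of_bool (i < j \<and> v i = v j)"
        using fr' j(1) by (simp add: den_frame)
    qed auto
    then show "den n f (PFor 32 et (compare_vectors ;;
      30 [:=] reg 30 [+] ((reg 31 [<] reg 32) [*] (reg 33 [=] Const 0)))) m' 30 0 =
      m' 30 0 + (\<Sum>j<t. of_bool (i < j \<and> v i = v j))" using fr assms by simp
  qed auto
  then have "den n f count_duplicates m 30 0 = (\<Sum>i<t. \<Sum>j<t. of_bool (i < j \<and> v i = v j))"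
    using assms by (simp add: count_duplicates_def m0_def)
  then have "den n f count_duplicates m 30 0 = 0 \<longleftrightarrow> (\<forall>i<t. \<forall>j<t. \<not> (i < j \<and> v i = v j))"
    by (simp only: sum_eq_0_iff finite_lessThan) auto
  also have "\<dots> \<longleftrightarrow> inj_on v {..<t}"
  proof
    assume A: "\<forall>i<t. \<forall>j<t. \<not> (i < j \<and> v i = v j)"
    show "inj_on v {..<t}"
    proof (rule inj_onI)
      fix i j assume "i \<in> {..<t}" "j \<in> {..<t}" "v i = v j"
      then show "i = j" using A[rule_format, of i j] A[rule_format, of j i]
        by (cases i j rule: linorder_cases) auto
    qed
  qed (auto simp: inj_on_def)
  also have "v = (\<lambda>j. read_vec n (m 3) (j * n))" by (rule ext) (simp add: v_def)
  finally show ?thesis .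
qed

lemma den_inner_product:
  fixes m :: mem
  defines "z \<equiv> \<lambda>i. m 4 (m 22 0 * m 5 4 + i)"
  assumes "m 0 0 = n"
  shows "odd (den n f inner_product m 35 0) \<longleftrightarrow> chi (read_vec n (m 3) (m 32 0 * n)) (block n z (m 14 0)) = - 1"
proof -
  define m0 where "m0 = upd m 35 0 0"
  have "den n f (PFor 13 en (35 [:=] reg 35 [+]
   parity (Cell 3 (reg 32 [*] en [+] reg 13) [*] tape_at (reg 14 [*] en [+] reg 13)))) m0 35 0 =
     m0 35 0 + (\<Sum>l<eval m0 en. (m 3 (m 32 0 * n + l) * z (m 14 0 * n + l)) mod 2)"
    by (rule for_sum) (use assms in \<open>auto simp: m0_def z_def\<close>)
  then have *: "den n f inner_product m 35 0 = (\<Sum>l<n. (m 3 (m 32 0 * n + l) * z (m 14 0 * n + l)) mod 2)"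
    using assms by (simp add: inner_product_def m0_def)
  have "of_nat (den n f inner_product m 35 0) = scalar_prod (read_vec n (m 3) (m 32 0 * n)) (block n z (m 14 0))"
    unfolding * of_nat_sum by (auto simp: scalar_prod_def read_vec_def block_def of_nat_bit atLeast0LessThan intro!: sum.cong)
  then show ?thesis by (auto simp: chi_def of_nat_bit split: if_splits)
qed

lemma den_count_mismatches:
  fixes m :: mem
  defines "z \<equiv> \<lambda>i. m 4 (m 22 0 * m 5 4 + i)"
  assumes "m 0 0 = n" "m 5 0 = k"
  shows "den n f count_mismatches m 34 0 = 0 \<longleftrightarrow>
    in_bucket (block n z) k (m 23 0) (read_vec n (m 3) (m 32 0 * n))"
proof -
  define m0 where "m0 = upd (upd m 34 0 0) 18 0 (m 23 0)"
  define g where "g l = (of_bool ((chi (read_vec n (m 3) (m 32 0 * n)) (block n z l) = - 1) \<noteq> bit (m 23 0) l) :: nat)" for l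
  define body where "body = (inner_product ;; 34 [:=] reg 34 [+] parity (reg 35 [+] reg 18) ;; 18 [:=] half (reg 18))"
  let ?I = "\<lambda>i m'. m' 34 0 = (\<Sum>l<i. g l) \<and> m' 18 0 = m 23 0 div 2 ^ i"
  have "?I (eval m0 ek) (den n f (PFor 14 ek body) m0)"
  proof (rule for_rule, goal_cases)
    case 1
    then show ?case by (simp add: body_def)
  next
    case 2
    then show ?case by (simp add: m0_def)
  next
    case (3 i m')
    have fr: "m' 0 = m 0" "m' 3 = m 3" "m' 4 = m 4" "m' 5 = m 5" "m' 22 = m 22" "m' 32 = m 32"
      by (simp_all add: 3(3) body_def m0_def)
    have odd_iff: "odd (den n f inner_product m' 35 0) \<longleftrightarrow> chi (read_vec n (m 3) (m 32 0 * n)) (block n z i) = - 1"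
      using den_inner_product[of m' n f] assms 3(2) by (simp add: fr z_def)
    have "(den n f inner_product m' 35 0 + m 23 0 div 2 ^ i) mod 2 = g i"
      unfolding g_def odd_iff[symmetric] by (auto simp: bit_iff_odd mod_2_eq_odd)
    moreover have "x div 2 ^ i div 2 = x div 2 ^ Suc i" for x :: nat
      by (simp only: power_Suc2 div_mult2_eq)
    ultimately show ?case using 3(4) by (simp add: body_def den_frame del: power_Suc)
  qed
  then have "den n f count_mismatches m 34 0 = (\<Sum>l<k. g l)"
    using assms by (simp add: count_mismatches_def body_def m0_def)
  then show ?thesis by (auto simp: in_bucket_def g_def)
qed

lemma den_count_hits:
  fixes m :: mem
  defines "z \<equiv> \<lambda>i. m 4 (m 22 0 * m 5 4 + i)"
  assumes "m 0 0 = n" "m 0 1 = t" "m 5 0 = k"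
  shows "den n f count_hits m 36 0 \<noteq> 0 \<longleftrightarrow>
    (\<exists>j<t. in_bucket (block n z) k (m 23 0) (read_vec n (m 3) (j * n)))"
proof -
  define m0 where "m0 = upd m 36 0 0"
  have "den n f (PFor 32 et (count_mismatches ;; 36 [:=] reg 36 [+] (reg 34 [=] Const 0))) m0 36 0 =
     m0 36 0 + (\<Sum>j<eval m0 et. of_bool (in_bucket (block n z) k (m 23 0) (read_vec n (m 3) (j * n))))"
  proof (rule for_sum)
    fix j m' assume j: "m' 32 0 = j" "\<And>a. a \<notin> insert 32 (writes (count_mismatches ;;
        36 [:=] reg 36 [+] (reg 34 [=] Const 0))) \<Longrightarrow> m' a = m0 a"
    have fr: "m' 0 = m 0" "m' 3 = m 3" "m' 4 = m 4" "m' 5 = m 5" "m' 22 = m 22" "m' 23 = m 23"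
      by (simp_all add: j(2) m0_def)
    have "den n f count_mismatches m' 34 0 = 0 \<longleftrightarrow> in_bucket (block n z) k (m 23 0) (read_vec n (m 3) (j * n))"
      using den_count_mismatches[of m' n k f] assms j(1) by (simp add: fr z_def)
    then show "den n f (count_mismatches ;; 36 [:=] reg 36 [+] (reg 34 [=] Const 0)) m' 36 0 =
      m' 36 0 + of_bool (in_bucket (block n z) k (m 23 0) (read_vec n (m 3) (j * n)))"
      by (simp add: den_frame)
  qed auto
  then show ?thesis using assms by (simp add: count_hits_def m0_def) (auto simp: Bex_def)
qed

text \<open>Besides the bound, the invariant records that the register is attained by a bucket or
  still has its initial value \<open>T\<close>: a violated test has to be traced back to a pair of
  buckets.\<close>

lemma running_min:
  fixes a T :: nat
  assumes "a = T \<or> (\<exists>c<i. h c \<and> a = g c)" "\<forall>c<i. h c \<longrightarrow> a \<le> g c"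
  shows "(if h i then min a (g i) else a) = T \<or> (\<exists>c<Suc i. h c \<and> (if h i then min a (g i) else a) = g c)"
    and "\<forall>c<Suc i. h c \<longrightarrow> (if h i then min a (g i) else a) \<le> g c"
proof -
  have "min a (g i) = a \<or> min a (g i) = g i" by linarith
  then show "(if h i then min a (g i) else a) = T \<or> (\<exists>c<Suc i. h c \<and> (if h i then min a (g i) else a) = g c)"
    using assms(1) less_Suc_eq by auto
  show "\<forall>c<Suc i. h c \<longrightarrow> (if h i then min a (g i) else a) \<le> g c"
  proof (intro allI impI)
    fix c assume "c < Suc i" "h c"
    then show "(if h i then min a (g i) else a) \<le> g c"
      using assms(2) by (cases "c = i") (auto simp: less_Suc_eq min_le_iff_disj le_max_iff_disj)
  qed
qed

lemma running_max:
  fixes a T :: nat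
  assumes "a = T \<or> (\<exists>c<i. h c \<and> a = g c)" "\<forall>c<i. h c \<longrightarrow> g c \<le> a"
  shows "(if h i then max a (g i) else a) = T \<or> (\<exists>c<Suc i. h c \<and> (if h i then max a (g i) else a) = g c)"
    and "\<forall>c<Suc i. h c \<longrightarrow> g c \<le> (if h i then max a (g i) else a)"
proof -
  have "max a (g i) = a \<or> max a (g i) = g i" by linarith
  then show "(if h i then max a (g i) else a) = T \<or> (\<exists>c<Suc i. h c \<and> (if h i then max a (g i) else a) = g c)"
    using assms(1) less_Suc_eq by auto
  show "\<forall>c<Suc i. h c \<longrightarrow> g c \<le> (if h i then max a (g i) else a)"
  proof (intro allI impI)
    fix c assume "c < Suc i" "h c"
    then show "g c \<le> (if h i then max a (g i) else a)"
      using assms(2) by (cases "c = i") (auto simp: less_Suc_eq min_le_iff_disj le_max_iff_disj)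
  qed
qed
lemma den_verify_round:
  fixes m :: mem
  defines "z \<equiv> \<lambda>i. m 4 (m 22 0 * m 5 4 + i)"
  assumes f: "f \<in> cube n \<rightarrow> {- 1, 1}" and m: "m 0 0 = n" "m 0 1 = t" "m 0 2 = a" "m 5 0 = k" "m 5 1 = 2 ^ k"
     "m 5 2 = M" "m 5 3 = M * 2 ^ k" "m 24 0 = n" and pos: "M > 0" "a > 0"
  shows "den n f verify_round m 37 0 = m 37 0 + of_bool (accepts_round n f k M (1 / (real a)\<^sup>2)
     ((\<lambda>j. read_vec n (m 3) (j * n)) ` {..<t}) z)"
proof -
  define \<Gamma> where "\<Gamma> = (\<lambda>j. read_vec n (m 3) (j * n)) ` {..<t}"
  define hit where "hit c \<longleftrightarrow> (\<exists>\<gamma>\<in>\<Gamma>. in_bucket (block n z) k c \<gamma>)" for c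
  define cnt where "cnt c = (\<Sum>\<mu><M. \<Sum>d<2 ^ k. agree n f k z c n \<mu> d)" for c
  define m0 where "m0 = upd (upd m 39 0 0) 40 0 (M * 2 ^ k)"
  define body where "body = (count_hits ;; bucket_count ;;
   PIf (reg 36) (40 [:=] reg 40 [-] (reg 40 [-] reg 10)) (39 [:=] reg 39 [+] (reg 10 [-] reg 39)))"
  let ?I = "\<lambda>i m'. (m' 40 0 = M * 2 ^ k \<or> (\<exists>c<i. hit c \<and> m' 40 0 = cnt c)) \<and>
     (\<forall>c<i. hit c \<longrightarrow> m' 40 0 \<le> cnt c) \<and>
     (m' 39 0 = 0 \<or> (\<exists>c<i. \<not> hit c \<and> m' 39 0 = cnt c)) \<and> (\<forall>c<i. \<not> hit c \<longrightarrow> cnt c \<le> m' 39 0)"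
  have wfb: "wf (PFor 23 eK body)" using wf_verify(7) by (simp add: scan_buckets_def body_def)
  define m1 where "m1 = den n f scan_buckets m0"
  have cnt_eq: "den n f bucket_count m' 10 0 = cnt (m' 23 0)"
    if "m' 0 = m 0" "m' 4 = m 4" "m' 5 = m 5" "m' 22 = m 22" "m' 24 = m 24" for m'
    using den_bucket_count[of m' n k M f] that m by (simp add: cnt_def z_def)
  have "?I (eval m0 eK) (den n f (PFor 23 eK body) m0)"
  proof (rule for_rule[OF wfb], goal_cases)
    case 1
    then show ?case by (simp add: m0_def)
  next
    case (2 i m')
    have fr: "m' 0 = m 0" "m' 3 = m 3" "m' 4 = m 4" "m' 5 = m 5" "m' 22 = m 22" "m' 24 = m 24"
      by (simp_all add: 2(3) body_def m0_def)
    define m'' where "m'' = den n f count_hits m'"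
    have fr'': "m'' 0 = m 0" "m'' 4 = m 4" "m'' 5 = m 5" "m'' 22 = m 22" "m'' 24 = m 24" "m'' 23 = m' 23"
      "m'' 39 = m' 39" "m'' 40 = m' 40"
      by (simp_all add: m''_def den_frame fr)
    have h: "m'' 36 0 \<noteq> 0 \<longleftrightarrow> hit i"
      using den_count_hits[of m' n t k f] m fr 2(2) by (auto simp: m''_def hit_def \<Gamma>_def z_def)
    have c: "den n f bucket_count m'' 10 0 = cnt i"
      using cnt_eq[of m''] fr'' 2(2) by simp
    define m3 where "m3 = den n f bucket_count m''"
    have m3: "m3 36 = m'' 36" "m3 39 = m' 39" "m3 40 = m' 40" "m3 10 0 = cnt i"
      by (simp_all add: m3_def den_frame fr'' c)
    have "den n f body m' = (if hit i then upd m3 40 0 (min (m' 40 0) (cnt i))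
        else upd m3 39 0 (max (m' 39 0) (cnt i)))"
    proof -
      have "x - (x - y) = min x y" "x + (y - x) = max x y" for x y :: nat by auto
      then show ?thesis using h m3 by (simp add: body_def m''_def[symmetric] m3_def[symmetric])
    qed
    then have new: "den n f body m' 40 0 = (if hit i then min (m' 40 0) (cnt i) else m' 40 0)"
       "den n f body m' 39 0 = (if \<not> hit i then max (m' 39 0) (cnt i) else m' 39 0)"
      using m3 by auto
    have eq: "upd (den n f body m') 23 0 (Suc i) 40 = den n f body m' 40"
      "upd (den n f body m') 23 0 (Suc i) 39 = den n f body m' 39" by simp_all
    note p = 2(4)[THEN conjunct1] 2(4)[THEN conjunct2, THEN conjunct1]
      2(4)[THEN conjunct2, THEN conjunct2, THEN conjunct1] 2(4)[THEN conjunct2, THEN conjunct2, THEN conjunct2]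
    have "den n f body m' 40 0 = M * 2 ^ k \<or> (\<exists>c<Suc i. hit c \<and> den n f body m' 40 0 = cnt c)"
      unfolding new(1) by (rule running_min(1)[where h = hit and g = cnt, OF p(1,2)])
    moreover have "\<forall>c<Suc i. hit c \<longrightarrow> den n f body m' 40 0 \<le> cnt c"
      unfolding new(1) by (rule running_min(2)[where h = hit and g = cnt, OF p(1,2)])
    moreover have "den n f body m' 39 0 = 0 \<or> (\<exists>c<Suc i. \<not> hit c \<and> den n f body m' 39 0 = cnt c)"
      unfolding new(2) by (rule running_max(1)[where h = "\<lambda>c. \<not> hit c" and g = cnt, OF p(3,4)])
    moreover have "\<forall>c<Suc i. \<not> hit c \<longrightarrow> cnt c \<le> den n f body m' 39 0"
      unfolding new(2) by (rule running_max(2)[where h = "\<lambda>c. \<not> hit c" and g = cnt, OF p(3,4)])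
    ultimately show ?case unfolding eq by (intro conjI)
  qed
  moreover have "eval m0 eK = 2 ^ k" using m by (simp add: m0_def)
  moreover have "den n f (PFor 23 eK body) m0 = m1" by (simp only: m1_def scan_buckets_def body_def)
  ultimately have I: "?I (2 ^ k) m1" by simp
  have le: "cnt c \<le> M * 2 ^ k" for c
  proof -
    have "cnt c \<le> (\<Sum>\<mu><M. \<Sum>d<2 ^ k :: nat. 1)"
      unfolding cnt_def by (intro sum_mono) (simp add: agree_def)
    then show ?thesis by simp
  qed
  have fr1: "m1 0 = m 0" "m1 5 = m 5" "m1 37 = m 37" by (simp_all add: m1_def m0_def den_frame)
  define w where "w = 16 * a * a"
  have "den n f verify_round m 37 0 = m 37 0 + (1 - of_bool (M * 2 ^ k + w * m1 40 0 < w * m1 39 0))"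
    using m fr1 by (simp add: verify_round_def m0_def[symmetric] m1_def[symmetric] w_def)
  also have "\<not> (M * 2 ^ k + w * m1 40 0 < w * m1 39 0) \<longleftrightarrow> accepts_round n f k M (1 / (real a)\<^sup>2) \<Gamma> z"
  proof -
    have est: "w * cnt c \<le> M * 2 ^ k + w * cnt c' \<longleftrightarrow>
        estimate n f k M z c n \<le> estimate n f k M z c' n + 1 / (real a)\<^sup>2 / 8" for c c'
    proof -
      define P where "P = real M * 2 ^ k"
      have e: "2 * real (cnt c) = P * (1 + estimate n f k M z c n)" for c
      proof -
        have "den n f bucket_count (upd m 23 0 c) 10 0 = cnt c"
          using cnt_eq[of "upd m 23 0 c"] by simp
        then show ?thesis
          using bucket_count_estimate[OF f, of "upd m 23 0 c" k M] m pos by (simp add: z_def P_def)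
      qed
      have a: "real a > 0" using pos by simp
      have P: "P > 0" using pos by (simp add: P_def)
      have "w * cnt c \<le> M * 2 ^ k + w * cnt c' \<longleftrightarrow> real (w * cnt c) \<le> real (M * 2 ^ k + w * cnt c')"
        by (simp only: of_nat_le_iff)
      also have "\<dots> \<longleftrightarrow> 8 * (real a)\<^sup>2 * (2 * real (cnt c)) \<le> P + 8 * (real a)\<^sup>2 * (2 * real (cnt c'))"
        by (simp add: w_def P_def power2_eq_square algebra_simps)
      also have "\<dots> \<longleftrightarrow> P * (8 * (real a)\<^sup>2 * estimate n f k M z c n) \<le> P * (1 + 8 * (real a)\<^sup>2 * estimate n f k M z c' n)"
        unfolding e by (simp add: algebra_simps)
      also have "\<dots> \<longleftrightarrow> 8 * (real a)\<^sup>2 * estimate n f k M z c n \<le> 1 + 8 * (real a)\<^sup>2 * estimate n f k M z c' n"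
        using P by (simp only: mult_le_cancel_left_pos)
      also have "\<dots> \<longleftrightarrow> estimate n f k M z c n \<le> estimate n f k M z c' n + 1 / (real a)\<^sup>2 / 8"
        using a by (simp add: field_simps)
      finally show ?thesis .
    qed
    have "\<not> (M * 2 ^ k + w * m1 40 0 < w * m1 39 0) \<longleftrightarrow>
      (\<forall>c<2 ^ k. \<forall>c'<2 ^ k. \<not> hit c \<longrightarrow> hit c' \<longrightarrow> w * cnt c \<le> M * 2 ^ k + w * cnt c')" (is "?A \<longleftrightarrow> ?B")
    proof
      assume A: ?A
      show ?B
      proof (intro allI impI)
        fix c c' :: nat assume "c < 2 ^ k" "c' < 2 ^ k" "\<not> hit c" "hit c'"
        then have "cnt c \<le> m1 39 0" "m1 40 0 \<le> cnt c'" using I by auto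
        then have "w * cnt c \<le> w * m1 39 0" "w * m1 40 0 \<le> w * cnt c'" by simp_all
        then show "w * cnt c \<le> M * 2 ^ k + w * cnt c'" using A by linarith
      qed
    next
      assume B: ?B
      have "m1 39 0 \<le> M * 2 ^ k" using I le by auto
      then have le39: "w * m1 39 0 \<le> w * (M * 2 ^ k)" by simp
      show ?A
      \<comment> \<open>If a register has its initial value, as it does when one kind of bucket is
        absent, the test holds because no count exceeds M * 2 ^ k.\<close>
      proof (cases "m1 40 0 = M * 2 ^ k \<or> m1 39 0 = 0")
        case True
        then show ?thesis
        proof
          assume "m1 40 0 = M * 2 ^ k"
          then have "w * m1 40 0 = w * (M * 2 ^ k)" by simp
          then show ?thesis using le39 by linarith
        qed simp
      next
        case False
        then obtain c c' where "c < 2 ^ k" "c' < 2 ^ k" "\<not> hit c" "hit c'" "m1 39 0 = cnt c" "m1 40 0 = cnt c'"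
          using I by auto
        then show ?thesis using B by (auto simp: not_less)
      qed
    qed
    also have "\<dots> \<longleftrightarrow> accepts_round n f k M (1 / (real a)\<^sup>2) \<Gamma> z"
      unfolding est accepts_round_def hit_def by auto
    finally show ?thesis .
  qed
  then have "1 - of_bool (M * 2 ^ k + w * m1 40 0 < w * m1 39 0) =
      (of_bool (accepts_round n f k M (1 / (real a)\<^sup>2) \<Gamma> z) :: nat)"
    by (auto simp: of_bool_def)
  finally show ?thesis by (simp add: \<Gamma>_def)
qed

lemma den_verify:
  fixes m :: mem and n :: nat
  defines "\<gamma> \<equiv> \<lambda>j. read_vec n (\<lambda>i. m 1 i + 1) (j * n)"
  assumes f: "f \<in> cube n \<rightarrow> {- 1, 1}" and m: "m 0 0 = n" "m 0 1 = t" "m 0 2 = a" "m 5 0 = k" "m 5 1 = 2 ^ k"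
     "m 5 2 = M" "m 5 3 = M * 2 ^ k" "m 5 4 = B" "m 5 5 = R" and pos: "M > 0" "a > 0"
  shows "j < t \<Longrightarrow> read_vec n (den n f verify m 3) (j * n) = \<gamma> j"
    and "den n f verify m 2 0 \<noteq> 0 \<longleftrightarrow> inj_on \<gamma> {..<t} \<and>
      R \<le> 2 * card {r. r < R \<and> accepts_round n f k M (1 / (real a)\<^sup>2) (\<gamma> ` {..<t}) (\<lambda>i. m 4 (r * B + i))}"
proof -
  define m1 where "m1 = den n f copy_message m"
  define m2 where "m2 = den n f count_duplicates m1"
  define m3 where "m3 = upd (upd m2 24 0 n) 37 0 0"
  define m4 where "m4 = den n f (PFor 22 eR verify_round) m3"
  have \<gamma>: "read_vec n (m1 3) (j * n) = \<gamma> j" if "j < t" for j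
  proof -
    have "j * n + i < t * n" if "i < n" for i
    proof -
      have "j * n + i < Suc j * n" using that by simp
      also have "\<dots> \<le> t * n" using \<open>j < t\<close> by (intro mult_right_mono) auto
      finally show ?thesis .
    qed
    then show ?thesis using m
      by (auto simp: read_vec_def m1_def den_copy_message \<gamma>_def)
  qed
  have \<Gamma>: "(\<lambda>j. read_vec n (m1 3) (j * n)) ` {..<t} = \<gamma> ` {..<t}"
    by (intro image_cong) (auto simp: \<gamma>)
  have fr1: "m1 a = m a" if "a \<notin> {3, 13}" for a using that by (simp add: m1_def den_frame)
  have fr2: "m2 a = m1 a" if "a \<notin> {13, 30, 31, 32, 33}" for a using that by (simp add: m2_def den_frame)
  have dup: "m2 30 0 = 0 \<longleftrightarrow> inj_on \<gamma> {..<t}"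
  proof -
    have "m2 30 0 = 0 \<longleftrightarrow> inj_on (\<lambda>j. read_vec n (m1 3) (j * n)) {..<t}"
      unfolding m2_def by (rule den_count_duplicates) (use m in \<open>simp_all add: fr1\<close>)
    also have "\<dots> \<longleftrightarrow> inj_on \<gamma> {..<t}" by (intro inj_on_cong) (simp add: \<gamma>)
    finally show ?thesis .
  qed
  have "den n f (PFor 22 eR verify_round) m3 37 0 = m3 37 0 + (\<Sum>r<eval m3 eR.
     of_bool (accepts_round n f k M (1 / (real a)\<^sup>2) (\<gamma> ` {..<t}) (\<lambda>i. m 4 (r * B + i))))"
  proof (rule for_sum)
    fix r m' assume r: "m' 22 0 = r" "\<And>a. a \<notin> insert 22 (writes verify_round) \<Longrightarrow> m' a = m3 a"
    have fr: "m' 0 = m 0" "m' 3 = m1 3" "m' 4 = m 4" "m' 5 = m 5" "m' 24 0 = n"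
      by (simp_all add: r(2) m3_def fr1 fr2)
    show "den n f verify_round m' 37 0 = m' 37 0 +
      of_bool (accepts_round n f k M (1 / (real a)\<^sup>2) (\<gamma> ` {..<t}) (\<lambda>i. m 4 (r * B + i)))"
      using den_verify_round[OF f, of m' t a k M] m pos r(1) by (simp add: fr \<Gamma>)
  qed auto
  then have acc: "m4 37 0 = card {r. r < R \<and> accepts_round n f k M (1 / (real a)\<^sup>2) (\<gamma> ` {..<t}) (\<lambda>i. m 4 (r * B + i))}"
    using m by (simp add: m4_def m3_def fr1 fr2 sum.inter_filter[symmetric] of_bool_def Int_def)
  have fr4: "m4 3 = m1 3" "m4 5 = m 5" "m4 30 = m2 30"
    by (simp_all add: m4_def den_frame m3_def fr1 fr2)
  have final: "den n f verify m = upd m4 2 0 (of_bool (m4 30 0 = 0) * of_bool (R < 2 * m4 37 0 + 1))"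
    using m fr1 fr2 fr4 by (simp add: verify_def m1_def[symmetric] m2_def[symmetric] m3_def[symmetric] m4_def[symmetric])
  show "read_vec n (den n f verify m 3) (j * n) = \<gamma> j" if "j < t"
    using \<gamma>[OF that] by (simp add: final fr4)
  show "den n f verify m 2 0 \<noteq> 0 \<longleftrightarrow> inj_on \<gamma> {..<t} \<and>
      R \<le> 2 * card {r. r < R \<and> accepts_round n f k M (1 / (real a)\<^sup>2) (\<gamma> ` {..<t}) (\<lambda>i. m 4 (r * B + i))}"
    using dup by (auto simp: final fr4 acc[symmetric])
qed

subsection \<open>The honest prover\<close>

text \<open>Array 41 receives the counts for direction n, array 42 the decoded vectors row by row: 2
  * count < M * 2 ^ k tests the sign of an estimate.\<close>

definition "tabulate = PFor 23 eK (24 [:=] en ;; bucket_count ;; PAssign 41 (reg 23) (reg 10) ;;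
   PFor 24 en (bucket_count ;;
     PAssign 42 (reg 23 [*] en [+] reg 24) (Const 2 [*] reg 10 [<] eMK)))"

definition "add_filler = (17 [:=] reg 43 ;; PFor 13 en (
     PAssign 42 ((eK [+] reg 43) [*] en [+] reg 13) (parity (reg 17)) ;; 17 [:=] half (reg 17)))"

text \<open>Decoded buckets may coincide, so \<open>t\<close> further candidates follow them, the
  numbers below \<open>t\<close> in binary. Array 41 is 0 at their positions, so no bucket with a
  positive count ranks below them.\<close>

definition "add_fillers = PFor 43 et add_filler"

definition "compare_candidate = (33 [:=] Const 0 ;; PFor 13 en (33 [:=] reg 33 [+]
   parity (Cell 1 (reg 31 [*] en [+] reg 13) [+] Cell 42 (reg 23 [*] en [+] reg 13))))"

definition "find_candidate = (30 [:=] Const 0 ;; PFor 31 et (compare_candidate ;;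
   30 [:=] reg 30 [+] ((reg 31 [<] reg 44) [*] (reg 33 [=] Const 0))))"

definition "append_candidate = (PFor 13 en (PAssign 1 (reg 44 [*] en [+] reg 13) (Cell 42 (reg 23 [*] en [+] reg 13))) ;;
   44 [:=] reg 44 [+] Const 1)"

definition "select_step = (find_candidate ;;
   PIf ((Cell 41 (reg 23) [+] reg 45 [=] eMK) [*] (reg 44 [<] et) [*] (reg 30 [=] Const 0))
     append_candidate (30 [:=] Const 0))"

text \<open>Selection without sorting: scores lie between 0 and M * 2 ^ k, so one pass per possible
  score visits the candidates in decreasing order, and the number of passes is polynomial.\<close>

definition "select_top = PFor 45 (eMK [+] Const 1) (PFor 23 (eK [+] et) select_step)"

text \<open>Bits become the symbols 1 and 2; the cells behind them stay 0, so the message ends after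
  exactly t * n symbols.\<close>

definition "emit = PFor 13 (et [*] en) (PAssign 1 (reg 13) (Cell 1 (reg 13) [+] Const 1))"

definition "prove = (tabulate ;; add_fillers ;; select_top ;; emit)"

lemma writes_prove [simp]:
  "writes tabulate = {10, 11, 12, 13, 14, 15, 16, 17, 18, 19, 20, 21, 23, 24, 41, 42}"
  "writes add_filler = {13, 17, 42}" "writes add_fillers = {13, 17, 42, 43}"
  "writes compare_candidate = {13, 33}" "writes find_candidate = {13, 30, 31, 33}"
  "writes append_candidate = {1, 13, 44}" "writes select_step = {1, 13, 30, 31, 33, 44}"
  "writes select_top = {1, 13, 23, 30, 31, 33, 44, 45}" "writes emit = {1, 13}"
  "writes prove = {1, 10, 11, 12, 13, 14, 15, 16, 17, 18, 19, 20, 21, 23, 24, 30, 31, 33, 41, 42, 43, 44, 45}"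
  by (auto simp: tabulate_def add_filler_def add_fillers_def compare_candidate_def find_candidate_def
      append_candidate_def select_step_def select_top_def emit_def prove_def)

lemma wf_prove [simp]:
  "wf tabulate" "wf add_filler" "wf add_fillers" "wf compare_candidate" "wf find_candidate"
  "wf append_candidate" "wf select_step" "wf select_top" "wf emit" "wf prove"
proof -
  show 1: "wf tabulate" by (simp add: tabulate_def)
  show 2: "wf add_filler" by (simp add: add_filler_def)
  show 3: "wf add_fillers" using 2 by (simp add: add_fillers_def)
  show 4: "wf compare_candidate" by (simp add: compare_candidate_def)
  show 5: "wf find_candidate" using 4 by (simp add: find_candidate_def)
  show 6: "wf append_candidate" by (simp add: append_candidate_def)
  show 7: "wf select_step" using 5 6 by (simp add: select_step_def)
  show 8: "wf select_top" using 7 by (simp add: select_top_def)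
  show 9: "wf emit" by (simp add: emit_def)
  show "wf prove" using 1 3 8 9 by (simp add: prove_def)
qed

lemma index_less:
  fixes j t n i :: nat
  assumes "j < t" "i < n"
  shows "j * n + i < t * n"
proof -
  have "j * n + i < Suc j * n" using assms by simp
  also have "\<dots> \<le> t * n" using assms by (intro mult_right_mono) auto
  finally show ?thesis .
qed

lemma den_tabulate:
  fixes m :: mem
  defines "z \<equiv> \<lambda>i. m 4 (m 22 0 * m 5 4 + i)"
  assumes f: "f \<in> cube n \<rightarrow> {- 1, 1}" and m: "m 0 0 = n" "m 5 0 = k" "m 5 1 = 2 ^ k"
     "m 5 2 = M" "m 5 3 = M * 2 ^ k" and pos: "M > 0"
     and init: "\<And>i. m 41 i = 0" "\<And>i. m 42 i \<le> 1"
  shows "\<And>c. c < 2 ^ k \<Longrightarrow> 2 * real (den n f tabulate m 41 c) = real (M * 2 ^ k) * (1 + estimate n f k M z c n)"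
    and "\<And>c. c \<ge> 2 ^ k \<Longrightarrow> den n f tabulate m 41 c = 0"
    and "\<And>c. c < 2 ^ k \<Longrightarrow> read_vec n (den n f tabulate m 42) (c * n) = decode n f k M z c"
    and "\<And>i. den n f tabulate m 42 i \<le> 1"
proof -
  define row where "row = PFor 24 en (bucket_count ;;
     PAssign 42 (reg 23 [*] en [+] reg 24) (Const 2 [*] reg 10 [<] eMK))"
  define body where "body = (24 [:=] en ;; bucket_count ;; PAssign 41 (reg 23) (reg 10) ;; row)"
  define g where "g c J = (of_bool (estimate n f k M z c J < 0) :: nat)" for c J
  have est: "2 * real (den n f bucket_count m' 10 0) = real (M * 2 ^ k) * (1 + estimate n f k M z (m' 23 0) (m' 24 0))"
    if "m' 0 = m 0" "m' 4 = m 4" "m' 5 = m 5" "m' 22 = m 22" for m'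
    using bucket_count_estimate[OF f, of m' k M] that m pos by (simp add: z_def)
  have wfr: "wf row" by (simp add: row_def)
  have wr: "writes row = {10, 11, 12, 13, 14, 15, 16, 17, 18, 19, 20, 21, 24, 42}"
    by (auto simp: row_def)
  have row: "den n f row m' 42 = (\<lambda>q. if m' 23 0 * n \<le> q \<and> q < m' 23 0 * n + n then g (m' 23 0) (q - m' 23 0 * n) else m' 42 q)"
    if m': "m' 0 = m 0" "m' 4 = m 4" "m' 5 = m 5" "m' 22 = m 22" for m'
  proof -
    let ?I = "\<lambda>i m''. m'' 42 = (\<lambda>q. if m' 23 0 * n \<le> q \<and> q < m' 23 0 * n + i then g (m' 23 0) (q - m' 23 0 * n) else m' 42 q)"
    have "?I (eval m' en) (den n f row m')"
      unfolding row_def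
    proof (rule for_rule, goal_cases)
      case 1
      then show ?case using wfr by (simp add: row_def)
    next
      case 2
      then show ?case by (auto simp: fun_eq_iff)
    next
      case (3 i m'')
      have fr: "m'' 0 = m 0" "m'' 4 = m 4" "m'' 5 = m 5" "m'' 22 = m 22" "m'' 23 = m' 23"
        by (simp_all add: 3(3) m')
      define m3 where "m3 = den n f bucket_count m''"
      have m3: "m3 0 = m 0" "m3 5 = m 5" "m3 23 = m' 23" "m3 24 = m'' 24" "m3 42 = m'' 42"
        by (simp_all add: m3_def den_frame fr)
      have "2 * real (m3 10 0) = real (M * 2 ^ k) * (1 + estimate n f k M z (m' 23 0) i)"
        using est[of m''] fr 3(2) by (simp add: m3_def)
      moreover have "2 * m3 10 0 < M * 2 ^ k \<longleftrightarrow> 2 * real (m3 10 0) < M * 2 ^ k"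
        by (metis of_nat_less_iff of_nat_mult of_nat_numeral of_nat_power)
      moreover have "real M * 2 ^ k * (1 + e) < M * 2 ^ k \<longleftrightarrow> e < 0" for e :: real
      proof -
        have P: "real M * 2 ^ k > 0" using pos by simp
        have "real M * 2 ^ k * (1 + e) < M * 2 ^ k \<longleftrightarrow> real M * 2 ^ k * (1 + e) < real M * 2 ^ k * 1" by simp
        also have "\<dots> \<longleftrightarrow> 1 + e < 1" using P by (rule mult_less_cancel_left_pos)
        finally show ?thesis by simp
      qed
      ultimately have "of_bool (2 * m3 10 0 < M * 2 ^ k) = g (m' 23 0) i" by (simp add: g_def)
      then have st: "den n f (bucket_count ;; PAssign 42 (reg 23 [*] en [+] reg 24) (Const 2 [*] reg 10 [<] eMK)) m'' =
          upd m3 42 (m' 23 0 * n + i) (g (m' 23 0) i)"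
        using m m3 3(2) by (simp add: m3_def[symmetric])
      show ?case unfolding st using 3(4) m3(5) by (auto simp: upd_same fun_eq_iff)
    qed
    then show ?thesis using m m' by simp
  qed
  let ?I = "\<lambda>i m'. (\<forall>c. if c < i then 2 * real (m' 41 c) = real (M * 2 ^ k) * (1 + estimate n f k M z c n) else m' 41 c = 0) \<and>
     (\<forall>c<i. \<forall>J<n. m' 42 (c * n + J) = g c J) \<and> (\<forall>q. m' 42 q \<le> 1)"
  have A: "?I (eval m eK) (den n f (PFor 23 eK body) m)"
  proof (rule for_rule, goal_cases)
    case 1
    then show ?case using wfr by (simp add: body_def wr)
  next
    case 2
    then show ?case using init by simp
  next
    case (3 i m')
    have fr: "m' 0 = m 0" "m' 4 = m 4" "m' 5 = m 5" "m' 22 = m 22"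
      by (simp_all add: 3(3) body_def wr)
    define m1 where "m1 = upd m' 24 0 n"
    define m2 where "m2 = den n f bucket_count m1"
    define m3 where "m3 = upd m2 41 i (m2 10 0)"
    have m2: "m2 0 = m 0" "m2 4 = m 4" "m2 5 = m 5" "m2 22 = m 22" "m2 23 = m' 23" "m2 41 = m' 41" "m2 42 = m' 42"
      by (simp_all add: m2_def den_frame m1_def fr)
    have e: "2 * real (m2 10 0) = real (M * 2 ^ k) * (1 + estimate n f k M z i n)"
      using est[of m1] fr 3(2) by (simp add: m2_def m1_def)
    have m3: "m3 0 = m 0" "m3 4 = m 4" "m3 5 = m 5" "m3 22 = m 22" "m3 23 0 = i" "m3 42 = m' 42"
       "m3 41 = (m' 41)(i := m2 10 0)"
      using m2 3(2) by (simp_all add: m3_def upd_same)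
    have b: "den n f body m' = den n f row m3"
      using fr m m2 3(2) by (simp add: body_def m1_def m2_def m3_def)
    have b41: "den n f body m' 41 = (m' 41)(i := m2 10 0)"
      unfolding b using m3 by (simp add: den_frame wr fun_upd_def)
    have b42: "den n f body m' 42 = (\<lambda>q. if i * n \<le> q \<and> q < i * n + n then g i (q - i * n) else m' 42 q)"
      unfolding b row[OF m3(1-4)] m3(5,6) by (rule refl)
    have I: "(if c < i then 2 * real (m' 41 c) = real (M * 2 ^ k) * (1 + estimate n f k M z c n) else m' 41 c = 0)"
      "c < i \<Longrightarrow> J < n \<Longrightarrow> m' 42 (c * n + J) = g c J" "m' 42 q \<le> 1" for c J q
      using 3(4) by blast+
    have "\<forall>c<Suc i. \<forall>J<n. den n f body m' 42 (c * n + J) = g c J"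
    proof (intro allI impI)
      fix c J assume cJ: "c < Suc i" "J < n"
      show "den n f body m' 42 (c * n + J) = g c J"
      proof (cases "c = i")
        case True
        then show ?thesis using cJ unfolding b42 by simp
      next
        case False
        then have "c < i" using cJ by simp
        then show ?thesis using I(2)[of c J] index_less[of c i J n] cJ unfolding b42 by simp
      qed
    qed
    moreover have "\<forall>q. den n f body m' 42 q \<le> 1"
      using I(3) unfolding b42 by (auto simp: g_def)
    moreover have "\<forall>c. if c < Suc i then 2 * real (den n f body m' 41 c) = real (M * 2 ^ k) * (1 + estimate n f k M z c n)
        else den n f body m' 41 c = 0"
      using I(1) e unfolding b41 by (auto simp: less_Suc_eq)
    ultimately show ?case by simp
  qed
  have ev: "eval m eK = 2 ^ k" using m by simp
  have eq: "PFor 23 eK body = tabulate" by (simp add: body_def row_def tabulate_def)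
  note I = A[unfolded ev eq]
  show "2 * real (den n f tabulate m 41 c) = real (M * 2 ^ k) * (1 + estimate n f k M z c n)" if "c < 2 ^ k" for c
    using I that by simp
  show "den n f tabulate m 41 c = 0" if "c \<ge> 2 ^ k" for c
    using I that by (simp add: not_less)
  show "den n f tabulate m 42 i \<le> 1" for i using I by blast
  show "read_vec n (den n f tabulate m 42) (c * n) = decode n f k M z c" if "c < 2 ^ k" for c
  proof (rule eq_vecI)
    fix J assume J: "J < dim_vec (decode n f k M z c)"
    then have "den n f tabulate m 42 (c * n + J) = g c J" using I that by (simp add: decode_def)
    then show "read_vec n (den n f tabulate m 42) (c * n) $ J = decode n f k M z c $ J"
      using J by (simp add: read_vec_def decode_def g_def)
  qed (simp add: read_vec_def decode_def)
qed

section \<open>Filler candidates and greedy selection\<close>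

definition binary_vec :: "nat \<Rightarrow> nat \<Rightarrow> bit vec" where
  "binary_vec n j = Matrix.vec n (\<lambda>i. of_bool (bit j i))"

lemma inj_on_binary_vec: "inj_on (binary_vec n) {..<2 ^ n}"
proof (rule inj_onI)
  fix i j :: nat assume ij: "i \<in> {..<2 ^ n}" "j \<in> {..<2 ^ n}" and eq: "binary_vec n i = binary_vec n j"
  show "i = j"
  proof (rule bit_eqI)
    fix l
    show "bit i l \<longleftrightarrow> bit j l"
    proof (cases "l < n")
      case True
      then have "binary_vec n i $ l = binary_vec n j $ l" using eq by simp
      then show ?thesis using True by (cases "bit i l"; cases "bit j l") (simp_all add: binary_vec_def)
    next
      case False
      have "x div 2 ^ l = 0" if "x < 2 ^ n" for x :: nat
      proof -
        have "(2 :: nat) ^ n \<le> 2 ^ l" using False by (intro power_increasing) auto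
        with that have "x < 2 ^ l" by (rule less_le_trans)
        then show ?thesis by simp
      qed
      then show ?thesis using ij by (simp add: bit_iff_odd)
    qed
  qed
qed

lemma den_add_filler:
  assumes m: "m 0 0 = n" "m 5 1 = K"
  shows "den n f add_filler m 42 = (\<lambda>q. if (K + m 43 0) * n \<le> q \<and> q < (K + m 43 0) * n + n
     then of_bool (bit (m 43 0) (q - (K + m 43 0) * n)) else m 42 q)"
proof -
  define m0 where "m0 = upd m 17 0 (m 43 0)"
  let ?s = "(K + m 43 0) * n"
  let ?I = "\<lambda>i m'. m' 42 = (\<lambda>q. if ?s \<le> q \<and> q < ?s + i then of_bool (bit (m 43 0) (q - ?s)) else m 42 q) \<and>
    m' 17 0 = m 43 0 div 2 ^ i"
  have "?I (eval m0 en) (den n f (PFor 13 en (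
     PAssign 42 ((eK [+] reg 43) [*] en [+] reg 13) (parity (reg 17)) ;; 17 [:=] half (reg 17))) m0)"
  proof (rule for_rule, goal_cases)
    case (3 i m')
    have fr: "m' 0 = m 0" "m' 5 = m 5" "m' 43 = m 43" by (simp_all add: 3(3) m0_def)
    have bits: "m 43 0 div 2 ^ i mod 2 = of_bool (bit (m 43 0) i)"
      by (simp add: bit_iff_odd mod_2_eq_odd)
    have dv: "m 43 0 div 2 ^ i div 2 = m 43 0 div 2 ^ Suc i"
      by (simp only: power_Suc2 div_mult2_eq)
    show ?case using 3(4) m 3(2) by (auto simp: fr bits dv upd_def fun_eq_iff simp del: power_Suc)
  qed (auto simp: m0_def fun_eq_iff)
  then show ?thesis using m by (simp add: add_filler_def m0_def)
qed

lemma den_add_fillers: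
  assumes m: "m 0 0 = n" "m 0 1 = t" "m 5 1 = K" and bd: "\<And>i. m 42 i \<le> 1"
  shows "\<And>i. den n f add_fillers m 42 i \<le> 1"
    and "\<And>c. c < K \<Longrightarrow> read_vec n (den n f add_fillers m 42) (c * n) = read_vec n (m 42) (c * n)"
    and "\<And>j. j < t \<Longrightarrow> read_vec n (den n f add_fillers m 42) ((K + j) * n) = binary_vec n j"
proof -
  let ?I = "\<lambda>i m'. (\<forall>q. m' 42 q \<le> 1) \<and> (\<forall>q<K * n. m' 42 q = m 42 q) \<and>
    (\<forall>j<i. \<forall>l<n. m' 42 ((K + j) * n + l) = of_bool (bit j l))"
  have "?I (eval m et) (den n f add_fillers m)"
    unfolding add_fillers_def
  proof (rule for_rule, goal_cases)
    case (3 i m')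
    have fr: "m' 0 = m 0" "m' 5 = m 5" by (simp_all add: 3(3))
    have e: "den n f add_filler m' 42 = (\<lambda>q. if (K + i) * n \<le> q \<and> q < (K + i) * n + n
       then of_bool (bit i (q - (K + i) * n)) else m' 42 q)"
    proof -
      have "m' 0 0 = n" "m' 5 1 = K" using m fr by simp_all
      note d = den_add_filler[OF this]
      show ?thesis unfolding d 3(2) by (rule refl)
    qed
    have I: "m' 42 q \<le> 1" "q < K * n \<Longrightarrow> m' 42 q = m 42 q"
      "j < i \<Longrightarrow> l < n \<Longrightarrow> m' 42 ((K + j) * n + l) = of_bool (bit j l)" for q j l
      using 3(4) by blast+
    have "\<forall>q. den n f add_filler m' 42 q \<le> 1" unfolding e using I(1) by auto
    moreover have "\<forall>q<K * n. den n f add_filler m' 42 q = m 42 q"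
    proof (intro allI impI)
      fix q assume q: "q < K * n"
      also have "K * n \<le> (K + i) * n" by (intro mult_right_mono) auto
      finally have nl: "\<not> (K + i) * n \<le> q" by (simp only: not_le)
      show "den n f add_filler m' 42 q = m 42 q"
        unfolding e using I(2)[OF q] nl by (simp only: simp_thms if_False)
    qed
    moreover have "\<forall>j<Suc i. \<forall>l<n. den n f add_filler m' 42 ((K + j) * n + l) = of_bool (bit j l)"
    proof (intro allI impI)
      fix j l assume jl: "j < Suc i" "l < n"
      show "den n f add_filler m' 42 ((K + j) * n + l) = of_bool (bit j l)"
      proof (cases "j = i")
        case True
        then show ?thesis using jl unfolding e by simp
      next
        case False
        then have "K + j < K + i" using jl by simp
        then have "(K + j) * n + l < (K + i) * n" using jl(2) by (rule index_less)
        then show ?thesis using I(3)[of j l] jl False unfolding e by simp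
      qed
    qed
    ultimately show ?case by simp
  qed (use bd in simp_all)
  then have I: "?I t (den n f add_fillers m)" using m by simp
  show "den n f add_fillers m 42 i \<le> 1" for i using I by blast
  show "read_vec n (den n f add_fillers m 42) (c * n) = read_vec n (m 42) (c * n)" if "c < K" for c
    using I index_less[OF that] by (auto simp: read_vec_def)
  show "read_vec n (den n f add_fillers m 42) ((K + j) * n) = binary_vec n j" if "j < t" for j
    using I that by (auto simp: read_vec_def binary_vec_def)
qed

lemma den_find_candidate:
  assumes m: "m 0 0 = n" "m 0 1 = t" "m 44 0 \<le> t"
  shows "den n f find_candidate m 30 0 = 0 \<longleftrightarrow>
    read_vec n (m 42) (m 23 0 * n) \<notin> (\<lambda>j. read_vec n (m 1) (j * n)) ` {..<m 44 0}"
proof -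
  define m0 where "m0 = upd m 30 0 0"
  define g where "g j = (of_bool (j < m 44 0 \<and> read_vec n (m 1) (j * n) = read_vec n (m 42) (m 23 0 * n)) :: nat)" for j
  have "den n f (PFor 31 et (compare_candidate ;;
   30 [:=] reg 30 [+] ((reg 31 [<] reg 44) [*] (reg 33 [=] Const 0)))) m0 30 0 = m0 30 0 + (\<Sum>j<eval m0 et. g j)"
  proof (rule for_sum)
    fix j m' assume j: "m' 31 0 = j" "\<And>a. a \<notin> insert 31 (writes (compare_candidate ;;
      30 [:=] reg 30 [+] ((reg 31 [<] reg 44) [*] (reg 33 [=] Const 0)))) \<Longrightarrow> m' a = m0 a"
    have fr: "m' 0 = m 0" "m' 1 = m 1" "m' 23 = m 23" "m' 42 = m 42" "m' 44 = m 44"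
      by (simp_all add: j(2) m0_def)
    define m1 where "m1 = upd m' 33 0 0"
    have "den n f (PFor 13 en (33 [:=] reg 33 [+]
      parity (Cell 1 (reg 31 [*] en [+] reg 13) [+] Cell 42 (reg 23 [*] en [+] reg 13)))) m1 33 0 =
      m1 33 0 + (\<Sum>l<eval m1 en. (m 1 (j * n + l) + m 42 (m 23 0 * n + l)) mod 2)"
      by (rule for_sum) (use m j(1) fr in \<open>auto simp: m1_def\<close>)
    then have "den n f compare_candidate m' 33 0 = (\<Sum>l<n. (m 1 (j * n + l) + m 42 (m 23 0 * n + l)) mod 2)"
      using m fr by (simp add: compare_candidate_def m1_def)
    then have "den n f compare_candidate m' 33 0 = 0 \<longleftrightarrow> read_vec n (m 1) (j * n) = read_vec n (m 42) (m 23 0 * n)"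
      by (simp only: read_vec_eq_iff)
    then show "den n f (compare_candidate ;;
      30 [:=] reg 30 [+] ((reg 31 [<] reg 44) [*] (reg 33 [=] Const 0))) m' 30 0 = m' 30 0 + g j"
      using fr j(1) by (simp add: den_frame g_def)
  qed auto
  then have "den n f find_candidate m 30 0 = (\<Sum>j<t. g j)"
    using m by (simp add: find_candidate_def m0_def)
  then have "den n f find_candidate m 30 0 = 0 \<longleftrightarrow> (\<forall>j<t. g j = 0)"
    by (simp only: sum_eq_0_iff finite_lessThan) auto
  also have "\<dots> \<longleftrightarrow> read_vec n (m 42) (m 23 0 * n) \<notin> (\<lambda>j. read_vec n (m 1) (j * n)) ` {..<m 44 0}"
  proof
    assume A: "\<forall>j<t. g j = 0"
    show "read_vec n (m 42) (m 23 0 * n) \<notin> (\<lambda>j. read_vec n (m 1) (j * n)) ` {..<m 44 0}"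
    proof
      assume "read_vec n (m 42) (m 23 0 * n) \<in> (\<lambda>j. read_vec n (m 1) (j * n)) ` {..<m 44 0}"
      then obtain j where "j < m 44 0" "read_vec n (m 42) (m 23 0 * n) = read_vec n (m 1) (j * n)" by auto
      then show False using A[rule_format, of j] m(3) by (simp add: g_def)
    qed
  next
    assume A: "read_vec n (m 42) (m 23 0 * n) \<notin> (\<lambda>j. read_vec n (m 1) (j * n)) ` {..<m 44 0}"
    show "\<forall>j<t. g j = 0"
    proof (intro allI impI)
      fix j
      have "\<not> (j < m 44 0 \<and> read_vec n (m 1) (j * n) = read_vec n (m 42) (m 23 0 * n))"
        using A by (metis imageI lessThan_iff)
      then show "g j = 0" by (simp add: g_def)
    qed
  qed
  finally show ?thesis .
qed

text \<open>
  Invariant of the selection in pass \<open>u\<close> before entry \<open>c\<close>; pass \<open>u\<close> considers the entries of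
  score \<open>MK - u\<close>. The list \<open>A\<close> has \<open>r\<close> vectors, and a considered entry is missing only if the list is
  full of vectors of at least the same score.
\<close>

definition sel_inv where
  "sel_inv n t T MK cand score u c r A \<longleftrightarrow> r \<le> t \<and> inj_on (\<lambda>j. read_vec n A (j * n)) {..<r} \<and>
     (\<forall>i. A i \<le> (1 :: nat)) \<and> (\<forall>i\<ge>t * n. A i = 0) \<and>
     (\<forall>j<r. \<exists>c'<T. read_vec n A (j * n) = cand c' \<and> MK \<le> score c' + u) \<and>
     (\<forall>c'<T. MK < score c' + u \<or> MK = score c' + u \<and> c' < c \<longrightarrow>
        cand c' \<in> (\<lambda>j. read_vec n A (j * n)) ` {..<r} \<or>
        r = t \<and> (\<forall>j<r. \<exists>c''<T. read_vec n A (j * n) = cand c'' \<and> score c' \<le> score c''))"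
  for score :: "nat \<Rightarrow> nat" and n t T MK u c r :: nat

lemma sel_inv_append:
  assumes inv: "sel_inv n t T MK cand score u c r A" and c: "c < T" "score c + u = MK" "r < t"
    and new: "cand c \<notin> (\<lambda>j. read_vec n A (j * n)) ` {..<r}"
    and A': "\<And>q. A' q = (if r * n \<le> q \<and> q < r * n + n then D (c * n + (q - r * n)) else A q)"
    and D: "cand c = read_vec n D (c * n)" "\<And>i. D i \<le> 1"
  shows "sel_inv n t T MK cand score u (Suc c) (Suc r) A'"
proof -
  have old: "read_vec n A' (j * n) = read_vec n A (j * n)" if "j < r" for j
  proof -
    have "A' (j * n + i) = A (j * n + i)" if "i < n" for i
      using index_less[OF \<open>j < r\<close> that] by (simp add: A')
    then show ?thesis by (intro eq_vecI) (auto simp: read_vec_def)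
  qed
  have cur: "read_vec n A' (r * n) = cand c" by (auto simp: read_vec_def A' D(1))
  have img: "(\<lambda>j. read_vec n A' (j * n)) ` {..<Suc r} = insert (cand c) ((\<lambda>j. read_vec n A (j * n)) ` {..<r})"
    using old cur by (auto simp: lessThan_Suc image_iff)
  have "r * n + n \<le> t * n" using c(3) by (metis Suc_leI add.commute mult_Suc mult_le_mono1)
  then have "\<forall>i\<ge>t * n. A' i = 0" using inv by (auto simp: sel_inv_def A')
  moreover have "\<forall>i. A' i \<le> 1" using inv D(2) by (auto simp: sel_inv_def A')
  moreover have "inj_on (\<lambda>j. read_vec n A' (j * n)) {..<Suc r}"
  proof -
    have "inj_on (\<lambda>j. read_vec n A' (j * n)) {..<r}"
      using inv inj_on_cong[of "{..<r}" "\<lambda>j. read_vec n A' (j * n)" "\<lambda>j. read_vec n A (j * n)"] old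
      by (simp add: sel_inv_def)
    moreover have "read_vec n A' (r * n) \<notin> (\<lambda>j. read_vec n A' (j * n)) ` {..<r}"
      using new old cur by (auto simp: image_iff)
    ultimately show ?thesis by (simp add: lessThan_Suc)
  qed
  moreover have "\<forall>j<Suc r. \<exists>c'<T. read_vec n A' (j * n) = cand c' \<and> MK \<le> score c' + u"
  proof (intro allI impI)
    fix j assume "j < Suc r"
    then consider "j < r" | "j = r" by linarith
    then show "\<exists>c'<T. read_vec n A' (j * n) = cand c' \<and> MK \<le> score c' + u"
    proof cases
      case 1
      then show ?thesis using inv old[OF 1] by (simp add: sel_inv_def)
    next
      case 2
      then show ?thesis using c cur by (intro exI[of _ c]) simp
    qed
  qed
  moreover have "\<forall>c'<T. MK < score c' + u \<or> MK = score c' + u \<and> c' < Suc c \<longrightarrow>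
      cand c' \<in> (\<lambda>j. read_vec n A' (j * n)) ` {..<Suc r}"
  proof (intro allI impI)
    fix c' assume c': "c' < T" "MK < score c' + u \<or> MK = score c' + u \<and> c' < Suc c"
    show "cand c' \<in> (\<lambda>j. read_vec n A' (j * n)) ` {..<Suc r}"
    proof (cases "c' = c")
      case False
      then have "MK < score c' + u \<or> MK = score c' + u \<and> c' < c" using c' by auto
      then have "cand c' \<in> (\<lambda>j. read_vec n A (j * n)) ` {..<r}"
        using inv c' c(3) unfolding sel_inv_def by (metis less_irrefl)
      then show ?thesis unfolding img by simp
    qed (simp only: img, simp)
  qed
  ultimately show ?thesis using c(3) unfolding sel_inv_def by simp
qed

text \<open>A skipped entry of the current score is already on the list, or the list is full; in the
  latter case every listed vector has at least the current score.\<close>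

lemma sel_inv_skip:
  assumes inv: "sel_inv n t T MK cand score u c r A"
    and skip: "score c + u = MK \<Longrightarrow> r < t \<Longrightarrow> cand c \<in> (\<lambda>j. read_vec n A (j * n)) ` {..<r}"
  shows "sel_inv n t T MK cand score u (Suc c) r A"
proof -
  have "cand c' \<in> (\<lambda>j. read_vec n A (j * n)) ` {..<r} \<or>
        r = t \<and> (\<forall>j<r. \<exists>c''<T. read_vec n A (j * n) = cand c'' \<and> score c' \<le> score c'')"
    if c': "c' < T" "MK < score c' + u \<or> MK = score c' + u \<and> c' < Suc c" for c'
  proof (cases "MK = score c' + u \<and> c' = c")
    case True
    show ?thesis
    proof (cases "r < t")
      case True
      then show ?thesis using skip \<open>MK = score c' + u \<and> c' = c\<close> by simp
    next
      case False
      then have rt: "r = t" using inv by (simp add: sel_inv_def)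
      have "\<exists>c''<T. read_vec n A (j * n) = cand c'' \<and> score c' \<le> score c''" if "j < r" for j
      proof -
        have "\<forall>j<r. \<exists>c'<T. read_vec n A (j * n) = cand c' \<and> MK \<le> score c' + u"
          using inv by (simp add: sel_inv_def)
        then obtain c'' where "c'' < T" "read_vec n A (j * n) = cand c''" "MK \<le> score c'' + u"
          using \<open>j < r\<close> by blast
        then show ?thesis using True by (intro exI[of _ c'']) simp
      qed
      then show ?thesis using rt by blast
    qed
  next
    case False
    then have "MK < score c' + u \<or> MK = score c' + u \<and> c' < c" using c' by auto
    then show ?thesis using inv c'(1) unfolding sel_inv_def by blast
  qed
  then show ?thesis using inv unfolding sel_inv_def by blast
qed

text \<open>A score above MK - (u + 1) is one of at least MK - u, so the entries considered before
  pass \<open>u + 1\<close> are those considered at the end of pass \<open>u\<close>.\<close>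

lemma sel_inv_next:
  assumes "sel_inv n t T MK cand score u T r A"
  shows "sel_inv n t T MK cand score (Suc u) 0 r A"
proof -
  have *: "MK < score c + Suc u \<or> MK = score c + Suc u \<and> c < 0 \<longleftrightarrow> MK < score c + u \<or> MK = score c + u" for c
    by auto
  have "\<exists>c'<T. read_vec n A (j * n) = cand c' \<and> MK \<le> score c' + Suc u" if "j < r" for j
  proof -
    have "\<forall>j<r. \<exists>c'<T. read_vec n A (j * n) = cand c' \<and> MK \<le> score c' + u"
      using assms by (simp add: sel_inv_def)
    then obtain c' where "c' < T" "read_vec n A (j * n) = cand c'" "MK \<le> score c' + u"
      using \<open>j < r\<close> by blast
    then show ?thesis by (intro exI[of _ c']) simp
  qed
  then show ?thesis using assms unfolding sel_inv_def * by (simp add: conj_disj_distribL)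
qed

lemma den_select_step:
  assumes m: "m 0 0 = n" "m 0 1 = t" "m 5 3 = MK" "m 23 0 = c" "m 45 0 = u" "c < T"
    and inv: "sel_inv n t T MK (\<lambda>c. read_vec n (m 42) (c * n)) (m 41) u c (m 44 0) (m 1)"
    and D: "\<And>i. m 42 i \<le> 1"
  shows "sel_inv n t T MK (\<lambda>c. read_vec n (m 42) (c * n)) (m 41) u (Suc c)
     (den n f select_step m 44 0) (den n f select_step m 1)"
proof -
  define m1 where "m1 = den n f find_candidate m"
  have fr: "m1 a = m a" if "a \<notin> {13, 30, 31, 33}" for a using that by (simp add: m1_def den_frame)
  have "m 44 0 \<le> t" using inv by (simp add: sel_inv_def)
  then have dup: "m1 30 0 = 0 \<longleftrightarrow> read_vec n (m 42) (c * n) \<notin> (\<lambda>j. read_vec n (m 1) (j * n)) ` {..<m 44 0}"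
    using den_find_candidate[of m n t f] m by (simp add: m1_def)
  define ap where "ap \<longleftrightarrow> m 41 c + u = MK \<and> m 44 0 < t \<and> m1 30 0 = 0"
  have step: "den n f select_step m = (if ap then den n f append_candidate m1 else upd m1 30 0 0)"
    using m by (simp add: select_step_def m1_def[symmetric] fr ap_def)
  show ?thesis
  proof (cases ap)
    case True
    have "den n f append_candidate m1 1 = (\<lambda>q. if m 44 0 * n \<le> q \<and> q < m 44 0 * n + n then m 42 (c * n + (q - m 44 0 * n)) else m 1 q)"
    proof -
      have "den n f (PFor 13 en (PAssign 1 (reg 44 [*] en [+] reg 13) (Cell 42 (reg 23 [*] en [+] reg 13)))) m1 1 =
        (\<lambda>q. if m 44 0 * n \<le> q \<and> q < m 44 0 * n + eval m1 en then m 42 (c * n + (q - m 44 0 * n)) else m1 1 q)"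
        by (rule for_fill) (use m in \<open>auto simp: fr\<close>)
      then show ?thesis using m by (simp add: append_candidate_def fr cong: if_cong)
    qed
    moreover have "den n f append_candidate m1 44 0 = Suc (m 44 0)"
      by (simp add: append_candidate_def den_frame fr)
    moreover have "sel_inv n t T MK (\<lambda>c. read_vec n (m 42) (c * n)) (m 41) u (Suc c) (Suc (m 44 0))
       (\<lambda>q. if m 44 0 * n \<le> q \<and> q < m 44 0 * n + n then m 42 (c * n + (q - m 44 0 * n)) else m 1 q)"
      by (rule sel_inv_append[OF inv]) (use True dup m D in \<open>auto simp: ap_def\<close>)
    ultimately show ?thesis using True step by simp
  next
    case False
    have "sel_inv n t T MK (\<lambda>c. read_vec n (m 42) (c * n)) (m 41) u (Suc c) (m 44 0) (m 1)"
      by (rule sel_inv_skip[OF inv]) (use False dup in \<open>auto simp: ap_def\<close>)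
    then show ?thesis using False step by (simp add: fr)
  qed
qed

lemma den_select_top:
  assumes m: "m 0 0 = n" "m 0 1 = t" "m 5 1 = K" "m 5 3 = MK" "m 44 0 = 0" "\<And>i. m 1 i = 0"
    and D: "\<And>i. m 42 i \<le> 1" and le: "\<And>c. m 41 c \<le> MK"
  shows "sel_inv n t (K + t) MK (\<lambda>c. read_vec n (m 42) (c * n)) (m 41) (Suc MK) 0
     (den n f select_top m 44 0) (den n f select_top m 1)"
proof -
  let ?S = "sel_inv n t (K + t) MK (\<lambda>c. read_vec n (m 42) (c * n)) (m 41)"
  have wfi: "wf (PFor 23 (eK [+] et) select_step)" by simp
  have "?S (eval m (eMK [+] Const 1)) 0 (den n f select_top m 44 0) (den n f select_top m 1)"
    unfolding select_top_def
  proof (rule for_rule[where I = "\<lambda>u m'. ?S u 0 (m' 44 0) (m' 1)"], goal_cases)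
    case 1
    show ?case by simp
  next
    case 2
    \<comment> \<open>Before pass 0 nothing has been considered, because no score exceeds
      \<open>MK\<close>; after \<open>MK + 1\<close> passes everything has.\<close>
    have "\<not> MK < m 41 c" for c using le[of c] by simp
    then show ?case using m by (simp add: sel_inv_def)
  next
    case (3 u m')
    have fr: "m' 0 = m 0" "m' 5 = m 5" "m' 41 = m 41" "m' 42 = m 42" by (simp_all add: 3(3))
    have "?S u (eval m' (eK [+] et)) (den n f (PFor 23 (eK [+] et) select_step) m' 44 0)
       (den n f (PFor 23 (eK [+] et) select_step) m' 1)"
    proof (rule for_rule[OF wfi, where I = "\<lambda>c m''. ?S u c (m'' 44 0) (m'' 1)"], goal_cases)
      case 1
      show ?case using 3(4) by simp
    next
      case (2 c m'')
      have fr': "m'' 0 = m 0" "m'' 5 = m 5" "m'' 41 = m 41" "m'' 42 = m 42" "m'' 45 = m' 45"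
        by (simp_all add: 2(3) fr)
      show ?case
        using den_select_step[of m'' n t MK c u "K + t" f] 2 3(2) m D fr fr' by simp
    qed
    moreover have "eval m' (eK [+] et) = K + t" using fr m by simp
    ultimately have "?S (Suc u) 0 (den n f (PFor 23 (eK [+] et) select_step) m' 44 0)
       (den n f (PFor 23 (eK [+] et) select_step) m' 1)" by (intro sel_inv_next) simp
    then show ?case by simp
  qed
  then show ?thesis using m by simp
qed


text \<open>Keeps every count at most M * 2 ^ k, the range covered by the passes of the
  selection.\<close>

lemma estimate_le_1:
  assumes f: "f \<in> cube n \<rightarrow> {- 1, 1}"
  shows "estimate n f k M z c J \<le> 1"
proof -
  have "(\<Sum>m<M. sample n f (block n z) k c J (block n z (k + m))) \<le> (\<Sum>m<M. 1)"
    using sample_bound[OF f] by (intro sum_mono) (meson abs_le_D1 block_carrier)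
  then show ?thesis by (cases "M = 0") (simp_all add: estimate_def)
qed

lemma den_emit: "den n f emit m 1 = (\<lambda>q. if q < m 0 1 * m 0 0 then m 1 q + 1 else m 1 q)"
  using for_add[of 13 "et [*] en" 1 "Const 1" m "\<lambda>_. 1" n f] by (simp add: emit_def)

lemma den_prove:
  fixes m :: mem and n :: nat
  defines "z \<equiv> \<lambda>i. m 4 (m 22 0 * m 5 4 + i)"
  assumes f: "f \<in> cube n \<rightarrow> {- 1, 1}" and m: "m 0 0 = n" "m 0 1 = t" "m 5 0 = k" "m 5 1 = 2 ^ k"
     "m 5 2 = M" "m 5 3 = M * 2 ^ k" and pos: "M > 0"
     and init: "\<And>i. m 1 i = 0" "\<And>i. m 41 i = 0" "\<And>i. m 42 i = 0" "m 44 0 = 0"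
  shows "\<exists>A. (\<forall>i. A i \<le> 1) \<and> den n f prove m 1 = (\<lambda>i. if i < t * n then A i + 1 else 0) \<and>
    (t \<le> 2 ^ n \<longrightarrow> inj_on (\<lambda>j. read_vec n A (j * n)) {..<t} \<and>
      (\<forall>h > 0. separated n f k h (block n z) \<longrightarrow> accurate n f k M {..n} h z \<longrightarrow>
        sq_top n f (10 * h) ((\<lambda>j. read_vec n A (j * n)) ` {..<t})))"
proof -
  define m1 where "m1 = den n f tabulate m"
  define m2 where "m2 = den n f add_fillers m1"
  define m3 where "m3 = den n f select_top m2"
  define A where "A = m3 1"
  define r where "r = m3 44 0"
  define cand where "cand c = read_vec n (m2 42) (c * n)" for c
  define score where "score = m2 41"
  have fr1: "m1 a = m a" if "a \<notin> writes tabulate" for a unfolding m1_def using that by (rule den_frame)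
  have fr2': "m2 a = m1 a" if "a \<notin> writes add_fillers" for a unfolding m2_def using that by (rule den_frame)
  have fr2: "m2 0 = m 0" "m2 5 = m 5" "m2 (Suc 0) = m (Suc 0)" "m2 44 = m 44" "m2 41 = m1 41"
    by (simp_all add: fr2' fr1)
  note tab = den_tabulate[OF f m(1,3-6) pos init(2), folded z_def m1_def]
  have tab1: "2 * real (score c) = real (M * 2 ^ k) * (1 + estimate n f k M z c n)" if "c < 2 ^ k" for c
    using tab(1)[OF _ that] init(3) by (simp add: score_def fr2)
  have tab2: "score c = 0" if "c \<ge> 2 ^ k" for c
    using tab(2)[OF _ that] init(3) by (simp add: score_def fr2)
  have tab4: "m1 42 i \<le> 1" for i using tab(4) init(3) by simp
  have m1': "m1 0 0 = n" "m1 0 1 = t" "m1 5 1 = 2 ^ k" using m by (simp_all add: fr1)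
  note fil = den_add_fillers[OF m1' tab4, where f = f, folded m2_def]
  have cand1: "cand c = decode n f k M z c" if "c < 2 ^ k" for c
    using fil(2)[OF that] tab(3)[OF _ that] init(3) by (simp add: cand_def)
  have cand2: "cand (2 ^ k + j) = binary_vec n j" if "j < t" for j
    using fil(3)[OF that] by (simp add: cand_def)
  have P: "real (M * 2 ^ k) > 0" using pos by simp
  have score_le: "score c \<le> M * 2 ^ k" for c
  proof (cases "c < 2 ^ k")
    case True
    have "1 + estimate n f k M z c n \<le> 2" using estimate_le_1[OF f, of k M z c n] by simp
    then have "2 * real (score c) \<le> real (M * 2 ^ k) * 2"
      unfolding tab1[OF True] by (intro mult_left_mono) simp_all
    then have "real (score c) \<le> real (M * 2 ^ k)" by simp
    then show ?thesis by (simp only: of_nat_le_iff)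
  qed (simp add: tab2)
  have m2': "m2 0 0 = n" "m2 0 1 = t" "m2 5 1 = 2 ^ k" "m2 5 3 = M * 2 ^ k" "m2 44 0 = 0" "\<And>i. m2 1 i = 0"
    using m init by (simp_all add: fr2)
  have inv: "sel_inv n t (2 ^ k + t) (M * 2 ^ k) cand score (Suc (M * 2 ^ k)) 0 r A"
    unfolding cand_def score_def r_def A_def m3_def
    by (rule den_select_top[OF m2' fil(1)]) (use score_le in \<open>simp add: score_def\<close>)
  have fr3: "m3 0 = m 0" by (simp add: m3_def den_frame fr2)
  have final: "den n f prove m 1 = (\<lambda>i. if i < t * n then A i + 1 else A i)"
  proof -
    have "den n f prove m = den n f emit m3"
      by (simp only: prove_def den.simps m1_def m2_def m3_def)
    then show ?thesis unfolding A_def by (simp only: den_emit fr3 m)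
  qed
  have A01: "\<forall>i. A i \<le> 1" and A0: "\<forall>i\<ge>t * n. A i = 0"
    using inv by (simp_all add: sel_inv_def)
  have out: "den n f prove m 1 = (\<lambda>i. if i < t * n then A i + 1 else 0)"
    unfolding final using A0 by (auto simp: fun_eq_iff not_less)
  let ?\<Gamma> = "(\<lambda>j. read_vec n A (j * n)) ` {..<r}"
  have chosen: "cand c \<in> ?\<Gamma> \<or> r = t \<and> (\<forall>j<r. \<exists>c'<2 ^ k + t. read_vec n A (j * n) = cand c' \<and> score c \<le> score c')"
    if "c < 2 ^ k + t" for c
    using inv that unfolding sel_inv_def by (metis le_add2 le_imp_less_Suc add_Suc_right)
  \<comment> \<open>A list that is not full would contain every candidate, in particular all
    fillers, which are \<open>t\<close> distinct vectors if t \<le> 2 ^ n.\<close>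
  have rt: "r = t" if t: "t \<le> 2 ^ n"
  proof (rule ccontr)
    assume ne: "r \<noteq> t"
    then have "r < t" using inv by (simp add: sel_inv_def)
    have "binary_vec n ` {..<t} \<subseteq> ?\<Gamma>"
    proof
      fix v assume "v \<in> binary_vec n ` {..<t}"
      then obtain j where "j < t" "v = binary_vec n j" by auto
      then show "v \<in> ?\<Gamma>" using chosen[of "2 ^ k + j"] cand2[of j] ne by simp
    qed
    then have "card (binary_vec n ` {..<t}) \<le> card ?\<Gamma>" by (intro card_mono) auto
    also have "\<dots> \<le> r" using card_image_le[of "{..<r}"] by simp
    also have "card (binary_vec n ` {..<t}) = t"
      using inj_on_subset[OF inj_on_binary_vec, of "{..<t}" n] t by (simp add: card_image)
    finally show False using \<open>r < t\<close> by simp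
  qed
  have top: "sq_top n f (10 * h) ?\<Gamma>"
    if "r = t" "h > 0" "separated n f k h (block n z)" "accurate n f k M {..n} h z" for h
  proof (rule selection_sq_top[OF that(3,4,2)])
    fix c \<beta> assume c: "c < 2 ^ k" "decode n f k M z c \<notin> ?\<Gamma>" "estimate n f k M z c n > 0" and \<beta>: "\<beta> \<in> ?\<Gamma>"
    have "cand c \<notin> ?\<Gamma>" using c cand1 by simp
    moreover obtain j where j: "j < r" "\<beta> = read_vec n A (j * n)" using \<beta> by auto
    ultimately obtain c' where c': "c' < 2 ^ k + t" "\<beta> = cand c'" "score c \<le> score c'"
      using chosen[of c] c(1) by auto
    \<comment> \<open>A positive score rules out the positions of the fillers, so \<beta> is
      obtained from a bucket.\<close>
    have "2 * real (score c) > 0" unfolding tab1[OF c(1)] using P c(3) by simp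
    then have "score c' > 0" using c'(3) by simp
    then have c'k: "c' < 2 ^ k" using tab2[of c'] by (cases "c' < 2 ^ k") auto
    have "2 * real (score c) \<le> 2 * real (score c')" using c'(3) by simp
    then have "estimate n f k M z c n \<le> estimate n f k M z c' n"
      unfolding tab1[OF c(1)] tab1[OF c'k] using P by (simp only: mult_le_cancel_left_pos add_le_cancel_left)
    then show "\<exists>c'<2 ^ k. \<beta> = decode n f k M z c' \<and> estimate n f k M z c n \<le> estimate n f k M z c' n"
      using c' c'k cand1 by auto
  qed
  have inj: "inj_on (\<lambda>j. read_vec n A (j * n)) {..<r}" using inv by (simp add: sel_inv_def)
  show ?thesis
    using A01 out rt top inj by (intro exI[of _ A]) auto
qed

section \<open>Running times\<close>

text \<open>One variable suffices: all inputs are bounded by a single number. Closure under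
  composition is what programs with several stages call for.\<close>

definition poly_bounded :: "(nat \<Rightarrow> nat) \<Rightarrow> bool" where
  "poly_bounded g \<longleftrightarrow> (\<exists>C k. \<forall>x. g x \<le> C * (1 + x) ^ k)"

lemma poly_bounded_const [intro, simp]: "poly_bounded (\<lambda>_. c)"
  unfolding poly_bounded_def by (intro exI[of _ c] exI[of _ 0]) simp

lemma poly_bounded_id [intro, simp]: "poly_bounded (\<lambda>x. x)"
  unfolding poly_bounded_def by (intro exI[of _ 1] exI[of _ 1]) simp

lemma poly_bounded_mono: "poly_bounded g \<Longrightarrow> (\<And>x. h x \<le> g x) \<Longrightarrow> poly_bounded h"
  unfolding poly_bounded_def using le_trans by meson

lemma poly_bounded_mult [intro]:
  assumes "poly_bounded g" "poly_bounded h"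
  shows "poly_bounded (\<lambda>x. g x * h x)"
proof -
  obtain C k C' k' where "\<And>x. g x \<le> C * (1 + x) ^ k" "\<And>x. h x \<le> C' * (1 + x) ^ k'"
    using assms unfolding poly_bounded_def by blast
  note bd = this
  have "g x * h x \<le> (C * C') * (1 + x) ^ (k + k')" for x
  proof -
    have "g x * h x \<le> (C * (1 + x) ^ k) * (C' * (1 + x) ^ k')"
      by (intro mult_le_mono bd)
    also have "\<dots> = (C * C') * (1 + x) ^ (k + k')"
      by (simp only: power_add mult_ac)
    finally show ?thesis .
  qed
  then show ?thesis unfolding poly_bounded_def by blast
qed

lemma poly_bounded_Suc [intro]:
  assumes "poly_bounded f"
  shows "poly_bounded (\<lambda>x. Suc (f x))"
proof -
  obtain C k where C: "\<And>x. f x \<le> C * (1 + x) ^ k" using assms unfolding poly_bounded_def by blast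
  have "Suc (f x) \<le> (1 + C) * (1 + x) ^ k" for x
  proof -
    have "1 \<le> (1 + x) ^ k" by simp
    then have "1 + f x \<le> (1 + x) ^ k + C * (1 + x) ^ k" using C by (rule add_mono)
    then show ?thesis by (simp add: add_mult_distrib)
  qed
  then show ?thesis unfolding poly_bounded_def by blast
qed

text \<open>A sum is at most the product of the successors, which spares a comparison of
  exponents.\<close>

lemma poly_bounded_add [intro]:
  assumes "poly_bounded g" "poly_bounded h"
  shows "poly_bounded (\<lambda>x. g x + h x)"
proof (rule poly_bounded_mono)
  show "poly_bounded (\<lambda>x. Suc (g x) * Suc (h x))"
    by (intro poly_bounded_mult poly_bounded_Suc assms)
qed simp

lemma poly_bounded_power [intro]: "poly_bounded g \<Longrightarrow> poly_bounded (\<lambda>x. g x ^ j)"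
  by (induction j) auto

lemma poly_bounded_comp:
  assumes "poly_bounded g" "poly_bounded h"
  shows "poly_bounded (\<lambda>x. g (h x))"
proof -
  obtain C k where C: "\<And>x. g x \<le> C * (1 + x) ^ k" using assms(1) unfolding poly_bounded_def by blast
  have "poly_bounded (\<lambda>x. C * Suc (h x) ^ k)"
    by (intro poly_bounded_mult poly_bounded_power poly_bounded_Suc poly_bounded_const assms(2))
  then show ?thesis by (rule poly_bounded_mono) (use C[of "h _"] in simp)
qed

lemmas poly_bounded_intros =
  poly_bounded_const poly_bounded_id poly_bounded_Suc poly_bounded_add poly_bounded_mult poly_bounded_power

fun obound :: "nat \<Rightarrow> prog \<Rightarrow> nat" where
  "obound B (PAssign a i e) = 1"
| "obound B (PQuery a i q) = 1"
| "obound B (PSeq p q) = obound B p + obound B q"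
| "obound B (PIf e p q) = 1 + obound B p + obound B q"
| "obound B (PFor x e p) = 2 + vbound B e * (2 + obound B p)"

lemma ops_le_obound: "mem_le m B \<Longrightarrow> ops m p \<le> obound B p"
  by (induction p) (simp_all add: add_mono mult_mono eval_le_vbound)

text \<open>The computation of the constants multiplies and is not tame. It has a fixed number of
  stages, so each may raise the memory bound polynomially and the bounds are composed; loops are
  still required to be tame (\<open>staged\<close>).\<close>

fun mbound :: "nat \<Rightarrow> prog \<Rightarrow> nat" where
  "mbound B (PAssign a i e) = B + vbound B e"
| "mbound B (PSeq p q) = mbound (mbound B p) q"
| "mbound B p = B + obound B p"

fun sbound :: "nat \<Rightarrow> prog \<Rightarrow> nat" where
  "sbound B (PAssign a i e) = 1 + cbound B i + cbound B e"
| "sbound B (PSeq p q) = sbound B p + sbound (mbound B p) q"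
| "sbound B p = obound B p * ubound (B + obound B p) p"

fun staged :: "prog \<Rightarrow> bool" where
  "staged (PAssign a i e) = True"
| "staged (PSeq p q) = (staged p \<and> staged q)"
| "staged p = (wf p \<and> tame p \<and> controls p \<inter> writes p = {} \<and> (\<forall>m. qcount m p = 0))"

lemma poly_bounded_vbound: "poly_bounded (\<lambda>B. vbound B e)"
  by (induction e) (simp_all only: vbound.simps poly_bounded_intros)

lemma poly_bounded_cbound: "poly_bounded (\<lambda>B. cbound B e)"
  by (induction e) (simp_all only: cbound.simps poly_bounded_intros poly_bounded_vbound)

lemma poly_bounded_ubound: "poly_bounded (\<lambda>B. ubound B p)"
  by (induction p) (simp_all only: ubound.simps poly_bounded_intros poly_bounded_cbound)

lemma poly_bounded_obound: "poly_bounded (\<lambda>B. obound B p)"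
  by (induction p) (simp_all only: obound.simps poly_bounded_intros poly_bounded_vbound)

lemma poly_bounded_mbound: "poly_bounded (\<lambda>B. mbound B p)"
proof (induction p)
  case (PSeq p q)
  show ?case using poly_bounded_comp[OF PSeq.IH(2,1)] by simp
qed (simp_all only: mbound.simps poly_bounded_intros poly_bounded_vbound poly_bounded_obound)

lemma poly_bounded_sbound: "poly_bounded (\<lambda>B. sbound B p)"
proof (induction p)
  case (PSeq p q)
  have "poly_bounded (\<lambda>B. sbound (mbound B p) q)"
    by (rule poly_bounded_comp[OF PSeq.IH(2) poly_bounded_mbound])
  with PSeq.IH(1) show ?case unfolding sbound.simps by (rule poly_bounded_add)
next
  case (PFor x e p)
  show ?case unfolding sbound.simps
    by (rule poly_bounded_mult[OF poly_bounded_obound poly_bounded_comp[OF poly_bounded_ubound]])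
      (rule poly_bounded_add[OF poly_bounded_id poly_bounded_obound])
next
  case (PIf e p q)
  show ?case unfolding sbound.simps
    by (rule poly_bounded_mult[OF poly_bounded_obound poly_bounded_comp[OF poly_bounded_ubound]])
      (rule poly_bounded_add[OF poly_bounded_id poly_bounded_obound])
next
  case (PQuery a i q)
  show ?case unfolding sbound.simps
    by (rule poly_bounded_mult[OF poly_bounded_obound poly_bounded_comp[OF poly_bounded_ubound]])
      (rule poly_bounded_add[OF poly_bounded_id poly_bounded_obound])
qed (simp_all only: sbound.simps poly_bounded_intros poly_bounded_cbound)

lemma mem_le_mbound: "B \<le> mbound B p"
  by (induction p arbitrary: B) (auto intro: le_trans)

lemma exec_tame:
  assumes "wf p" "tame p" "controls p \<inter> writes p = {}" "n \<le> B" "2 \<le> B" "mem_le (memory s) B"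
  shows "\<exists>s'. exec n f (compile p) s = return_spmf s' \<and> memory s' = den n f p (memory s) \<and>
    queries s' \<le> queries s + qcount (memory s) p \<and>
    steps s' \<le> steps s + obound B p * ubound (B + obound B p) p \<and>
    mem_le (memory s') (B + obound B p)"
proof -
  have le: "ops (memory s) p \<le> obound B p" by (rule ops_le_obound[OF assms(6)])
  obtain s' where s': "exec n f (compile p) s = return_spmf s'" "memory s' = den n f p (memory s)"
    "queries s' \<le> queries s + qcount (memory s) p"
    "steps s' \<le> steps s + ops (memory s) p * ubound (B + obound B p) p"
    "mem_le (memory s') (B + ops (memory s) p)"
    using exec_compile[of p n "B + obound B p" B "memory s" s "ubound (B + obound B p) p" f] assms le by auto
  have "ops (memory s) p * ubound (B + obound B p) p \<le> obound B p * ubound (B + obound B p) p"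
    using le by simp
  then have "steps s' \<le> steps s + obound B p * ubound (B + obound B p) p" using s'(4) by linarith
  moreover have "mem_le (memory s') (B + obound B p)"
    by (rule mem_le_mono[OF s'(5)]) (use le in simp)
  ultimately show ?thesis using s'(1-3) by blast
qed

lemma exec_staged:
  assumes "staged p" "n \<le> B" "2 \<le> B" "mem_le (memory s) B"
  shows "\<exists>s'. exec n f (compile p) s = return_spmf s' \<and> memory s' = den n f p (memory s) \<and>
    queries s' \<le> queries s \<and> steps s' \<le> steps s + sbound B p \<and> mem_le (memory s') (mbound B p)"
  using assms
proof (induction p arbitrary: s B)
  case (PAssign a i e)
  have "mem_le (upd (memory s) a (eval (memory s) i) (eval (memory s) e)) (B + vbound B e)"
    by (rule mem_le_upd[OF mem_le_mono[OF PAssign.prems(4)]])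
      (use eval_le_vbound[OF PAssign.prems(4), of e] in auto)
  then show ?case
    using cost_le_cbound[OF PAssign.prems(4), of i] cost_le_cbound[OF PAssign.prems(4), of e]
    by (simp add: exec_simps)
next
  case (PSeq p q)
  obtain s1 where s1: "exec n f (compile p) s = return_spmf s1" "memory s1 = den n f p (memory s)"
    "queries s1 \<le> queries s" "steps s1 \<le> steps s + sbound B p" "mem_le (memory s1) (mbound B p)"
    using PSeq.IH(1)[of B s] PSeq.prems by auto
  obtain s2 where s2: "exec n f (compile q) s1 = return_spmf s2" "memory s2 = den n f q (memory s1)"
    "queries s2 \<le> queries s1" "steps s2 \<le> steps s1 + sbound (mbound B p) q"
    "mem_le (memory s2) (mbound (mbound B p) q)"
  proof -
    have "n \<le> mbound B p" "2 \<le> mbound B p" using PSeq.prems(2,3) mem_le_mbound[of B p] by linarith+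
    then show ?thesis using PSeq.IH(2)[of "mbound B p" s1] PSeq.prems(1) s1(5) that by auto
  qed
  show ?case using s1 s2 by (auto simp: exec_simps)
next
  case (PFor x e p)
  then have a: "wf (PFor x e p)" "tame (PFor x e p)" "controls (PFor x e p) \<inter> writes (PFor x e p) = {}" "qcount (memory s) (PFor x e p) = 0"
    by (simp_all only: staged.simps simp_thms)
  show ?case using exec_tame[OF a(1-3) PFor.prems(2-4), of f]
    unfolding a(4) by (simp only: sbound.simps mbound.simps add_0_right)
next
  case (PIf e p q)
  then have a: "wf (PIf e p q)" "tame (PIf e p q)" "controls (PIf e p q) \<inter> writes (PIf e p q) = {}" "qcount (memory s) (PIf e p q) = 0"
    by (simp_all only: staged.simps simp_thms)
  show ?case using exec_tame[OF a(1-3) PIf.prems(2-4), of f]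
    unfolding a(4) by (simp only: sbound.simps mbound.simps add_0_right)
next
  case (PQuery a i q)
  then show ?case by simp
qed

subsection \<open>Random bits\<close>

definition flips :: com where
  "flips = Seq (Assign 8 (Const 0) (Const 0)) (While (Op Less (reg 8) (Cell 5 (Const 6)))
     (Seq (Flip 4 (reg 8)) (Assign 8 (Const 0) (Op Plus (reg 8) (Const 1)))))"

definition fbound :: "nat \<Rightarrow> nat" where
  "fbound B = 3 + (1 + B) * (4 + cbound (1 + B) (Op Less (reg 8) (Cell 5 (Const 6))) + cbound (1 + B) (reg 8) +
     cbound (1 + B) (Op Plus (reg 8) (Const 1)))"

lemma poly_bounded_fbound: "poly_bounded fbound"
proof -
  have *: "poly_bounded (\<lambda>B. cbound (1 + B) e)" for e
    by (rule poly_bounded_comp[OF poly_bounded_cbound]) (intro poly_bounded_intros)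
  have "poly_bounded (\<lambda>B. fbound B)"
    unfolding fbound_def
    by (intro poly_bounded_add poly_bounded_mult poly_bounded_const poly_bounded_id *)
  then show ?thesis .
qed

text \<open>The number of steps is the same for all outcomes, because no expression in the loop
  reads array 4. The final configuration is therefore one fixed function of the tape, and
  \<open>coins\<close> gives its distribution.\<close>

lemma exec_flips:
  assumes B: "mem_le (memory s) B" and N: "memory s 5 6 = N" and z: "memory s 4 = (\<lambda>_. 0)"
  shows "\<exists>T\<le>fbound B. exec n f flips s = map_spmf (\<lambda>z. \<lparr>memory = (memory s)(8 := (memory s 8)(0 := N), 4 := z),
     steps = steps s + T, queries = queries s\<rparr>) (coins N)"
proof -
  define test where "test = Op Less (reg 8) (Cell 5 (Const 6))"
  define W where "W = While test (Seq (Flip 4 (reg 8)) (Assign 8 (Const 0) (Op Plus (reg 8) (Const 1))))"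
  define mm where "mm j z = (memory s)(8 := (memory s 8)(0 := j), 4 := z)" for j z
  define U where "U = 4 + cbound (1 + B) test + cbound (1 + B) (reg 8) + cbound (1 + B) (Op Plus (reg 8) (Const 1))"
  define \<kappa> where "\<kappa> j = (1 + cost (mm j (\<lambda>_. 0)) test) + (1 + cost (mm j (\<lambda>_. 0)) (reg 8)) +
    (1 + cost (mm j (\<lambda>_. 0)) (Const 0) + cost (mm j (\<lambda>_. 0)) (Op Plus (reg 8) (Const 1)))" for j
  define c0 where "c0 = 1 + cost (memory s) (Const 0) + cost (memory s) (Const 0)"
  define st where "st j z = \<lparr>memory = mm j z, steps = steps s + c0 + (\<Sum>i<j. \<kappa> i), queries = queries s\<rparr>" for j z
  have NB: "N \<le> B" using B N by blast
  have c: "cost (mm j z) test = cost (mm j (\<lambda>_. 0)) test" "cost (mm j z) (reg 8) = cost (mm j (\<lambda>_. 0)) (reg 8)"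
    "cost (mm j z) (Op Plus (reg 8) (Const 1)) = cost (mm j (\<lambda>_. 0)) (Op Plus (reg 8) (Const 1))" for j z
    by (simp_all add: mm_def test_def)
  have step: "exec n f W (st j z) = bind_spmf coin_spmf (\<lambda>b. exec n f W (st (Suc j) (z(j := of_bool b))))"
    if "j < N" for j z
  proof -
    define s0 where "s0 = charge (1 + cost (memory (st j z)) test) (st j z)"
    define s1 where "s1 b = charge (1 + cost (memory s0) (reg 8)) (store 4 (eval (memory s0) (reg 8)) (of_bool b) s0)" for b
    define s2 where "s2 b = charge (1 + cost (memory (s1 b)) (Const 0) + cost (memory (s1 b)) (Op Plus (reg 8) (Const 1)))
      (store 8 (eval (memory (s1 b)) (Const 0)) (eval (memory (s1 b)) (Op Plus (reg 8) (Const 1))) (s1 b))" for b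
    have sel: "mm j z 8 0 = j" "mm j z 5 = memory s 5" for j z by (simp_all add: mm_def)
    have m0: "memory s0 = mm j z" by (simp add: s0_def st_def)
    have m1: "memory (s1 b) = mm j (z(j := of_bool b))" for b
      by (simp add: s1_def m0 sel) (simp add: mm_def upd_def fun_eq_iff)
    have s2: "s2 b = st (Suc j) (z(j := of_bool b))" for b
    proof (rule config.equality)
      show "memory (s2 b) = memory (st (Suc j) (z(j := of_bool b)))"
        by (simp add: s2_def m1 sel st_def) (simp add: mm_def upd_def fun_eq_iff)
      show "steps (s2 b) = steps (st (Suc j) (z(j := of_bool b)))"
        unfolding s2_def charge_sel store_sel m1 s1_def s0_def c by (simp add: st_def \<kappa>_def test_def sel)
    qed (simp_all add: s2_def s1_def s0_def st_def store_def charge_def)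
    have "eval (memory (st j z)) test \<noteq> 0" using that N by (simp add: st_def test_def mm_def)
    then have "exec n f W (st j z) = bind_spmf (exec n f (Seq (Flip 4 (reg 8)) (Assign 8 (Const 0) (Op Plus (reg 8) (Const 1)))) s0) (exec n f W)"
      unfolding W_def s0_def by (subst exec_simps(7)) simp
    also have "\<dots> = bind_spmf coin_spmf (\<lambda>b. exec n f W (s2 b))"
      by (simp only: exec_simps(2,3,5) bind_spmf_assoc return_bind_spmf s1_def s2_def)
    finally show ?thesis by (simp only: s2)
  qed
  have loop: "exec n f W (st 0 (\<lambda>_. 0)) = bind_spmf (coins j) (\<lambda>z. exec n f W (st j z))" if "j \<le> N" for j
    using that
  proof (induction j)
    case (Suc j)
    then have "exec n f W (st 0 (\<lambda>_. 0)) = bind_spmf (coins j) (\<lambda>z. exec n f W (st j z))" by simp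
    also have "\<dots> = bind_spmf (coins (Suc j)) (\<lambda>z. exec n f W (st (Suc j) z))"
      using step[of j] Suc.prems by simp
    finally show ?case .
  qed simp
  define T where "T = c0 + (\<Sum>i<N. \<kappa> i) + (1 + cost (mm N (\<lambda>_. 0)) test)"
  have last: "exec n f W (st N z) = return_spmf \<lparr>memory = mm N z, steps = steps s + T, queries = queries s\<rparr>" for z
  proof -
    have "eval (memory (st N z)) test = 0" using N by (simp add: st_def test_def mm_def)
    then have "exec n f W (st N z) = return_spmf (charge (1 + cost (memory (st N z)) test) (st N z))"
      unfolding W_def by (subst exec_simps(7)) simp
    then show ?thesis by (simp add: st_def c[of N z] charge_def T_def)
  qed
  have init: "exec n f flips s = exec n f W (st 0 (\<lambda>_. 0))"
  proof -
    have "charge c0 (store 8 0 0 s) = st 0 (\<lambda>_. 0)"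
      using z by (cases s) (auto simp: st_def charge_def store_def mm_def fun_eq_iff)
    then show ?thesis
      by (simp only: flips_def exec_simps(2,5) return_bind_spmf eval.simps test_def[symmetric]
          W_def[symmetric] c0_def[symmetric])
  qed
  have "exec n f flips s = map_spmf (\<lambda>z. \<lparr>memory = mm N z, steps = steps s + T, queries = queries s\<rparr>) (coins N)"
    unfolding init loop[OF order_refl] last by (simp add: map_spmf_conv_bind_spmf)
  moreover have "T \<le> fbound B"
  proof -
    have le: "mem_le (mm j (\<lambda>_. 0)) (1 + B)" if "j \<le> N" for j
    proof (intro allI)
      fix a i
      have "memory s a i \<le> 1 + B" using B by (simp add: le_SucI)
      then show "mm j (\<lambda>_. 0) a i \<le> 1 + B" using that NB by (auto simp: mm_def)
    qed
    have \<kappa>: "\<kappa> j \<le> U" if "j \<le> N" for j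
      unfolding \<kappa>_def U_def using cost_le_cbound[OF le[OF that], of test] cost_le_cbound[OF le[OF that], of "reg 8"]
        cost_le_cbound[OF le[OF that], of "Op Plus (reg 8) (Const 1)"] floorlog_le[of 0]
      by (simp del: cbound.simps)
    have "(\<Sum>i<N. \<kappa> i) \<le> N * U" using sum_mono[of "{..<N}" \<kappa> "\<lambda>_. U"] \<kappa> by simp
    moreover have "1 + cost (mm N (\<lambda>_. 0)) test \<le> U"
      using cost_le_cbound[OF le[OF order_refl], of test] by (simp add: U_def del: cbound.simps)
    moreover have "c0 \<le> 3" using floorlog_le[of 0] by (simp add: c0_def)
    moreover have "N * U \<le> B * U" using NB by simp
    moreover have "fbound B = 3 + (U + B * U)"
      by (simp add: fbound_def U_def test_def del: cbound.simps)
    ultimately show ?thesis unfolding T_def by linarith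
  qed
  ultimately show ?thesis unfolding mm_def by blast
qed

subsection \<open>Programs with random bits\<close>

definition randomized :: "prog \<Rightarrow> prog \<Rightarrow> com" where
  "randomized I p = Seq (compile I) (Seq flips (compile p))"

definition tbound :: "prog \<Rightarrow> prog \<Rightarrow> nat \<Rightarrow> nat" where
  "tbound I p B = sbound B I + fbound (mbound B I) +
     obound (1 + mbound B I) p * ubound (1 + mbound B I + obound (1 + mbound B I) p) p"

lemma poly_bounded_tbound: "poly_bounded (tbound I p)"
proof -
  have 1: "poly_bounded (\<lambda>B. 1 + mbound B I)"
    by (intro poly_bounded_intros poly_bounded_mbound)
  have 2: "poly_bounded (\<lambda>B. obound (1 + mbound B I) p)"
    by (rule poly_bounded_comp[OF poly_bounded_obound 1])
  have 3: "poly_bounded (\<lambda>B. ubound (1 + mbound B I + obound (1 + mbound B I) p) p)"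
    by (rule poly_bounded_comp[OF poly_bounded_ubound poly_bounded_add[OF 1 2]])
  have "poly_bounded (\<lambda>B. tbound I p B)"
    unfolding tbound_def
    by (intro poly_bounded_add poly_bounded_mult 2 3 poly_bounded_sbound
        poly_bounded_comp[OF poly_bounded_fbound poly_bounded_mbound])
  then show ?thesis .
qed

text \<open>After the flips the run is deterministic, so the final configuration is a function
  \<open>fin\<close> of the tape and events become sets of tapes. The flips touch only arrays 4 and
  8, outside the \<open>controls\<close> of \<open>p\<close>, so its queries can be counted in
  \<open>m1\<close>.\<close>

lemma exec_randomized:
  fixes s :: config and I :: prog and n :: nat and f :: "bit vec \<Rightarrow> real"
  defines "m1 \<equiv> den n f I (memory s)"
  assumes "staged I" "4 \<notin> writes I" "wf p" "tame p" "controls p \<inter> writes p = {}" "controls p \<subseteq> {0, 5}"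
    and "n \<le> B" "2 \<le> B" "mem_le (memory s) B" "memory s 4 = (\<lambda>_. 0)"
  shows "\<exists>fin. exec n f (randomized I p) s = map_spmf fin (coins (m1 5 6)) \<and>
    (\<forall>z\<in>tapes (m1 5 6). memory (fin z) = den n f p (m1(8 := (m1 8)(0 := m1 5 6), 4 := z)) \<and>
       queries (fin z) \<le> queries s + qcount m1 p \<and> steps (fin z) \<le> steps s + tbound I p B)"
proof -
  obtain s1 where s1: "exec n f (compile I) s = return_spmf s1" "memory s1 = m1"
    "queries s1 \<le> queries s" "steps s1 \<le> steps s + sbound B I" "mem_le m1 (mbound B I)"
    using exec_staged[of I n B s f] assms by auto
  define N where "N = m1 5 6"
  have "m1 4 = (\<lambda>_. 0)" using assms by (simp add: m1_def den_frame)
  then obtain T where T: "T \<le> fbound (mbound B I)"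
    "exec n f flips s1 = map_spmf (\<lambda>z. \<lparr>memory = m1(8 := (m1 8)(0 := N), 4 := z),
     steps = steps s1 + T, queries = queries s1\<rparr>) (coins N)"
    using exec_flips[of s1 "mbound B I" N n f] s1 by (auto simp: N_def)
  define s2 where "s2 z = \<lparr>memory = m1(8 := (m1 8)(0 := N), 4 := z), steps = steps s1 + T, queries = queries s1\<rparr>" for z
  have "\<exists>s'. exec n f (compile p) (s2 z) = return_spmf s' \<and> memory s' = den n f p (memory (s2 z)) \<and>
      queries s' \<le> queries s + qcount m1 p \<and> steps s' \<le> steps s + tbound I p B" if z: "z \<in> tapes N" for z
  proof -
    let ?B = "1 + mbound B I"
    have le: "mem_le (memory (s2 z)) ?B"
    proof (intro allI)
      fix a i
      have "m1 a i \<le> ?B" "N \<le> ?B" using s1(5) by (simp_all add: N_def le_SucI)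
      moreover have "z i \<le> ?B"
      proof -
        have "z i \<le> 1" using z by (simp add: tapes_def)
        then show ?thesis by linarith
      qed
      ultimately show "memory (s2 z) a i \<le> ?B" by (auto simp: s2_def)
    qed
    have "n \<le> ?B" "2 \<le> ?B" using assms(8,9) mem_le_mbound[of B I] by linarith+
    then obtain s' where s': "exec n f (compile p) (s2 z) = return_spmf s'" "memory s' = den n f p (memory (s2 z))"
      "queries s' \<le> queries (s2 z) + qcount (memory (s2 z)) p"
      "steps s' \<le> steps (s2 z) + obound ?B p * ubound (?B + obound ?B p) p"
      using exec_tame[of p n ?B "s2 z" f] le assms by auto
    have "qcount m p = qcount m' p" if "\<And>a. a \<in> controls p \<Longrightarrow> m a = m' a" for m m'
      using that by (induction p) (auto simp: eval_cong[of _ m m'])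
    moreover have "memory (s2 z) a = m1 a" if "a \<in> controls p" for a
    proof -
      have "a \<noteq> 4" "a \<noteq> 8" using that assms(7) by auto
      then show ?thesis by (simp add: s2_def)
    qed
    ultimately have "qcount (memory (s2 z)) p = qcount m1 p" by blast
    then show ?thesis using s' s1(3,4) T(1) by (auto simp: s2_def tbound_def)
  qed
  then obtain fin where fin: "\<And>z. z \<in> tapes N \<Longrightarrow> exec n f (compile p) (s2 z) = return_spmf (fin z) \<and>
      memory (fin z) = den n f p (memory (s2 z)) \<and>
      queries (fin z) \<le> queries s + qcount m1 p \<and> steps (fin z) \<le> steps s + tbound I p B"
    by metis
  have "exec n f (randomized I p) s = bind_spmf (coins N) (\<lambda>z. exec n f (compile p) (s2 z))"
    by (simp add: randomized_def exec_simps s1 T(2) s2_def[symmetric] bind_map_spmf o_def)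
  also have "\<dots> = bind_spmf (coins N) (\<lambda>z. return_spmf (fin z))"
    by (rule bind_spmf_cong) (use fin in \<open>auto simp: set_coins\<close>)
  also have "\<dots> = map_spmf fin (coins N)" by (simp add: map_spmf_conv_bind_spmf)
  finally show ?thesis using fin by (intro exI[of _ fin]) (auto simp: N_def s2_def)
qed

subsection \<open>The two programs\<close>

text \<open>Syntactic criteria for tame assignments: a capped value, possibly plus a bit. The last
  two rules of \<open>capped_intros\<close> are maximum and minimum written with truncated
  subtraction.\<close>

definition capped :: "expr \<Rightarrow> bool" where
  "capped e \<longleftrightarrow> (\<forall>m B. 2 \<le> B \<longrightarrow> mem_le m B \<longrightarrow> eval m e \<le> B)"

definition bit_valued :: "expr \<Rightarrow> bool" where
  "bit_valued e \<longleftrightarrow> (\<forall>m. eval m e \<le> 1)"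

lemma capped_intros:
  "capped (Cell a i)" "capped (Const 0)" "capped (Const 1)" "capped (Const 2)" "capped e \<Longrightarrow> capped (e [-] e')"
  "capped e \<Longrightarrow> capped (half e)" "bit_valued e \<Longrightarrow> capped e"
  "capped (Cell a i [+] (Cell b j [-] Cell a i))"
  "capped (e [-] (e [-] Cell a i))"
proof -
  show "capped e \<Longrightarrow> capped (e [-] e')" by (auto simp: capped_def intro: le_trans[OF diff_le_self])
  show "capped e \<Longrightarrow> capped (half e)" by (auto simp: capped_def intro: le_trans[OF div_le_dividend])
  show "bit_valued e \<Longrightarrow> capped e"
    unfolding capped_def bit_valued_def
  proof (intro allI impI)
    fix m B assume "\<forall>m. eval m e \<le> 1" "(2 :: nat) \<le> B"
    then show "eval m e \<le> B" using order_trans[of "eval m e" 1 B] by auto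
  qed
  show "capped (Cell a i [+] (Cell b j [-] Cell a i))"
  proof -
    have "x + (y - x) \<le> B" if "x \<le> B" "y \<le> B" for x y B :: nat using that by linarith
    then show ?thesis by (simp add: capped_def)
  qed
  show "capped (e [-] (e [-] Cell a i))"
  proof -
    have "x - (x - y) \<le> B" if "y \<le> B" for x y B :: nat using that by linarith
    then show ?thesis by (simp add: capped_def)
  qed
qed (auto simp: capped_def)

lemma bit_valued_intros:
  "bit_valued (parity e)" "bit_valued (e [<] e')" "bit_valued (e [=] e')"
  "bit_valued (Const 1 [-] e)" "bit_valued e \<Longrightarrow> bit_valued e' \<Longrightarrow> bit_valued (e [*] e')"
  "bit_valued (Const 0)" "bit_valued (Const 1)"
proof -
  show "bit_valued e \<Longrightarrow> bit_valued e' \<Longrightarrow> bit_valued (e [*] e')"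
    using mult_le_mono[of "eval _ e" 1 "eval _ e'" 1] by (auto simp: bit_valued_def)
  show "bit_valued (parity e)" by (auto simp: bit_valued_def less_Suc_eq_le[symmetric])
qed (auto simp: bit_valued_def)

lemma increment_intros:
  "capped e \<Longrightarrow> increment e" "capped e \<Longrightarrow> bit_valued e' \<Longrightarrow> increment (e [+] e')"
proof -
  show "capped e \<Longrightarrow> increment e" by (simp add: capped_def increment_def le_SucI)
  show "capped e \<Longrightarrow> bit_valued e' \<Longrightarrow> increment (e [+] e')"
    using add_mono[of "eval _ e" _ "eval _ e'" 1] by (auto simp: capped_def bit_valued_def increment_def)
qed

lemmas tame_intros = capped_intros bit_valued_intros increment_intros

lemma tame_bucket_count: "tame bucket_count"
  unfolding bucket_count_def count_step_def combine_def add_direction_def load_point_def copy_point_def tame.simps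
  by (simp only: tame_intros simp_thms)

lemma tame_verify: "tame verify"
  unfolding verify_def verify_round_def scan_buckets_def count_hits_def count_mismatches_def
    inner_product_def count_duplicates_def compare_vectors_def copy_message_def tame.simps
  by (simp only: tame_intros tame_bucket_count simp_thms)

lemma tame_prove: "tame prove"
  unfolding prove_def tabulate_def add_fillers_def add_filler_def select_top_def select_step_def
    find_candidate_def compare_candidate_def append_candidate_def emit_def tame.simps
  by (simp only: tame_intros tame_bucket_count simp_thms)

lemma tame_choose_buckets: "tame choose_buckets"
  unfolding choose_buckets_def tame.simps
  by (simp only: tame_intros tame_bucket_count simp_thms)

lemma controls_bucket_count: "controls bucket_count = {0, 5}"
  by (auto simp: bucket_count_def count_step_def combine_def add_direction_def load_point_def copy_point_def)

lemma controls_verify: "controls verify = {0, 5}"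
  by (auto simp: verify_def verify_round_def scan_buckets_def count_hits_def count_mismatches_def
    inner_product_def count_duplicates_def compare_vectors_def copy_message_def controls_bucket_count)

lemma controls_prove: "controls prove = {0, 5}"
  by (auto simp: prove_def tabulate_def add_fillers_def add_filler_def select_top_def select_step_def
    find_candidate_def compare_candidate_def append_candidate_def emit_def controls_bucket_count)

lemma staged_init: "staged (init eL eF eQ)"
proof -
  have "controls choose_buckets = {6}" by (simp add: choose_buckets_def)
  moreover have "qcount m choose_buckets = 0" for m by (simp add: choose_buckets_def)
  moreover have "staged choose_buckets \<longleftrightarrow> wf choose_buckets \<and> tame choose_buckets \<and>
      controls choose_buckets \<inter> writes choose_buckets = {} \<and> (\<forall>m. qcount m choose_buckets = 0)"
    unfolding choose_buckets_def by (simp only: staged.simps)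
  ultimately have "staged choose_buckets" using tame_choose_buckets by simp
  then show ?thesis by (simp add: init_def)
qed

lemma qcount_bucket_count: "qcount m bucket_count = m 5 2 * (m 5 1 * 2)"
  by (simp add: bucket_count_def count_step_def combine_def add_direction_def load_point_def copy_point_def)

text \<open>Only the numbers of rounds, buckets and samples occur; \<open>verifier_init\<close>
  computes none of them from n.\<close>

lemma qcount_verify: "qcount m verify = m 5 5 * (m 5 1 * (m 5 2 * (m 5 1 * 2)))"
  by (simp add: verify_def verify_round_def scan_buckets_def count_hits_def count_mismatches_def
    inner_product_def count_duplicates_def compare_vectors_def copy_message_def qcount_bucket_count)

definition "a4 = ea [*] ea [*] ea [*] ea"

text \<open>With \<open>\<theta> = 1 / a\<^sup>2\<close> a round of the verifier fails with probability at most
  \<open>t / 2 ^ k + (1 / 2 ^ k + 2 ^ k / M) * (64 / \<theta>)\<^sup>2\<close>; the constant \<open>98304 = 24 * 64\<^sup>2\<close> makes this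
  at most \<open>1 / 12\<close>. The prover needs all estimates, one for each unit direction, to be within
  \<open>1 / (128 * a\<^sup>2)\<close>, and \<open>32768 = 2 * 128\<^sup>2\<close> makes its failure probability at most \<open>1 / (n + 1)\<close>.\<close>

definition "verifier_init = init (Const 98304 [*] a4 [*] (et [+] Const 1)) (Const 98304 [*] a4) (Const 2 [*] eb)"

definition "prover_init = init (Const 32768 [*] a4 [*] (en [+] Const 1))
   (Const 32768 [*] a4 [*] ((en [+] Const 1) [*] (en [+] Const 1))) (Const 1)"

definition "verifier = randomized verifier_init verify"

definition "prover = randomized prover_init prove"

section \<open>Completeness and soundness\<close>

lemma emeasure_bind_spmf:
  "emeasure (measure_spmf (bind_spmf p g)) A = (\<integral>\<^sup>+x. emeasure (measure_spmf (g x)) A \<partial>measure_spmf p)"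
proof -
  have "emeasure (measure_spmf (bind_spmf p g)) A = emeasure (measure_spmf p \<bind> measure_spmf \<circ> g) A"
    by (simp only: measure_spmf_bind)
  also have "\<dots> = (\<integral>\<^sup>+x. emeasure ((measure_spmf \<circ> g) x) A \<partial>measure_spmf p)"
    by (rule emeasure_bind[where N = "count_space UNIV"])
      (auto simp: space_measure_spmf space_subprob_algebra intro!: subprob_space_measure_spmf)
  finally show ?thesis by simp
qed

text \<open>A randomized prover is a mixture of fixed messages, so soundness is shown for each
  message. Missing mass cannot increase the probability.\<close>

lemma measure_bind_spmf_le:
  assumes "\<And>x. measure (measure_spmf (g x)) A \<le> c" "c \<ge> 0"
  shows "measure (measure_spmf (bind_spmf p g)) A \<le> c"
proof -
  have "emeasure (measure_spmf (bind_spmf p g)) A \<le> (\<integral>\<^sup>+x. ennreal c \<partial>measure_spmf p)"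
    unfolding emeasure_bind_spmf
    by (intro nn_integral_mono) (simp add: measure_spmf.emeasure_eq_measure assms)
  also have "\<dots> \<le> ennreal c * 1"
    by (simp del: mult_1_right) (intro mult_left_mono, auto simp: measure_spmf.emeasure_space_le_1)
  finally show ?thesis using assms(2) by (simp add: measure_spmf.emeasure_eq_measure)
qed

lemma measure_bind_coins:
  "measure (measure_spmf (bind_spmf (coins N) g)) A = avg N (\<lambda>z. measure (measure_spmf (g z)) A)"
proof -
  have "ennreal (measure (measure_spmf (bind_spmf (coins N) g)) A) =
      (\<Sum>z\<in>tapes N. ennreal (measure (measure_spmf (g z)) A)) / ennreal (2 ^ N)"
    by (simp add: measure_spmf.emeasure_eq_measure[symmetric] emeasure_bind_spmf coins_eq
        nn_integral_spmf_of_set card_tapes ennreal_of_nat_eq_real_of_nat)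
  also have "\<dots> = ennreal (avg N (\<lambda>z. measure (measure_spmf (g z)) A))"
    by (simp add: avg_def sum_ennreal divide_ennreal sum_nonneg)
  finally show ?thesis
    by (subst (asm) ennreal_inj) (auto simp: avg_def intro!: divide_nonneg_nonneg sum_nonneg)
qed

section \<open>Runs of the two programs\<close>

lemma start_memory [simp]:
  "memory (start n t \<epsilon> \<delta> w) 0 0 = n" "memory (start n t \<epsilon> \<delta> w) 0 (Suc 0) = t"
  "memory (start n t \<epsilon> \<delta> w) 0 2 = nat \<lceil>1 / \<epsilon>\<rceil>" "memory (start n t \<epsilon> \<delta> w) 0 3 = nat \<lceil>log 2 (1 / \<delta>)\<rceil>"
  "memory (start n t \<epsilon> \<delta> w) (Suc 0) = tape w"
  "a \<ge> 2 \<Longrightarrow> memory (start n t \<epsilon> \<delta> w) a = (\<lambda>_. 0)"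
  "steps (start n t \<epsilon> \<delta> w) = 0" "queries (start n t \<epsilon> \<delta> w) = 0"
  by (simp_all add: start_def)

text \<open>Tape symbols are at most 2, whence the summand 2; the length of the message does not
  enter.\<close>

lemma start_le:
  "mem_le (memory (start n t \<epsilon> \<delta> w)) (n + t + nat \<lceil>1 / \<epsilon>\<rceil> + nat \<lceil>log 2 (1 / \<delta>)\<rceil> + 2)"
proof -
  define a where "a = nat \<lceil>1 / \<epsilon>\<rceil>"
  define b where "b = nat \<lceil>log 2 (1 / \<delta>)\<rceil>"
  have "memory (start n t \<epsilon> \<delta> w) = (\<lambda>_ _. 0)(0 := (\<lambda>_. 0)(0 := n, 1 := t, 2 := a, 3 := b), 1 := tape w)"
    by (simp only: start_def config.simps a_def b_def)
  then show ?thesis unfolding a_def[symmetric] b_def[symmetric] by (simp add: tape_def)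
qed

text \<open>The summand 1 is that of \<open>copy_message\<close>: parity then yields the transmitted
  bit, and cells behind the end of the message count as 1.\<close>

definition vectors :: "nat \<Rightarrow> message \<Rightarrow> nat \<Rightarrow> bit vec" where
  "vectors n w j = read_vec n (\<lambda>i. tape w i + 1) (j * n)"

lemma run_verifier:
  fixes \<epsilon> \<delta> :: real and t :: nat
  defines "a \<equiv> nat \<lceil>1 / \<epsilon>\<rceil>" and "b \<equiv> nat \<lceil>log 2 (1 / \<delta>)\<rceil>"
  assumes f: "f \<in> cube n \<rightarrow> {- 1, 1}" and a: "a > 0"
  shows "\<exists>k M fin. 98304 * (a * a * a * a) * (t + 1) \<le> 2 ^ k \<and> 2 ^ k \<le> 2 * (98304 * (a * a * a * a) * (t + 1)) \<and>
    M = 98304 * (a * a * a * a) * 2 ^ k \<and>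
    run verifier n t \<epsilon> \<delta> f w = map_spmf fin (coins (2 * b * ((k + M) * n))) \<and>
    (\<forall>z\<in>tapes (2 * b * ((k + M) * n)).
      verifier_output n t (fin z) = (if inj_on (vectors n w) {..<t} \<and>
          b \<le> card {r. r < 2 * b \<and> accepts_round n f k M (1 / (real a)\<^sup>2) (vectors n w ` {..<t}) (\<lambda>i. z (r * ((k + M) * n) + i))}
        then Some (vectors n w ` {..<t}) else None) \<and>
      queries (fin z) \<le> 2 * b * (2 ^ k * (M * (2 ^ k * 2))) \<and>
      steps (fin z) \<le> tbound verifier_init verify (n + t + a + b + 2))"
proof -
  define s where "s = start n t \<epsilon> \<delta> w"
  define m1 where "m1 = den n f verifier_init (memory s)"
  have m0: "memory s 0 0 = n" "memory s 0 1 = t" "memory s 0 2 = a" "memory s 0 3 = b" "memory s 1 = tape w"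
    by (simp_all add: s_def a_def b_def)
  have e: "eval (memory s) (Const 98304 [*] a4 [*] (et [+] Const 1)) = 98304 * (a * a * a * a) * (t + 1)"
    "eval (memory s) (Const 98304 [*] a4) = 98304 * (a * a * a * a)" "eval (memory s) (Const 2 [*] eb) = 2 * b"
    using m0 by (simp_all add: a4_def)
  have L: "0 < 98304 * (a * a * a * a) * (t + 1)" using a by simp
  have z5: "\<And>i. memory s 5 i = 0" by (simp add: s_def)
  have ar: "arrays (Const 98304 [*] a4) \<subseteq> {0}" "arrays (Const 2 [*] eb) \<subseteq> {0}" by (simp_all add: a4_def)
  note init = den_init[of "memory s" "Const 98304 [*] a4 [*] (et [+] Const 1)" "Const 98304 [*] a4" "Const 2 [*] eb" n f,
      folded verifier_init_def, folded m1_def, unfolded e m0(1), OF z5 L ar]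
  obtain k M where k: "98304 * (a * a * a * a) * (t + 1) \<le> 2 ^ k" "2 ^ k \<le> 2 * (98304 * (a * a * a * a) * (t + 1))"
    "M = 98304 * (a * a * a * a) * 2 ^ k"
    and m1: "m1 5 0 = k" "m1 5 1 = 2 ^ k" "m1 5 2 = M" "m1 5 3 = M * 2 ^ k" "m1 5 4 = (k + M) * n" "m1 5 5 = 2 * b"
      "m1 5 6 = 2 * b * ((k + M) * n)"
    using init by blast
  have fr: "m1 x = memory s x" if "x \<notin> {5, 6, 7}" for x
    using that by (simp add: m1_def verifier_init_def den_frame)
  have M: "M > 0" using k(3) a by simp
  define B where "B = n + t + a + b + 2"
  have pre: "staged verifier_init" "4 \<notin> writes verifier_init" "wf verify" "tame verify" "controls verify \<inter> writes verify = {}"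
    "controls verify \<subseteq> {0, 5}" "n \<le> B" "2 \<le> B" "mem_le (memory s) B" "memory s 4 = (\<lambda>_. 0)"
  proof -
    show "staged verifier_init" "4 \<notin> writes verifier_init" by (simp_all add: verifier_init_def staged_init)
    show "wf verify" "tame verify" by (simp_all add: tame_verify)
    show "controls verify \<inter> writes verify = {}" by (simp add: controls_verify)
    show "controls verify \<subseteq> {0, 5}" by (simp add: controls_verify)
    show "n \<le> B" "2 \<le> B" by (simp_all add: B_def)
    show "mem_le (memory s) B" unfolding B_def s_def a_def b_def by (rule start_le)
    show "memory s 4 = (\<lambda>_. 0)" by (simp add: s_def)
  qed
  obtain fin where fin: "exec n f verifier s = map_spmf fin (coins (m1 5 6))"
    "\<And>z. z \<in> tapes (m1 5 6) \<Longrightarrow> memory (fin z) = den n f verify (m1(8 := (m1 8)(0 := m1 5 6), 4 := z)) \<and>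
       queries (fin z) \<le> queries s + qcount m1 verify \<and>
       steps (fin z) \<le> steps s + tbound verifier_init verify B"
    using exec_randomized[OF pre, of f, folded verifier_def m1_def] by blast
  show ?thesis
  proof (intro exI conjI ballI)
    show "run verifier n t \<epsilon> \<delta> f w = map_spmf fin (coins (2 * b * ((k + M) * n)))"
      using fin(1) by (simp add: run_def s_def m1)
    fix z assume z: "z \<in> tapes (2 * b * ((k + M) * n))"
    define m where "m = m1(8 := (m1 8)(0 := m1 5 6), 4 := z)"
    have m: "m 0 0 = n" "m 0 1 = t" "m 0 2 = a" "m 5 0 = k" "m 5 1 = 2 ^ k" "m 5 2 = M" "m 5 3 = M * 2 ^ k"
      "m 5 4 = (k + M) * n" "m 5 5 = 2 * b" "m 1 = tape w" "m 4 = z"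
      using m1 m0 by (simp_all add: m_def fr)
    have fz: "memory (fin z) = den n f verify m" "queries (fin z) \<le> qcount m1 verify"
      "steps (fin z) \<le> tbound verifier_init verify (n + t + a + b + 2)"
      using fin(2)[of z] z m1 by (simp_all add: m_def s_def B_def)
    note V = den_verify[OF f m(1-9) M a, unfolded m(10,11), folded vectors_def]
    have "(\<lambda>j. read_vec n (memory (fin z) 3) (j * n)) ` {..<t} = vectors n w ` {..<t}"
      using V(1) by (intro image_cong) (auto simp: fz)
    then show "verifier_output n t (fin z) = (if inj_on (vectors n w) {..<t} \<and>
          b \<le> card {r. r < 2 * b \<and> accepts_round n f k M (1 / (real a)\<^sup>2) (vectors n w ` {..<t}) (\<lambda>i. z (r * ((k + M) * n) + i))}
        then Some (vectors n w ` {..<t}) else None)"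
      using V(2) by (auto simp: verifier_output_def fz)
    show "queries (fin z) \<le> 2 * b * (2 ^ k * (M * (2 ^ k * 2)))"
      using fz(2) m1 by (simp add: qcount_verify)
    show "steps (fin z) \<le> tbound verifier_init verify (n + t + a + b + 2)" by (rule fz)
  qed (use k in auto)
qed

lemma tape_untape:
  assumes "\<And>i. A i \<le> 1"
  shows "tape (untape (\<lambda>i. if i < N then A i + 1 else 0)) = (\<lambda>i. if i < N then A i + 1 else 0)"
    and "length (untape (\<lambda>i. if i < N then A i + 1 else 0)) = N"
proof -
  let ?A = "\<lambda>i. if i < N then A i + 1 else 0 :: nat"
  have L: "(LEAST i. ?A i = 0) = N"
    by (rule Least_equality) (auto split: if_splits)
  show "length (untape ?A) = N" unfolding untape_def L by simp
  have A01: "A i = 0 \<or> A i = 1" for i using assms[of i] by auto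
  show "tape (untape ?A) = ?A"
  proof
    fix i
    show "tape (untape ?A) i = ?A i"
      using A01[of i] unfolding tape_def untape_def L by (auto simp: nth_append)
  qed
qed

lemma run_prover:
  fixes \<epsilon> \<delta> :: real and t :: nat
  defines "a \<equiv> nat \<lceil>1 / \<epsilon>\<rceil>" and "b \<equiv> nat \<lceil>log 2 (1 / \<delta>)\<rceil>"
  assumes f: "f \<in> cube n \<rightarrow> {- 1, 1}" and a: "a > 0"
  shows "\<exists>k M fin. 32768 * (a * a * a * a) * (n + 1) \<le> 2 ^ k \<and>
    M = 32768 * (a * a * a * a) * ((n + 1) * (n + 1)) * 2 ^ k \<and>
    run prover n t \<epsilon> \<delta> f [] = map_spmf fin (coins ((k + M) * n)) \<and>
    (\<forall>z\<in>tapes ((k + M) * n). length (prover_message (fin z)) = t * n \<and>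
      steps (fin z) \<le> tbound prover_init prove (n + t + a + b + 2) \<and>
      (t \<le> 2 ^ n \<longrightarrow> inj_on (vectors n (prover_message (fin z))) {..<t} \<and>
        (\<forall>h>0. separated n f k h (block n z) \<longrightarrow> accurate n f k M {..n} h z \<longrightarrow>
          sq_top n f (10 * h) (vectors n (prover_message (fin z)) ` {..<t}))))"
proof -
  define s where "s = start n t \<epsilon> \<delta> []"
  define m1 where "m1 = den n f prover_init (memory s)"
  have t0: "tape [] = (\<lambda>_. 0)" by (simp add: tape_def fun_eq_iff)
  have m0: "memory s 0 0 = n" "memory s 0 1 = t" "memory s 0 2 = a" "memory s 0 3 = b" "memory s 1 = (\<lambda>_. 0)"
    by (simp_all add: s_def a_def b_def t0)
  have e: "eval (memory s) (Const 32768 [*] a4 [*] (en [+] Const 1)) = 32768 * (a * a * a * a) * (n + 1)"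
    "eval (memory s) (Const 32768 [*] a4 [*] ((en [+] Const 1) [*] (en [+] Const 1))) = 32768 * (a * a * a * a) * ((n + 1) * (n + 1))"
    "eval (memory s) (Const 1) = 1"
    using m0 by (simp_all add: a4_def)
  have L: "0 < 32768 * (a * a * a * a) * (n + 1)" using a by simp
  have z5: "\<And>i. memory s 5 i = 0" by (simp add: s_def)
  have ar: "arrays (Const 32768 [*] a4 [*] ((en [+] Const 1) [*] (en [+] Const 1))) \<subseteq> {0}" "arrays (Const 1) \<subseteq> {0}"
    by (simp_all add: a4_def)
  note init = den_init[of "memory s" "Const 32768 [*] a4 [*] (en [+] Const 1)"
      "Const 32768 [*] a4 [*] ((en [+] Const 1) [*] (en [+] Const 1))" "Const 1" n f,
      folded prover_init_def, folded m1_def, unfolded e m0(1), OF z5 L ar]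
  obtain k M where k: "32768 * (a * a * a * a) * (n + 1) \<le> 2 ^ k"
    "M = 32768 * (a * a * a * a) * ((n + 1) * (n + 1)) * 2 ^ k"
    and m1: "m1 5 0 = k" "m1 5 1 = 2 ^ k" "m1 5 2 = M" "m1 5 3 = M * 2 ^ k" "m1 5 6 = (k + M) * n"
    using init by (simp only: mult_1) blast
  have fr: "m1 x = memory s x" if "x \<notin> {5, 6, 7}" for x
    using that by (simp add: m1_def prover_init_def den_frame)
  have M: "M > 0" using k(2) a by simp
  define B where "B = n + t + a + b + 2"
  have pre: "staged prover_init" "4 \<notin> writes prover_init" "wf prove" "tame prove" "controls prove \<inter> writes prove = {}"
    "controls prove \<subseteq> {0, 5}" "n \<le> B" "2 \<le> B" "mem_le (memory s) B" "memory s 4 = (\<lambda>_. 0)"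
  proof -
    show "staged prover_init" "4 \<notin> writes prover_init" by (simp_all add: prover_init_def staged_init)
    show "wf prove" "tame prove" by (simp_all add: tame_prove)
    show "controls prove \<inter> writes prove = {}" by (simp add: controls_prove)
    show "controls prove \<subseteq> {0, 5}" by (simp add: controls_prove)
    show "n \<le> B" "2 \<le> B" by (simp_all add: B_def)
    show "mem_le (memory s) B" unfolding B_def s_def a_def b_def by (rule start_le)
    show "memory s 4 = (\<lambda>_. 0)" by (simp add: s_def)
  qed
  obtain fin where fin: "exec n f prover s = map_spmf fin (coins (m1 5 6))"
    "\<And>z. z \<in> tapes (m1 5 6) \<Longrightarrow> memory (fin z) = den n f prove (m1(8 := (m1 8)(0 := m1 5 6), 4 := z)) \<and>
       queries (fin z) \<le> queries s + qcount m1 prove \<and>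
       steps (fin z) \<le> steps s + tbound prover_init prove B"
    using exec_randomized[OF pre, of f, folded prover_def m1_def] by blast
  have "length (prover_message (fin z)) = t * n \<and>
      steps (fin z) \<le> tbound prover_init prove (n + t + a + b + 2) \<and>
      (t \<le> 2 ^ n \<longrightarrow> inj_on (vectors n (prover_message (fin z))) {..<t} \<and>
        (\<forall>h>0. separated n f k h (block n z) \<longrightarrow> accurate n f k M {..n} h z \<longrightarrow>
          sq_top n f (10 * h) (vectors n (prover_message (fin z)) ` {..<t})))"
    if z: "z \<in> tapes ((k + M) * n)" for z
  proof -
    define m where "m = m1(8 := (m1 8)(0 := m1 5 6), 4 := z)"
    have m: "m 0 0 = n" "m 0 1 = t" "m 5 0 = k" "m 5 1 = 2 ^ k" "m 5 2 = M" "m 5 3 = M * 2 ^ k"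
      using m1 m0 by (simp_all add: m_def fr)
    have z': "(\<lambda>i. m 4 (m 22 0 * m 5 4 + i)) = z" by (simp add: m_def fr s_def)
    have i: "\<And>i. m 1 i = 0" "\<And>i. m 41 i = 0" "\<And>i. m 42 i = 0" "m 44 0 = 0"
      using m0(5) by (simp_all add: m_def fr s_def)
    obtain A where A: "\<And>i. A i \<le> 1" "den n f prove m 1 = (\<lambda>i. if i < t * n then A i + 1 else 0)"
      and top: "t \<le> 2 ^ n \<Longrightarrow> inj_on (\<lambda>j. read_vec n A (j * n)) {..<t} \<and>
        (\<forall>h > 0. separated n f k h (block n z) \<longrightarrow> accurate n f k M {..n} h z \<longrightarrow>
        sq_top n f (10 * h) ((\<lambda>j. read_vec n A (j * n)) ` {..<t}))"
      using den_prove[OF f m M i] unfolding z' by blast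
    have fz: "memory (fin z) = den n f prove m"
      "steps (fin z) \<le> tbound prover_init prove (n + t + a + b + 2)"
      using fin(2)[of z] z m1 by (simp_all add: m_def s_def B_def)
    have msg: "prover_message (fin z) = untape (\<lambda>i. if i < t * n then A i + 1 else 0)"
      by (simp only: prover_message_def fz A(2))
    have v: "vectors n (prover_message (fin z)) j = read_vec n A (j * n)" if "j < t" for j
    proof -
      have "j * n + l < t * n" if "l < n" for l using index_less[OF \<open>j < t\<close> that] .
      \<comment> \<open>\<open>emit\<close> has added 1 and \<open>vectors\<close> adds another;
        together they leave the parity of \<open>A\<close> unchanged.\<close>
      then show ?thesis
        unfolding vectors_def msg tape_untape(1)[OF A(1)]
        by (intro eq_vecI) (auto simp: read_vec_def of_nat_bit)
    qed
    have "vectors n (prover_message (fin z)) ` {..<t} = (\<lambda>j. read_vec n A (j * n)) ` {..<t}"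
      by (intro image_cong) (auto simp: v)
    moreover have "inj_on (vectors n (prover_message (fin z))) {..<t} = inj_on (\<lambda>j. read_vec n A (j * n)) {..<t}"
      by (intro inj_on_cong) (simp add: v)
    ultimately show ?thesis using top fz(2) tape_untape(2)[OF A(1)] by (simp add: msg)
  qed
  then show ?thesis
    using k fin(1) by (intro exI[of _ k] exI[of _ M] exI[of _ fin]) (simp add: run_def s_def m1)
qed

section \<open>From single rounds to the guarantees of the protocol\<close>

lemma accepts_round_cong:
  assumes "\<And>i. i < (k + M) * n \<Longrightarrow> z i = z' i"
  shows "accepts_round n f k M \<theta> \<Gamma> z = accepts_round n f k M \<theta> \<Gamma> z'"
proof -
  have b: "block n z l = block n z' l" if "l < k + M" for l
    using assms index_less[OF that] by (auto simp: block_def read_vec_def)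
  have "estimate n f k M z c J = estimate n f k M z' c J" for c J
    unfolding estimate_def
    by (intro arg_cong2[where f = "(/)"] sum.cong refl) (simp add: b sample_cong[of k "block n z" "block n z'"])
  then show ?thesis
    unfolding accepts_round_def using in_bucket_cong[of k "block n z" "block n z'"] b by simp
qed

text \<open>For b the absolute value at \<beta>, b^2 + \<theta> \<le> b^2 + \<epsilon>^2 \<le> (b +
  \<epsilon>)^2; then roots are taken.\<close>

lemma is_top_if_sq_top:
  assumes "sq_top n f \<theta> \<Gamma>" "\<Gamma> \<subseteq> cube n" "\<theta> \<le> \<epsilon>\<^sup>2" "\<epsilon> > 0"
  shows "is_top n f \<epsilon> \<Gamma>"
  unfolding is_top_def
proof (intro conjI ballI)
  fix \<alpha> \<beta> assume "\<alpha> \<in> cube n - \<Gamma>" "\<beta> \<in> \<Gamma>"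
  then have "(fourier n f \<alpha>)\<^sup>2 \<le> (fourier n f \<beta>)\<^sup>2 + \<theta>" using assms(1) by (simp add: sq_top_def sqf_def)
  also have "\<dots> \<le> (\<bar>fourier n f \<beta>\<bar> + \<epsilon>)\<^sup>2"
  proof -
    have "0 \<le> 2 * \<bar>fourier n f \<beta>\<bar> * \<epsilon>" using assms(4) by simp
    moreover have "(\<bar>fourier n f \<beta>\<bar> + \<epsilon>)\<^sup>2 = (fourier n f \<beta>)\<^sup>2 + \<epsilon>\<^sup>2 + 2 * \<bar>fourier n f \<beta>\<bar> * \<epsilon>"
      by (simp add: power2_sum)
    ultimately show ?thesis using assms(3) by linarith
  qed
  finally have le: "\<bar>fourier n f \<alpha>\<bar>\<^sup>2 \<le> (\<bar>fourier n f \<beta>\<bar> + \<epsilon>)\<^sup>2" by simp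
  show "\<bar>fourier n f \<alpha>\<bar> \<le> \<bar>fourier n f \<beta>\<bar> + \<epsilon>"
    by (rule power2_le_imp_le[OF le]) (use assms(4) in simp)
qed (rule assms(2))

lemma vectors_carrier: "vectors n w ` S \<subseteq> cube n"
  by (auto simp: vectors_def read_vec_def)

text \<open>Here (64 / \<theta>)^2 = 4096 * a^4. The choice of \<open>M\<close> makes the sampling
  term exactly 1 / 24, and 98304 = 24 * 4096 bounds the terms with t / 2 ^ k and 1 / 2 ^ k together
  by another 1 / 24.\<close>

lemma round_error_le:
  fixes a t k M :: nat
  assumes a: "a > 0" and K: "98304 * (a * a * a * a) * (t + 1) \<le> 2 ^ k" and M: "M = 98304 * (a * a * a * a) * 2 ^ k"
  shows "t / 2 ^ k + (1 / 2 ^ k + 2 ^ k / M) * (64 / (1 / (real a)\<^sup>2))\<^sup>2 \<le> 1 / 12"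
proof -
  define A where "A = real (a * a * a * a)"
  have "a * a * a * a > 0" using a by simp
  then have A: "A \<ge> 1" unfolding A_def by linarith
  have "real (98304 * (a * a * a * a) * (t + 1)) \<le> real (2 ^ k)" using K by (simp only: of_nat_le_iff)
  then have K': "98304 * A * (t + 1) \<le> 2 ^ k" by (simp add: A_def algebra_simps)
  have q: "(64 / (1 / (real a)\<^sup>2))\<^sup>2 = 4096 * A"
    by (simp add: A_def power2_eq_square)
  have "real M = 98304 * A * 2 ^ k" by (simp add: M A_def)
  then have m: "2 ^ k / real M * (4096 * A) = 1 / 24" using A by simp
  have "t + 4096 * A \<le> 4096 * A * (t + 1)"
  proof -
    have "1 * real t \<le> (4096 * A) * real t" using A by (intro mult_right_mono) auto
    then show ?thesis by (simp add: algebra_simps)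
  qed
  also have "\<dots> \<le> 2 ^ k / 24" using K' by simp
  finally have "(t + 4096 * A) / 2 ^ k \<le> 1 / 24" by (simp add: field_simps)
  moreover have "t / 2 ^ k + (1 / 2 ^ k + 2 ^ k / real M) * (4096 * A) =
      (t + 4096 * A) / 2 ^ k + 2 ^ k / real M * (4096 * A)"
    by (simp add: add_divide_distrib distrib_right)
  ultimately show ?thesis unfolding q using m by linarith
qed

lemma confidence_le:
  assumes "\<delta> > 0"
  shows "1 / 2 ^ nat \<lceil>log 2 (1 / \<delta>)\<rceil> \<le> \<delta>"
proof -
  have "log 2 (1 / \<delta>) \<le> real (nat \<lceil>log 2 (1 / \<delta>)\<rceil>)" by (rule of_nat_ceiling)
  then have "1 / \<delta> \<le> 2 powr real (nat \<lceil>log 2 (1 / \<delta>)\<rceil>)"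
    using assms by (simp add: log_le_iff)
  then have "1 / \<delta> \<le> 2 ^ nat \<lceil>log 2 (1 / \<delta>)\<rceil>" by (simp add: powr_realpow)
  then show ?thesis using assms by (simp add: field_simps)
qed

lemma accuracy:
  assumes "\<epsilon> > 0"
  shows "nat \<lceil>1 / \<epsilon>\<rceil> > 0" "1 / (real (nat \<lceil>1 / \<epsilon>\<rceil>))\<^sup>2 \<le> \<epsilon>\<^sup>2"
proof -
  define a where "a = nat \<lceil>1 / \<epsilon>\<rceil>"
  have le: "1 / \<epsilon> \<le> real a" unfolding a_def by (rule of_nat_ceiling)
  moreover have "0 < 1 / \<epsilon>" using assms by simp
  ultimately have pos: "real a > 0" by linarith
  have "1 / real a \<le> \<epsilon>" using le assms pos by (simp add: field_simps)
  then have "(1 / real a)\<^sup>2 \<le> \<epsilon>\<^sup>2" using pos by (intro power_mono) auto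
  then show "nat \<lceil>1 / \<epsilon>\<rceil> > 0" "1 / (real (nat \<lceil>1 / \<epsilon>\<rceil>))\<^sup>2 \<le> \<epsilon>\<^sup>2"
    using pos unfolding a_def[symmetric] by (simp_all add: power_divide)
qed

text \<open>A fixed message fixes the claimed set, and an error requires at least \<open>b\<close>
  of 2 * b independent rounds to accept it although some square gap exceeds 1 / a^2.\<close>

lemma verifier_sound:
  assumes f: "f \<in> cube n \<rightarrow> {- 1, 1}" and \<epsilon>: "\<epsilon> > 0" and \<delta>: "\<delta> > 0"
  shows "measure (measure_spmf (map_spmf (verifier_output n t) (run verifier n t \<epsilon> \<delta> f w)))
    {Some \<Lambda> | \<Lambda>. \<not> is_top n f \<epsilon> \<Lambda>} \<le> \<delta>"
proof -
  define a where "a = nat \<lceil>1 / \<epsilon>\<rceil>"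
  define b where "b = nat \<lceil>log 2 (1 / \<delta>)\<rceil>"
  define \<Gamma> where "\<Gamma> = vectors n w ` {..<t}"
  have a: "a > 0" "1 / (real a)\<^sup>2 \<le> \<epsilon>\<^sup>2" using accuracy[OF \<epsilon>] by (simp_all add: a_def)
  obtain k M fin where k: "98304 * (a * a * a * a) * (t + 1) \<le> 2 ^ k" "M = 98304 * (a * a * a * a) * 2 ^ k"
    and run: "run verifier n t \<epsilon> \<delta> f w = map_spmf fin (coins (2 * b * ((k + M) * n)))"
    and out: "\<And>z. z \<in> tapes (2 * b * ((k + M) * n)) \<Longrightarrow> verifier_output n t (fin z) = (if inj_on (vectors n w) {..<t} \<and>
          b \<le> card {r. r < 2 * b \<and> accepts_round n f k M (1 / (real a)\<^sup>2) \<Gamma> (\<lambda>i. z (r * ((k + M) * n) + i))}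
        then Some \<Gamma> else None)"
    using run_verifier[OF f, of \<epsilon> t \<delta> w] a(1) unfolding a_def b_def \<Gamma>_def by blast
  define Q where "Q = accepts_round n f k M (1 / (real a)\<^sup>2) \<Gamma>"
  have "measure (measure_spmf (map_spmf (verifier_output n t) (run verifier n t \<epsilon> \<delta> f w)))
      {Some \<Lambda> | \<Lambda>. \<not> is_top n f \<epsilon> \<Lambda>} =
     avg (2 * b * ((k + M) * n)) (\<lambda>z. of_bool (verifier_output n t (fin z) \<in> {Some \<Lambda> | \<Lambda>. \<not> is_top n f \<epsilon> \<Lambda>}))"
    unfolding run by (simp add: measure_map_spmf vimage_def measure_coins)
  also have "\<dots> \<le> 1 / 2 ^ b"
  proof (cases "is_top n f \<epsilon> \<Gamma>")
    case True
    have "avg (2 * b * ((k + M) * n)) (\<lambda>z. of_bool (verifier_output n t (fin z) \<in> {Some \<Lambda> | \<Lambda>. \<not> is_top n f \<epsilon> \<Lambda>})) \<le>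
       avg (2 * b * ((k + M) * n)) (\<lambda>z. 0)"
      by (rule avg_mono) (use out True in auto)
    also have "\<dots> \<le> 1 / 2 ^ b" by simp
    finally show ?thesis .
  next
    case False
    have \<Gamma>: "\<Gamma> \<subseteq> cube n" by (simp add: \<Gamma>_def vectors_carrier)
    have nt: "\<not> sq_top n f (1 / (real a)\<^sup>2) \<Gamma>" using False is_top_if_sq_top[OF _ \<Gamma> a(2) \<epsilon>] by blast
    have p: "avg ((k + M) * n) (\<lambda>z. of_bool (Q z)) \<le> 1 / 12"
    proof -
      have "avg ((k + M) * n) (\<lambda>z. of_bool (Q z)) \<le> card \<Gamma> / 2 ^ k + (1 / 2 ^ k + 2 ^ k / M) * (64 / (1 / (real a)\<^sup>2))\<^sup>2"
        unfolding Q_def by (rule round_sound[OF f _ _ _ \<Gamma> nt]) (use a k in auto)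
      also have "card \<Gamma> \<le> t" unfolding \<Gamma>_def using card_image_le[of "{..<t}"] by simp
      then have "card \<Gamma> / 2 ^ k + (1 / 2 ^ k + 2 ^ k / M) * (64 / (1 / (real a)\<^sup>2))\<^sup>2 \<le>
        t / 2 ^ k + (1 / 2 ^ k + 2 ^ k / M) * (64 / (1 / (real a)\<^sup>2))\<^sup>2"
        by (intro add_mono divide_right_mono) auto
      also have "\<dots> \<le> 1 / 12" by (rule round_error_le[OF a(1) k])
      finally show ?thesis .
    qed
    have "avg (2 * b * ((k + M) * n)) (\<lambda>z. of_bool (verifier_output n t (fin z) \<in> {Some \<Lambda> | \<Lambda>. \<not> is_top n f \<epsilon> \<Lambda>})) \<le>
      avg (2 * b * ((k + M) * n)) (\<lambda>z. of_bool (card {r. r < 2 * b \<and> Q (\<lambda>i. z (r * ((k + M) * n) + i))} \<ge> b))"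
      by (rule avg_mono) (use out in \<open>auto simp: Q_def\<close>)
    also have "\<dots> \<le> 1 / 2 ^ b"
      by (rule majority_le[OF _ p]) (unfold Q_def, rule accepts_round_cong, simp)
    finally show ?thesis .
  qed
  also have "\<dots> \<le> \<delta>" unfolding b_def by (rule confidence_le[OF \<delta>])
  finally show ?thesis .
qed

lemma verifier_complete:
  assumes f: "f \<in> cube n \<rightarrow> {- 1, 1}" and \<epsilon>: "\<epsilon> > 0" and \<delta>: "\<delta> > 0"
    and inj: "inj_on (vectors n w) {..<t}"
    and top: "sq_top n f (5 / (64 * (real (nat \<lceil>1 / \<epsilon>\<rceil>))\<^sup>2)) (vectors n w ` {..<t})"
  shows "measure (measure_spmf (map_spmf (verifier_output n t) (run verifier n t \<epsilon> \<delta> f w)))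
    {Some \<Lambda> | \<Lambda>. is_top n f (\<epsilon> / 3) \<Lambda>} \<ge> 1 - \<delta>"
proof -
  define a where "a = nat \<lceil>1 / \<epsilon>\<rceil>"
  define b where "b = nat \<lceil>log 2 (1 / \<delta>)\<rceil>"
  define \<Gamma> where "\<Gamma> = vectors n w ` {..<t}"
  have a: "a > 0" "1 / (real a)\<^sup>2 \<le> \<epsilon>\<^sup>2" using accuracy[OF \<epsilon>] by (simp_all add: a_def)
  have \<Gamma>: "\<Gamma> \<subseteq> cube n" by (simp add: \<Gamma>_def vectors_carrier)
  have top': "sq_top n f (5 * (1 / (real a)\<^sup>2) / 64) \<Gamma>" using top by (simp add: a_def \<Gamma>_def mult.commute)
  \<comment> \<open>This is where \<epsilon> / 3 comes from: 5 / 64 \<le> 1 / 9.\<close>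
  have "5 * (1 / (real a)\<^sup>2) / 64 \<le> (\<epsilon> / 3)\<^sup>2"
  proof -
    define y where "y = 1 / (real a)\<^sup>2"
    have "0 \<le> y" "y \<le> \<epsilon>\<^sup>2" using a(2) by (simp_all add: y_def)
    moreover have "(\<epsilon> / 3)\<^sup>2 = \<epsilon>\<^sup>2 / 9" by (simp add: power_divide)
    ultimately show ?thesis unfolding y_def[symmetric] by linarith
  qed
  then have is_top: "is_top n f (\<epsilon> / 3) \<Gamma>" using is_top_if_sq_top[OF top' \<Gamma>] \<epsilon> by simp
  obtain k M fin where k: "98304 * (a * a * a * a) * (t + 1) \<le> 2 ^ k" "M = 98304 * (a * a * a * a) * 2 ^ k"
    and run: "run verifier n t \<epsilon> \<delta> f w = map_spmf fin (coins (2 * b * ((k + M) * n)))"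
    and out: "\<And>z. z \<in> tapes (2 * b * ((k + M) * n)) \<Longrightarrow> verifier_output n t (fin z) = (if inj_on (vectors n w) {..<t} \<and>
          b \<le> card {r. r < 2 * b \<and> accepts_round n f k M (1 / (real a)\<^sup>2) \<Gamma> (\<lambda>i. z (r * ((k + M) * n) + i))}
        then Some \<Gamma> else None)"
    using run_verifier[OF f, of \<epsilon> t \<delta> w] a(1) unfolding a_def b_def \<Gamma>_def by blast
  define Q where "Q z \<longleftrightarrow> \<not> accepts_round n f k M (1 / (real a)\<^sup>2) \<Gamma> z" for z
  have p: "avg ((k + M) * n) (\<lambda>z. of_bool (Q z)) \<le> 1 / 12"
  proof -
    have "avg ((k + M) * n) (\<lambda>z. of_bool (Q z)) \<le> (1 / 2 ^ k + 2 ^ k / M) * (64 / (1 / (real a)\<^sup>2))\<^sup>2"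
      unfolding Q_def by (rule round_complete[OF f _ _ \<Gamma> top']) (use a k in auto)
    also have "\<dots> \<le> t / 2 ^ k + (1 / 2 ^ k + 2 ^ k / M) * (64 / (1 / (real a)\<^sup>2))\<^sup>2" by simp
    also have "\<dots> \<le> 1 / 12" by (rule round_error_le[OF a(1) k])
    finally show ?thesis .
  qed
  have bad: "avg (2 * b * ((k + M) * n)) (\<lambda>z. of_bool (card {r. r < 2 * b \<and> Q (\<lambda>i. z (r * ((k + M) * n) + i))} \<ge> b)) \<le> 1 / 2 ^ b"
    by (rule majority_le[OF _ p]) (unfold Q_def, subst accepts_round_cong, auto)
  have "1 - \<delta> \<le> 1 - 1 / 2 ^ b" unfolding b_def using confidence_le[OF \<delta>] by simp
  also have "\<dots> \<le> avg (2 * b * ((k + M) * n)) (\<lambda>z. 1 - of_bool (card {r. r < 2 * b \<and> Q (\<lambda>i. z (r * ((k + M) * n) + i))} \<ge> b))"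
    using bad by (simp add: avg_diff)
  also have "\<dots> \<le> avg (2 * b * ((k + M) * n)) (\<lambda>z. of_bool (verifier_output n t (fin z) \<in> {Some \<Lambda> | \<Lambda>. is_top n f (\<epsilon> / 3) \<Lambda>}))"
  proof (rule avg_mono)
    fix z assume z: "z \<in> tapes (2 * b * ((k + M) * n))"
    let ?P = "\<lambda>r. accepts_round n f k M (1 / (real a)\<^sup>2) \<Gamma> (\<lambda>i. z (r * ((k + M) * n) + i))"
    have "card {r. r < 2 * b \<and> ?P r} + card {r. r < 2 * b \<and> \<not> ?P r} = card ({r. r < 2 * b \<and> ?P r} \<union> {r. r < 2 * b \<and> \<not> ?P r})"
      by (rule card_Un_disjoint[symmetric]) auto
    also have "{r. r < 2 * b \<and> ?P r} \<union> {r. r < 2 * b \<and> \<not> ?P r} = {..<2 * b}" by auto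
    finally have sum: "card {r. r < 2 * b \<and> ?P r} + card {r. r < 2 * b \<and> \<not> ?P r} = 2 * b" by simp
    show "1 - of_bool (card {r. r < 2 * b \<and> Q (\<lambda>i. z (r * ((k + M) * n) + i))} \<ge> b) \<le>
      (of_bool (verifier_output n t (fin z) \<in> {Some \<Lambda> | \<Lambda>. is_top n f (\<epsilon> / 3) \<Lambda>}) :: real)"
    proof (cases "card {r. r < 2 * b \<and> \<not> ?P r} \<ge> b")
      case False
      then have "b \<le> card {r. r < 2 * b \<and> ?P r}" using sum by linarith
      then have "verifier_output n t (fin z) = Some \<Gamma>" using out[OF z] inj by simp
      then show ?thesis using is_top by simp
    qed (simp add: Q_def)
  qed
  also have "\<dots> = measure (measure_spmf (map_spmf (verifier_output n t) (run verifier n t \<epsilon> \<delta> f w)))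
      {Some \<Lambda> | \<Lambda>. is_top n f (\<epsilon> / 3) \<Lambda>}"
    unfolding run by (simp add: measure_map_spmf vimage_def measure_coins)
  finally show ?thesis .
qed

text \<open>This \<open>h\<close> makes 10 * h the squared gap 5 * \<theta> / 64 that
  \<open>round_complete\<close> tolerates. Bucketing and sampling fail with probability at most 1 /
  (2 * (n + 1)) each; of the two factors n + 1 in \<open>M\<close>, one pays for the n + 1
  directions.\<close>

lemma prover_error_le:
  fixes a n k M :: nat
  assumes f: "f \<in> cube n \<rightarrow> {- 1, 1}" and a: "a > 0" and K: "32768 * (a * a * a * a) * (n + 1) \<le> 2 ^ k"
    and M: "M = 32768 * (a * a * a * a) * ((n + 1) * (n + 1)) * 2 ^ k"
  defines "h \<equiv> 1 / (128 * (real a)\<^sup>2)"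
  shows "avg ((k + M) * n) (\<lambda>z. of_bool (\<not> separated n f k h (block n z) \<or> \<not> accurate n f k M {..n} h z)) \<le> 1 / (n + 1)"
proof -
  define A where "A = real (a * a * a * a)"
  have "a * a * a * a > 0" using a by simp
  then have A: "A \<ge> 1" unfolding A_def by linarith
  have h: "h > 0" using a by (simp add: h_def)
  have h2: "h\<^sup>2 = 1 / (16384 * A)" by (simp add: h_def A_def power2_eq_square)
  have "real (32768 * (a * a * a * a) * (n + 1)) \<le> real (2 ^ k)" using K by (simp only: of_nat_le_iff)
  then have K': "32768 * A * (n + 1) \<le> 2 ^ k" by (simp add: A_def algebra_simps)
  have M': "real M = 32768 * A * ((real n + 1) * (real n + 1)) * 2 ^ k" by (simp add: M A_def algebra_simps)
  have "avg ((k + M) * n) (\<lambda>z. of_bool (\<not> separated n f k h (block n z) \<or> \<not> accurate n f k M {..n} h z)) \<le>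
     1 / (2 ^ k * h\<^sup>2) + 2 ^ k * card {..n} / (M * h\<^sup>2)"
    using inseparable_le[OF f h, of k M] inaccurate_le[OF f h, of M "{..n}" k] M a
    by (intro order_trans[OF avg_disj_le] add_mono) auto
  also have "1 / (2 ^ k * h\<^sup>2) \<le> 1 / (2 * (real n + 1))"
    unfolding h2 using K' A by (simp add: field_simps)
  also have "2 ^ k * card {..n} / (M * h\<^sup>2) = 1 / (2 * (real n + 1))"
  proof -
    define q where "q = real n + 1"
    have q: "q > 0" and n: "real n = q - 1" by (simp_all add: q_def)
    show ?thesis unfolding h2 M' using A q by (simp add: n field_simps)
  qed
  also have "1 / (2 * (real n + 1)) + 1 / (2 * (real n + 1)) = 1 / (n + 1)" by (simp add: field_simps)
  finally show ?thesis by simp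
qed


section \<open>The protocol\<close>

lemma poly_bounded_real:
  assumes "poly_bounded g"
  shows "\<exists>C k. C \<ge> 0 \<and> (\<forall>x y C' k'. real (1 + x) \<le> 5 * y \<longrightarrow> 1 \<le> y \<longrightarrow> C \<le> C' \<longrightarrow> k \<le> k' \<longrightarrow> real (g x) \<le> C' * y ^ k')"
proof -
  obtain C k where C: "\<And>x. g x \<le> C * (1 + x) ^ k" using assms unfolding poly_bounded_def by blast
  have "real (g x) \<le> C' * y ^ k'"
    if "real (1 + x) \<le> 5 * y" "1 \<le> y" "real C * 5 ^ k \<le> C'" "k \<le> k'" for x y C' k'
  proof -
    have "real (g x) \<le> real (C * (1 + x) ^ k)" using C by (simp only: of_nat_le_iff)
    also have "\<dots> = real C * real (1 + x) ^ k" by simp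
    also have "\<dots> \<le> real C * (5 * y) ^ k" using that(1) by (intro mult_left_mono power_mono) auto
    also have "\<dots> = real C * 5 ^ k * y ^ k" by (simp add: power_mult_distrib)
    also have "\<dots> \<le> C' * y ^ k'"
    proof (rule mult_mono)
      have "0 \<le> real C * 5 ^ k" by simp
      then show "0 \<le> C'" using that(3) by linarith
    qed (use that in \<open>auto intro: power_increasing\<close>)
    finally show ?thesis .
  qed
  then show ?thesis by (intro exI[of _ "real C * 5 ^ k"] exI[of _ k]) simp
qed

text \<open>The average over the prover's tape is taken outside: a good tape yields a message that
  meets the assumptions of \<open>verifier_complete\<close>; for a bad one the lower bound 1 -
  \<delta> - 1 is negative.\<close>

lemma interaction_complete:
  assumes f: "f \<in> cube n \<rightarrow> {- 1, 1}" and \<epsilon>: "\<epsilon> > 0" and \<delta>: "\<delta> > 0" and t: "t \<le> 2 ^ n"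
  shows "measure (measure_spmf (interaction verifier (program_prover prover) n t \<epsilon> \<delta> f))
    {Some \<Lambda> | \<Lambda>. is_top n f (\<epsilon> / 3) \<Lambda>} \<ge> 1 - \<delta> - 1 / (n + 1)"
proof -
  define a where "a = nat \<lceil>1 / \<epsilon>\<rceil>"
  define h where "h = 1 / (128 * (real a)\<^sup>2)"
  define X where "X = {Some \<Lambda> | \<Lambda>. is_top n f (\<epsilon> / 3) \<Lambda>}"
  have a: "a > 0" using accuracy(1)[OF \<epsilon>] by (simp add: a_def)
  have h: "h > 0" "10 * h = 5 / (64 * (real a)\<^sup>2)" using a by (simp_all add: h_def)
  obtain k M fin where k: "32768 * (a * a * a * a) * (n + 1) \<le> 2 ^ k"
    "M = 32768 * (a * a * a * a) * ((n + 1) * (n + 1)) * 2 ^ k"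
    and run: "run prover n t \<epsilon> \<delta> f [] = map_spmf fin (coins ((k + M) * n))"
    and out: "\<And>z. z \<in> tapes ((k + M) * n) \<Longrightarrow> inj_on (vectors n (prover_message (fin z))) {..<t} \<and>
        (\<forall>h>0. separated n f k h (block n z) \<longrightarrow> accurate n f k M {..n} h z \<longrightarrow>
          sq_top n f (10 * h) (vectors n (prover_message (fin z)) ` {..<t}))"
    using run_prover[OF f, of \<epsilon> t \<delta>] a t unfolding a_def by blast
  define g where "g = (\<lambda>z. map_spmf (verifier_output n t) (run verifier n t \<epsilon> \<delta> f (prover_message (fin z))))"
  have "interaction verifier (program_prover prover) n t \<epsilon> \<delta> f = bind_spmf (coins ((k + M) * n)) g"
    by (simp add: interaction_def program_prover_def run g_def bind_map_spmf o_def spmf.map_comp)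
  then have eq: "measure (measure_spmf (interaction verifier (program_prover prover) n t \<epsilon> \<delta> f)) X =
      avg ((k + M) * n) (\<lambda>z. measure (measure_spmf (g z)) X)"
    by (simp only: measure_bind_coins)
  have "1 - \<delta> - 1 / (n + 1) \<le> 1 - \<delta> - avg ((k + M) * n) (\<lambda>z. of_bool (\<not> separated n f k h (block n z) \<or> \<not> accurate n f k M {..n} h z))"
    using prover_error_le[OF f a k] by (simp add: h_def)
  also have "\<dots> = avg ((k + M) * n) (\<lambda>z. 1 - \<delta> - of_bool (\<not> separated n f k h (block n z) \<or> \<not> accurate n f k M {..n} h z))"
    by (simp only: avg_diff avg_const)
  also have "\<dots> \<le> avg ((k + M) * n) (\<lambda>z. measure (measure_spmf (g z)) X)"
  proof (rule avg_mono)
    fix z assume z: "z \<in> tapes ((k + M) * n)"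
    show "1 - \<delta> - of_bool (\<not> separated n f k h (block n z) \<or> \<not> accurate n f k M {..n} h z) \<le> measure (measure_spmf (g z)) X"
    proof (cases "separated n f k h (block n z) \<and> accurate n f k M {..n} h z")
      case True
      then have "sq_top n f (5 / (64 * (real (nat \<lceil>1 / \<epsilon>\<rceil>))\<^sup>2)) (vectors n (prover_message (fin z)) ` {..<t})"
        using out[OF z] h unfolding a_def[symmetric] h(2)[symmetric] by blast
      then have "1 - \<delta> \<le> measure (measure_spmf (g z)) X"
        unfolding g_def X_def using verifier_complete[OF f \<epsilon> \<delta>] out[OF z] by blast
      then show ?thesis using True by simp
    next
      case False
      then have "1 - \<delta> - of_bool (\<not> separated n f k h (block n z) \<or> \<not> accurate n f k M {..n} h z) \<le> 0"
        using \<delta> by auto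
      then show ?thesis using measure_nonneg order_trans by blast
    qed
  qed
  finally show ?thesis unfolding eq[symmetric] of_nat_add of_nat_1 unfolding X_def .
qed

theorem theorem4p9:
  shows "\<exists>(V :: com) (Pstar :: com) (C :: real) (k :: nat) (\<eta> :: nat \<Rightarrow> real).
    \<eta> \<longlonglongrightarrow> 0 \<and>
    (\<forall>(n :: nat) (t :: nat) (\<epsilon> :: real) (\<delta> :: real) (f :: bit vec \<Rightarrow> real).
      \<epsilon> > 0 \<longrightarrow> \<delta> > 0 \<longrightarrow> f \<in> carrier_vec n \<rightarrow> {-1, 1} \<longrightarrow>
      \<comment> \<open>the verifier, on every message\<close>
      (\<forall>w. lossless_spmf (run V n t \<epsilon> \<delta> f w) \<and>
        (\<forall>s \<in> set_spmf (run V n t \<epsilon> \<delta> f w).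
          real (queries s) \<le> C * (1 + real t + 1 / \<epsilon> + log_inv \<delta>) ^ k \<and>
          real (steps s) \<le> C * (1 + real n + real t + 1 / \<epsilon> + log_inv \<delta>) ^ k \<and>
          (\<forall>\<Lambda>. verifier_output n t s = Some \<Lambda> \<longrightarrow> \<Lambda> \<subseteq> carrier_vec n \<and> card \<Lambda> = t))) \<and>
      \<comment> \<open>the honest prover\<close>
      lossless_spmf (run Pstar n t \<epsilon> \<delta> f []) \<and>
      (\<forall>s \<in> set_spmf (run Pstar n t \<epsilon> \<delta> f []).
        real (steps s) \<le> C * (1 + real n + real t + 1 / \<epsilon> + log_inv \<delta>) ^ k \<and>
        length (prover_message s) = t * n) \<and>
      \<comment> \<open>completeness; a subset of size t exists only if t is at most 2 ^ n\<close>
      (t \<le> 2 ^ n \<longrightarrow>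
        measure (measure_spmf (interaction V (program_prover Pstar) n t \<epsilon> \<delta> f))
          {Some \<Lambda> | \<Lambda>. is_top n f (\<epsilon> / 3) \<Lambda>} \<ge> 1 - \<delta> - \<eta> n) \<and>
      \<comment> \<open>soundness\<close>
      (\<forall>P :: prover.
        measure (measure_spmf (interaction V P n t \<epsilon> \<delta> f))
          {Some \<Lambda> | \<Lambda>. \<not> is_top n f \<epsilon> \<Lambda>} \<le> \<delta> + \<eta> n))"
proof -
  \<comment> \<open>The query bound of the verifier, with 2 ^ k and \<open>M\<close> replaced by
    upper bounds and every parameter by x = t + a + b, in which n does not occur.\<close>
  define qb where "qb x = 2 * x * (2 * (98304 * (x * x * x * x) * (x + 1)) *
    (98304 * (x * x * x * x) * (2 * (98304 * (x * x * x * x) * (x + 1))) *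
    (2 * (98304 * (x * x * x * x) * (x + 1)) * 2)))" for x :: nat
  have pq: "poly_bounded qb"
    unfolding qb_def by (simp only: poly_bounded_intros)
  have two: "poly_bounded (\<lambda>x. x + 2)" by (intro poly_bounded_intros)
  have pv: "poly_bounded (\<lambda>x. tbound verifier_init verify (x + 2))"
    by (rule poly_bounded_comp[OF poly_bounded_tbound two])
  have pp: "poly_bounded (\<lambda>x. tbound prover_init prove (x + 2))"
    by (rule poly_bounded_comp[OF poly_bounded_tbound two])
  obtain C1 k1 where C1: "C1 \<ge> 0" "\<And>x y C' k'. real (1 + x) \<le> 5 * y \<Longrightarrow> 1 \<le> y \<Longrightarrow> C1 \<le> C' \<Longrightarrow> k1 \<le> k' \<Longrightarrow>
      real (qb x) \<le> C' * y ^ k'"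
    using poly_bounded_real[OF pq] by blast
  obtain C2 k2 where C2: "C2 \<ge> 0" "\<And>x y C' k'. real (1 + x) \<le> 5 * y \<Longrightarrow> 1 \<le> y \<Longrightarrow> C2 \<le> C' \<Longrightarrow> k2 \<le> k' \<Longrightarrow>
      real (tbound verifier_init verify (x + 2)) \<le> C' * y ^ k'"
    using poly_bounded_real[OF pv] by blast
  obtain C3 k3 where C3: "C3 \<ge> 0" "\<And>x y C' k'. real (1 + x) \<le> 5 * y \<Longrightarrow> 1 \<le> y \<Longrightarrow> C3 \<le> C' \<Longrightarrow> k3 \<le> k' \<Longrightarrow>
      real (tbound prover_init prove (x + 2)) \<le> C' * y ^ k'"
    using poly_bounded_real[OF pp] by blast
  define C where "C = C1 + C2 + C3"
  define kk where "kk = k1 + k2 + k3"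
  have Ck: "C1 \<le> C" "C2 \<le> C" "C3 \<le> C" "k1 \<le> kk" "k2 \<le> kk" "k3 \<le> kk"
    using C1(1) C2(1) C3(1) by (simp_all add: C_def kk_def)
  \<comment> \<open>The failure probability of the prover; soundness is obtained with \<delta>
    itself.\<close>
  define \<eta> where "\<eta> n = 1 / (real n + 1)" for n :: nat
  have \<eta>: "\<eta> \<longlonglongrightarrow> 0"
  proof -
    have "(\<lambda>n. inverse (real (Suc n))) \<longlonglongrightarrow> 0" by (rule LIMSEQ_inverse_real_of_nat)
    moreover have "\<eta> = (\<lambda>n. inverse (real (Suc n)))"
      by (rule ext) (simp add: \<eta>_def inverse_eq_divide add.commute)
    ultimately show ?thesis by simp
  qed
  show ?thesis
  proof (rule exI[of _ verifier], rule exI[of _ prover], rule exI[of _ C], rule exI[of _ kk], rule exI[of _ \<eta>],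
      intro conjI allI impI ballI)
    show "\<eta> \<longlonglongrightarrow> 0" by (rule \<eta>)
  next
    fix n t :: nat and \<epsilon> \<delta> :: real and f :: "bit vec \<Rightarrow> real"
    assume \<epsilon>: "\<epsilon> > 0" and \<delta>: "\<delta> > 0" and f: "f \<in> cube n \<rightarrow> {- 1, 1}"
    define a where "a = nat \<lceil>1 / \<epsilon>\<rceil>"
    define b where "b = nat \<lceil>log 2 (1 / \<delta>)\<rceil>"
    have a: "a > 0" using accuracy(1)[OF \<epsilon>] by (simp add: a_def)
    have a_le: "real a \<le> 1 / \<epsilon> + 1"
    proof -
      have "0 < 1 / \<epsilon>" using \<epsilon> by simp
      then show ?thesis unfolding a_def by linarith
    qed
    have b_le: "real b \<le> log_inv \<delta> + 1" unfolding b_def log_inv_def by linarith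
    have l0: "log_inv \<delta> \<ge> 0" "1 / \<epsilon> > 0" using \<epsilon> by (simp_all add: log_inv_def)
    have sums: "real (1 + (t + a + b)) = 1 + real t + real a + real b"
      "real (1 + (n + t + a + b)) = 1 + real n + real t + real a + real b" by simp_all
    have lin: "1 + T + A + B \<le> 5 * (1 + T + E + L)" "1 \<le> 1 + T + E + L"
      if "0 \<le> T" "0 < E" "0 \<le> L" "A \<le> E + 1" "B \<le> L + 1" for T A B E L :: real
      using that by (simp_all add: algebra_simps)
    have yq: "real (1 + (t + a + b)) \<le> 5 * (1 + real t + 1 / \<epsilon> + log_inv \<delta>)" "1 \<le> 1 + real t + 1 / \<epsilon> + log_inv \<delta>"
      unfolding sums using lin[OF _ l0(2,1) a_le b_le, of "real t"] by simp_all
    have ys: "real (1 + (n + t + a + b)) \<le> 5 * (1 + real n + real t + 1 / \<epsilon> + log_inv \<delta>)"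
      "1 \<le> 1 + real n + real t + 1 / \<epsilon> + log_inv \<delta>"
      unfolding sums using lin[OF _ l0(2,1) a_le b_le, of "real n + real t"] by (simp_all add: add.assoc)
    {
      fix w
      obtain k M fin where K: "2 ^ k \<le> 2 * (98304 * (a * a * a * a) * (t + 1))" "M = 98304 * (a * a * a * a) * 2 ^ k"
        and run: "run verifier n t \<epsilon> \<delta> f w = map_spmf fin (coins (2 * b * ((k + M) * n)))"
        and fin: "\<And>z. z \<in> tapes (2 * b * ((k + M) * n)) \<Longrightarrow>
          verifier_output n t (fin z) = (if inj_on (vectors n w) {..<t} \<and>
            b \<le> card {r. r < 2 * b \<and> accepts_round n f k M (1 / (real a)\<^sup>2) (vectors n w ` {..<t}) (\<lambda>i. z (r * ((k + M) * n) + i))}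
            then Some (vectors n w ` {..<t}) else None) \<and>
          queries (fin z) \<le> 2 * b * (2 ^ k * (M * (2 ^ k * 2))) \<and>
          steps (fin z) \<le> tbound verifier_init verify (n + t + a + b + 2)"
        using run_verifier[OF f, of \<epsilon> t \<delta> w] a unfolding a_def b_def by blast
      show "lossless_spmf (run verifier n t \<epsilon> \<delta> f w)" unfolding run by (simp add: lossless_coins)
      fix s assume "s \<in> set_spmf (run verifier n t \<epsilon> \<delta> f w)"
      then obtain z where z: "z \<in> tapes (2 * b * ((k + M) * n))" "s = fin z"
        unfolding run by (auto simp: set_coins)
      define x where "x = t + a + b"
      have x: "a \<le> x" "t + 1 \<le> x + 1" "b \<le> x" by (simp_all add: x_def)
      have p4: "a * a * a * a \<le> x * x * x * x" by (intro mult_le_mono x)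
      have PK: "2 ^ k \<le> 2 * (98304 * (x * x * x * x) * (x + 1))"
        by (rule order_trans[OF K(1)]) (intro mult_le_mono p4 x order_refl)
      have PM: "M \<le> 98304 * (x * x * x * x) * (2 * (98304 * (x * x * x * x) * (x + 1)))"
        unfolding K(2) by (intro mult_le_mono p4 PK order_refl)
      have "queries s \<le> 2 * b * (2 ^ k * (M * (2 ^ k * 2)))" using fin[OF z(1)] z(2) by simp
      also have "\<dots> \<le> qb x" unfolding qb_def by (intro mult_le_mono PK PM x order_refl)
      finally have "real (queries s) \<le> real (qb (t + a + b))" by (simp only: of_nat_le_iff x_def)
      also have "\<dots> \<le> C * (1 + real t + 1 / \<epsilon> + log_inv \<delta>) ^ kk" by (rule C1(2)[OF yq Ck(1,4)])
      finally show "real (queries s) \<le> C * (1 + real t + 1 / \<epsilon> + log_inv \<delta>) ^ kk" .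
      have "real (steps s) \<le> real (tbound verifier_init verify (n + t + a + b + 2))"
        using fin[OF z(1)] z(2) by simp
      also have "\<dots> \<le> C * (1 + real n + real t + 1 / \<epsilon> + log_inv \<delta>) ^ kk" by (rule C2(2)[OF ys Ck(2,5)])
      finally show "real (steps s) \<le> C * (1 + real n + real t + 1 / \<epsilon> + log_inv \<delta>) ^ kk" .
      fix \<Lambda> assume "verifier_output n t s = Some \<Lambda>"
      then have \<Lambda>: "inj_on (vectors n w) {..<t}" "\<Lambda> = vectors n w ` {..<t}"
        using fin[OF z(1)] z(2) by (auto split: if_splits)
      show "\<Lambda> \<subseteq> cube n" using \<Lambda>(2) vectors_carrier by simp
      show "card \<Lambda> = t" using \<Lambda> by (simp add: card_image)
    }
    obtain k M fin where run: "run prover n t \<epsilon> \<delta> f [] = map_spmf fin (coins ((k + M) * n))"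
      and fin: "\<And>z. z \<in> tapes ((k + M) * n) \<Longrightarrow> length (prover_message (fin z)) = t * n \<and>
        steps (fin z) \<le> tbound prover_init prove (n + t + a + b + 2)"
      using run_prover[OF f, of \<epsilon> t \<delta>] a unfolding a_def b_def by blast
    show "lossless_spmf (run prover n t \<epsilon> \<delta> f [])" unfolding run by (simp add: lossless_coins)
    {
      fix s assume "s \<in> set_spmf (run prover n t \<epsilon> \<delta> f [])"
      then obtain z where z: "z \<in> tapes ((k + M) * n)" "s = fin z"
        unfolding run by (auto simp: set_coins)
      have "real (steps s) \<le> real (tbound prover_init prove (n + t + a + b + 2))"
        using fin[OF z(1)] z(2) by simp
      also have "\<dots> \<le> C * (1 + real n + real t + 1 / \<epsilon> + log_inv \<delta>) ^ kk" by (rule C3(2)[OF ys Ck(3,6)])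
      finally show "real (steps s) \<le> C * (1 + real n + real t + 1 / \<epsilon> + log_inv \<delta>) ^ kk" .
      show "length (prover_message s) = t * n" using fin[OF z(1)] z(2) by simp
    }
    show "measure (measure_spmf (interaction verifier (program_prover prover) n t \<epsilon> \<delta> f))
        {Some \<Lambda> | \<Lambda>. is_top n f (\<epsilon> / 3) \<Lambda>} \<ge> 1 - \<delta> - \<eta> n" if "t \<le> 2 ^ n"
      using interaction_complete[OF f \<epsilon> \<delta> that] by (simp add: \<eta>_def add.commute)
    fix P :: prover
    have "measure (measure_spmf (interaction verifier P n t \<epsilon> \<delta> f)) {Some \<Lambda> | \<Lambda>. \<not> is_top n f \<epsilon> \<Lambda>} \<le> \<delta>"
      unfolding interaction_def using \<delta> by (intro measure_bind_spmf_le verifier_sound[OF f \<epsilon> \<delta>]) simp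
    also have "\<delta> \<le> \<delta> + \<eta> n" by (simp add: \<eta>_def)
    finally show "measure (measure_spmf (interaction verifier P n t \<epsilon> \<delta> f)) {Some \<Lambda> | \<Lambda>. \<not> is_top n f \<epsilon> \<Lambda>} \<le> \<delta> + \<eta> n" .
  qed
qed

end
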